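(* Let $H$ be a complex Hilbert space with $\dim H<\infty$, let $n=2\ell$, and let $A(\lambda)=A_0+\lambda A_1+\dots+\lambda^nA_n$ be an operator pencil in $H$ such that (i) $\operatorname{Im}(A(\lambda)x,x)\le 0$ for all $x\in H$ and all $\lambda\in\mathbb R$; (ii) $\operatorname{Ker}A_n=\{0\}$; (iii) there is a point $\lambda_0\in\mathbb R$ such that $0\notin\theta(A(\lambda_0))$. Then both systems $\mathscr E^+$ and $\mathscr E^-$ are complete in the space $H^\ell$.
   Context: Notation. $\theta(B)=\{(Bu,u):\|u\|=1\}$ is the numerical range of $B$; $[\gamma]$ is the largest integer $\le\gamma$; $A^*(\lambda)=[A(\bar\lambda)]^*$; $(\cdot,z)w$ is the operator $x\mapsto (x,z)w$. Chains. Vectors $w^0\ne0,w^1,\dots,w^p$ form a chain of eigen and associated vectors of length $p+1$ at the eigenvalue $c$ if $\sum_{j=0}^{s}\frac1{j!}A^{(j)}(c)w^{s-j}=0$ for $s=0,\dots,p$. A canonical system at $c$ is a family of chains $w_k^0,\dots,w_k^{p_k}$ $(k=1,\dots,N)$ such that $\{w_k^0\}$ is a basis of $\operatorname{Ker}A(c)$ and $\sum_k(p_k+1)$ is the maximal possible. The principal part of $A^{-1}(\lambda)$ at $c$ then has the form $$\sum_{k=1}^N\sum_{s=0}^{p_k}\frac{\sum_{r=0}^{s}(\cdot,z_k^{s-r})w_k^{r}}{(\lambda-c)^{p_k+1-s}},$$ where $z_k^0,\dots,z_k^{p_k}$ $(k=1,\dots,N)$ is a canonical system of $A^*(\lambda)$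 at $\bar c$, uniquely determined by $\{w_k^h\}$ and called the adjoint canonical system. Keldysh derived chains. Given a canonical system at $c$, put $v_k^h(t)=e^{ict}\sum_{r=0}^h\frac{(it)^r}{r!}w_k^{h-r}$ (elementary solutions). The Keldysh derived chain of length $m$ corresponding to $w_k^h$ is the vector $\{v_k^h(0),-i(v_k^h)'(0),\dots,(-i)^{m-1}(v_k^h)^{(m-1)}(0)\}\in H^m$. For $m=n$ it is denoted $\tilde w_k^h$, and $\tilde z_k^h$ is formed in the same way from the adjoint chains at $\bar c$. Regular canonical systems and sign characteristics. Let $c$ be a real eigenvalue. A canonical system at $c$ is called regular if for every $k$ with $p_k=2\ell_k$ even there is $\varepsilon_k\in\{1,-1\}$ such that $\tilde z_k^{\ell_k}-\varepsilon_k\tilde w_k^{\ell_k}$ belongs to the span of $\{\tilde w_j^h:\ 1\le j\le N,\ 0\le h\le[(p_j-1)/2]\}$ (nothing is taken from a chain with $p_j=0$). Regular systems exist for pencils satisfying (i). The numbers $\varepsilon_k$ are the sign characteristics; for chains of even length ($p_k$ odd) one puts $\varepsilon_k=0$. Halves. Number the chains over all eigenvalues $\lambda_k$, each eigenvalue repeated according to its geometric multiplicity, using any canonical systems at non-real eigenvalues and regular ones at real eigenvalues. Let $$E^{\pm}=\{w_k^h:\ \pm\operatorname{Im}\lambda_k>0,\ 0\le h\le p_k\}\cup\{w_k^h:\ \lambda_k\in\mathbb R,\ 0\le h\le[(p_k\pm\varepsilon_k)/2]\},$$ where for $p_k=0$ and $\pm\varepsilon_k=-1$ nothing is taken. $\mathscr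 E^\pm$ is the system of Keldysh derived chains of length $\ell$ corresponding to the vectors of $E^\pm$. A system is complete if only the zero vector is orthogonal to all its elements. *)

theory Defs
  imports "HOL-Analysis.Analysis" "HOL-Library.Function_Algebras"
begin

section \<open>Complex inner product spaces\<close>

text \<open>The inner product is linear in the first argument.  Positive definiteness and
  \<open>(x,x) = \<parallel>x\<parallel>\<^sup>2\<close> follow from the real inner product being \<open>Re (x,y)\<close>.\<close>

class complex_inner = real_inner +
  fixes scaleC :: "complex \<Rightarrow> 'a \<Rightarrow> 'a" (infixr "*\<^sub>C" 75)
    and cinner :: "'a \<Rightarrow> 'a \<Rightarrow> complex"
  assumes scaleC_add_right: "a *\<^sub>C (x + y) = a *\<^sub>C x + a *\<^sub>C y"
    and scaleC_add_left: "(a + b) *\<^sub>C x = a *\<^sub>C x + b *\<^sub>C x"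
    and scaleC_scaleC: "a *\<^sub>C b *\<^sub>C x = (a * b) *\<^sub>C x"
    and scaleR_scaleC: "scaleR r x = complex_of_real r *\<^sub>C x"
    and cinner_add_left: "cinner (x + y) z = cinner x z + cinner y z"
    and cinner_scaleC_left: "cinner (a *\<^sub>C x) y = a * cinner x y"
    and cinner_commute: "cinner y x = cnj (cinner x y)"
    and inner_cinner: "inner x y = Re (cinner x y)"

global_interpretation complex_vector:
  vector_space "scaleC :: complex \<Rightarrow> 'a \<Rightarrow> 'a::complex_inner"
proof
  show "1 *\<^sub>C x = x" for x :: 'a
    using scaleR_scaleC[of 1 x] by simp
qed (simp_all add: scaleC_add_right scaleC_add_left scaleC_scaleC)

text \<open>A finite-dimensional inner product space is complete, hence a Hilbert space.\<close>

definition cfinite_dim :: "'a::complex_inner itself \<Rightarrow> bool" where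
  "cfinite_dim _ \<longleftrightarrow> (\<exists>B :: 'a set. finite B \<and> complex_vector.span B = UNIV)"

definition clinear :: "('a::complex_inner \<Rightarrow> 'a) \<Rightarrow> bool" where
  "clinear = Vector_Spaces.linear scaleC scaleC"

definition cadjoint :: "('a::complex_inner \<Rightarrow> 'a) \<Rightarrow> 'a \<Rightarrow> 'a" where
  "cadjoint T = (THE S. \<forall>x y. cinner (T x) y = cinner x (S y))"

definition numerical_range :: "('a::complex_inner \<Rightarrow> 'a) \<Rightarrow> complex set" where
  "numerical_range B = {cinner (B u) u | u. norm u = 1}"


section \<open>Operator pencils and canonical systems\<close>

definition pencil :: "(nat \<Rightarrow> 'a::complex_inner \<Rightarrow> 'a) \<Rightarrow> nat \<Rightarrow> complex \<Rightarrow> 'a \<Rightarrow> 'a" where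
  "pencil A n \<mu> x = (\<Sum>i\<le>n. \<mu> ^ i *\<^sub>C A i x)"

text \<open>The \<open>j\<close>-th derivative in \<open>\<mu>\<close>, computed on the scalar factors \<open>\<mu> ^ i\<close>.\<close>

definition pencil_deriv ::
    "(nat \<Rightarrow> 'a::complex_inner \<Rightarrow> 'a) \<Rightarrow> nat \<Rightarrow> nat \<Rightarrow> complex \<Rightarrow> 'a \<Rightarrow> 'a" where
  "pencil_deriv A n j \<mu> x = (\<Sum>i\<le>n. (deriv ^^ j) (\<lambda>\<zeta>. \<zeta> ^ i) \<mu> *\<^sub>C A i x)"

text \<open>Coefficients of \<open>A\<^sup>*(\<mu>) = [A(cnj \<mu>)]\<^sup>*\<close>, which is the sum of \<open>\<mu> ^ i A\<^sub>i\<^sup>*\<close>.\<close>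

definition adjoint_pencil :: "(nat \<Rightarrow> 'a::complex_inner \<Rightarrow> 'a) \<Rightarrow> nat \<Rightarrow> 'a \<Rightarrow> 'a" where
  "adjoint_pencil A i = cadjoint (A i)"

definition pencil_ker :: "(nat \<Rightarrow> 'a::complex_inner \<Rightarrow> 'a) \<Rightarrow> nat \<Rightarrow> complex \<Rightarrow> 'a set" where
  "pencil_ker A n c = {x. pencil A n c x = 0}"

definition eigenvalue :: "(nat \<Rightarrow> 'a::complex_inner \<Rightarrow> 'a) \<Rightarrow> nat \<Rightarrow> complex \<Rightarrow> bool" where
  "eigenvalue A n c \<longleftrightarrow> (\<exists>x. x \<noteq> 0 \<and> x \<in> pencil_ker A n c)"

text \<open>The chain \<open>w 0, \<dots>, w p\<close> has length \<open>p + 1\<close>; values \<open>w h\<close> with \<open>h > p\<close> are irrelevant.\<close>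

definition eigen_chain ::
    "(nat \<Rightarrow> 'a::complex_inner \<Rightarrow> 'a) \<Rightarrow> nat \<Rightarrow> complex \<Rightarrow> nat \<Rightarrow> (nat \<Rightarrow> 'a) \<Rightarrow> bool" where
  "eigen_chain A n c p w \<longleftrightarrow> w 0 \<noteq> 0 \<and>
     (\<forall>s\<le>p. (\<Sum>j\<le>s. (1 / fact j) *\<^sub>C pencil_deriv A n j c (w (s - j))) = 0)"

text \<open>In a family of chains with index set \<open>I\<close>, the \<open>k\<close>-th chain is \<open>w k 0, \<dots>, w k (p k)\<close>.\<close>

definition chain_family ::
    "(nat \<Rightarrow> 'a::complex_inner \<Rightarrow> 'a) \<Rightarrow> nat \<Rightarrow> complex \<Rightarrow>
     nat set \<Rightarrow> (nat \<Rightarrow> nat) \<Rightarrow> (nat \<Rightarrow> nat \<Rightarrow> 'a) \<Rightarrow> bool" where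
  "chain_family A n c I p w \<longleftrightarrow> finite I \<and>
     (\<forall>k\<in>I. eigen_chain A n c (p k) (w k)) \<and>
     inj_on (\<lambda>k. w k 0) I \<and>
     complex_vector.independent ((\<lambda>k. w k 0) ` I) \<and>
     complex_vector.span ((\<lambda>k. w k 0) ` I) = pencil_ker A n c"

definition canonical_system ::
    "(nat \<Rightarrow> 'a::complex_inner \<Rightarrow> 'a) \<Rightarrow> nat \<Rightarrow> complex \<Rightarrow>
     nat set \<Rightarrow> (nat \<Rightarrow> nat) \<Rightarrow> (nat \<Rightarrow> nat \<Rightarrow> 'a) \<Rightarrow> bool" where
  "canonical_system A n c I p w \<longleftrightarrow> chain_family A n c I p w \<and>
     (\<forall>J q u. chain_family A n c J q u \<longrightarrow> (\<Sum>k\<in>J. q k + 1) \<le> (\<Sum>k\<in>I. p k + 1))"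

definition polar_sum ::
    "complex \<Rightarrow> nat set \<Rightarrow> (nat \<Rightarrow> nat) \<Rightarrow> (nat \<Rightarrow> nat \<Rightarrow> 'a::complex_inner) \<Rightarrow>
     (nat \<Rightarrow> nat \<Rightarrow> 'a) \<Rightarrow> complex \<Rightarrow> 'a \<Rightarrow> 'a" where
  "polar_sum c I p w z \<mu> x = (\<Sum>k\<in>I. \<Sum>s\<le>p k.
     (1 / (\<mu> - c) ^ (p k + 1 - s)) *\<^sub>C (\<Sum>r\<le>s. cinner x (z k (s - r)) *\<^sub>C w k r))"

text \<open>The second conjunct says that \<open>polar_sum\<close> is the principal part of \<open>A(\<mu>)\<^sup>-\<^sup>1\<close> at \<open>c\<close>: the
  difference is regular at \<open>c\<close>.  In finite dimension this may be tested on matrix elements.\<close>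

definition adjoint_canonical_system ::
    "(nat \<Rightarrow> 'a::complex_inner \<Rightarrow> 'a) \<Rightarrow> nat \<Rightarrow> complex \<Rightarrow>
     nat set \<Rightarrow> (nat \<Rightarrow> nat) \<Rightarrow> (nat \<Rightarrow> nat \<Rightarrow> 'a) \<Rightarrow> (nat \<Rightarrow> nat \<Rightarrow> 'a) \<Rightarrow> bool" where
  "adjoint_canonical_system A n c I p w z \<longleftrightarrow>
     canonical_system (adjoint_pencil A) n (cnj c) I p z \<and>
     (\<forall>x y. \<exists>g. g analytic_on {c} \<and>
        (\<forall>\<^sub>F \<mu> in at c. bij (pencil A n \<mu>) \<and>
           cinner (inv (pencil A n \<mu>) x - polar_sum c I p w z \<mu> x) y = g \<mu>))"


section \<open>Keldysh derived chains\<close>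

definition elementary_solution ::
    "complex \<Rightarrow> (nat \<Rightarrow> 'a::complex_inner) \<Rightarrow> nat \<Rightarrow> real \<Rightarrow> 'a" where
  "elementary_solution c w h t =
     exp (\<i> * c * of_real t) *\<^sub>C (\<Sum>r\<le>h. ((\<i> * of_real t) ^ r / fact r) *\<^sub>C w (h - r))"

text \<open>Elements of \<open>H\<^sup>m\<close> are sequences that vanish from position \<open>m\<close> on; the linear structure is
  pointwise.\<close>

definition Hpow :: "nat \<Rightarrow> (nat \<Rightarrow> 'a::complex_inner) set" where
  "Hpow m = {f. \<forall>j\<ge>m. f j = 0}"

definition Hpow_inner :: "nat \<Rightarrow> (nat \<Rightarrow> 'a::complex_inner) \<Rightarrow> (nat \<Rightarrow> 'a) \<Rightarrow> complex" where
  "Hpow_inner m f g = (\<Sum>j<m. cinner (f j) (g j))"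

definition Hpow_scale :: "complex \<Rightarrow> (nat \<Rightarrow> 'a::complex_inner) \<Rightarrow> nat \<Rightarrow> 'a" where
  "Hpow_scale a f = (\<lambda>j. a *\<^sub>C f j)"

global_interpretation Hpow: vector_space Hpow_scale
  by unfold_locales
    (simp_all add: Hpow_scale_def fun_eq_iff scaleC_add_right scaleC_add_left scaleC_scaleC)

definition keldysh_chain ::
    "nat \<Rightarrow> complex \<Rightarrow> (nat \<Rightarrow> 'a::complex_inner) \<Rightarrow> nat \<Rightarrow> nat \<Rightarrow> 'a" where
  "keldysh_chain m c w h = (\<lambda>j. if j < m then
     (- \<i>) ^ j *\<^sub>C ((\<lambda>v t. vector_derivative v (at t)) ^^ j) (elementary_solution c w h) 0
     else 0)"

definition complete_in_Hpow :: "nat \<Rightarrow> (nat \<Rightarrow> 'a::complex_inner) set \<Rightarrow> bool" where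
  "complete_in_Hpow m S \<longleftrightarrow> (\<forall>f\<in>Hpow m. (\<forall>g\<in>S. Hpow_inner m f g = 0) \<longrightarrow> f = 0)"


section \<open>Regular canonical systems and half systems\<close>

text \<open>The system is regular and \<open>\<epsilon>\<close> gives its sign characteristics.  Integer division rounds
  downwards, so nothing is taken from a chain with \<open>p j = 0\<close>.\<close>

definition regular_system ::
    "(nat \<Rightarrow> 'a::complex_inner \<Rightarrow> 'a) \<Rightarrow> nat \<Rightarrow> complex \<Rightarrow>
     nat set \<Rightarrow> (nat \<Rightarrow> nat) \<Rightarrow> (nat \<Rightarrow> nat \<Rightarrow> 'a) \<Rightarrow> (nat \<Rightarrow> int) \<Rightarrow> bool" where
  "regular_system A n c I p w \<epsilon> \<longleftrightarrow> c \<in> \<real> \<and> canonical_system A n c I p w \<and>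
     (\<exists>z. adjoint_canonical_system A n c I p w z \<and>
       (\<forall>k\<in>I. if even (p k)
          then \<epsilon> k \<in> {1, -1} \<and>
            keldysh_chain n (cnj c) (z k) (p k div 2)
              - Hpow_scale (of_int (\<epsilon> k)) (keldysh_chain n c (w k) (p k div 2))
            \<in> Hpow.span {keldysh_chain n c (w j) h | j h. j \<in> I \<and> int h \<le> (int (p j) - 1) div 2}
          else \<epsilon> k = 0))"

text \<open>All chains are numbered by \<open>k < M\<close>, the \<open>k\<close>-th one belonging to the eigenvalue \<open>\<Lambda> k\<close>.
  The values of \<open>\<epsilon>\<close> at non-real eigenvalues play no role.\<close>

definition chain_numbering ::
    "(nat \<Rightarrow> 'a::complex_inner \<Rightarrow> 'a) \<Rightarrow> nat \<Rightarrow> nat \<Rightarrow> (nat \<Rightarrow> complex) \<Rightarrow>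
     (nat \<Rightarrow> nat) \<Rightarrow> (nat \<Rightarrow> nat \<Rightarrow> 'a) \<Rightarrow> (nat \<Rightarrow> int) \<Rightarrow> bool" where
  "chain_numbering A n M \<Lambda> p w \<epsilon> \<longleftrightarrow>
     (\<forall>k<M. eigenvalue A n (\<Lambda> k)) \<and>
     (\<forall>c. eigenvalue A n c \<longrightarrow>
        (if c \<in> \<real> then regular_system A n c {k. k < M \<and> \<Lambda> k = c} p w \<epsilon>
         else canonical_system A n c {k. k < M \<and> \<Lambda> k = c} p w))"

text \<open>Pairs \<open>(k, h)\<close> indexing the vectors \<open>w k h\<close> of \<open>E\<^sup>+\<close> (for \<open>\<sigma> = 1\<close>) and \<open>E\<^sup>-\<close> (for
  \<open>\<sigma> = -1\<close>).\<close>

definition half_index ::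
    "int \<Rightarrow> nat \<Rightarrow> (nat \<Rightarrow> complex) \<Rightarrow> (nat \<Rightarrow> nat) \<Rightarrow> (nat \<Rightarrow> int) \<Rightarrow> (nat \<times> nat) set" where
  "half_index \<sigma> M \<Lambda> p \<epsilon> =
     {(k, h). k < M \<and> of_int \<sigma> * Im (\<Lambda> k) > 0 \<and> h \<le> p k} \<union>
     {(k, h). k < M \<and> \<Lambda> k \<in> \<real> \<and> int h \<le> (int (p k) + \<sigma> * \<epsilon> k) div 2}"

definition half_system ::
    "int \<Rightarrow> nat \<Rightarrow> nat \<Rightarrow> (nat \<Rightarrow> complex) \<Rightarrow> (nat \<Rightarrow> nat) \<Rightarrow>
     (nat \<Rightarrow> nat \<Rightarrow> 'a::complex_inner) \<Rightarrow> (nat \<Rightarrow> int) \<Rightarrow> (nat \<Rightarrow> 'a) set" where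
  "half_system \<sigma> m M \<Lambda> p w \<epsilon> =
     {keldysh_chain m (\<Lambda> k) (w k) h | k h. (k, h) \<in> half_index \<sigma> M \<Lambda> p \<epsilon>}"

end

theory Submission
  imports Defs "HOL-Complex_Analysis.Complex_Analysis"
begin

text \<open>
  Let \<open>f = (f\<^sub>0, \<dots>, f\<^sub>l\<^sub>-\<^sub>1)\<close> be orthogonal to one of the half systems, say to the one for the upper
  half plane, and put \<open>F(\<mu>) = \<Sum>\<^sub>j \<mu>\<^sup>j f\<^sub>j\<close>. Everything is read off from the scalar function
  \<open>G(\<mu>) = (A(\<mu>)\<^sup>-\<^sup>1 F(\<mu>), F(cnj \<mu>))\<close>, which is holomorphic off the eigenvalues and, since
  \<open>F\<close> has degree at most \<open>l - 1\<close> and \<open>A\<close> has degree \<open>2 l\<close> with injective leading coefficient, is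
  \<open>O(\<mu>\<^sup>-\<^sup>2)\<close> at infinity. On the real line \<open>Im G \<ge> 0\<close>, because
  \<open>(y, A(t) y)\<close> with \<open>y = A(t)\<^sup>-\<^sup>1 F(t)\<close> has non-negative imaginary part.

  The inner product of \<open>f\<close> with the derived chain of \<open>w\<^sup>h\<close> is the conjugate of the coefficient of
  \<open>(\<mu> - c)\<^sup>h\<close> in \<open>(w(\<mu>), F(cnj \<mu>))\<close>, where \<open>w(\<mu>) = \<Sum>\<^sub>r (\<mu> - c)\<^sup>r w\<^sup>r\<close>. So orthogonality is an order of
  vanishing, and it controls the poles of \<open>G\<close>.

  At an eigenvalue in the open half plane \<open>f\<close> is orthogonal to complete chains. Maximality of the
  canonical system means that the vectors \<open>(\<mu> - c)\<^sup>-\<^sup>p\<^sup>-\<^sup>1 A(\<mu>) w(\<mu>)\<close>, taken at \<open>\<mu> = c\<close>, are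
  independent modulo the range of \<open>A(c)\<close>: otherwise some chain could be prolonged
  (\<open>canonical_defect_independent\<close>). They describe \<open>A(\<mu>)\<^sup>-\<^sup>1\<close> near \<open>c\<close>, and \<open>G\<close> turns out to be
  bounded there (\<open>resolvent_form_bounded\<close>).

  At a real eigenvalue \<open>f\<close> is orthogonal to the lower halves of the chains \<open>w\<^sub>k\<close>. By dissipativity it is
  then orthogonal to the lower halves of the adjoint chains \<open>z\<^sub>k\<close> as well
  (\<open>lower_half_orthogonal\<close>). Multiplying out the polar part of \<open>A\<^sup>-\<^sup>1\<close>, the pole of
  \<open>G\<close> is at most simple, and regularity of the canonical system turns its residue into
  \<open>\<Sum> \<epsilon>\<^sub>k \<bar>(f, w\<^sub>k\<^sup>p\<^sup>/\<^sup>2)\<bar>\<^sup>2\<close> over the chains with even \<open>p\<close>, where \<open>w\<^sub>k\<^sup>p\<^sup>/\<^sup>2\<close> stands for its derived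
  chain. The terms with \<open>\<epsilon>\<^sub>k = 1\<close> vanish by orthogonality, so the residue is
  not positive.

  A function with these properties vanishes on the real line: this is Cauchy's theorem on large half
  discs, applied twice (\<open>real_line_vanishing\<close>). So \<open>(A(t) y, y) = 0\<close> with \<open>y = A(t)\<^sup>-\<^sup>1 F(t)\<close> for all real
  regular \<open>t\<close>. Near a point where the numerical range omits \<open>0\<close> this forces \<open>F = 0\<close>
  (\<open>resolvent_form_zero_imp\<close>). For the lower half plane \<open>G(-\<mu>)\<close> is used in place of \<open>G(\<mu>)\<close>.
\<close>

section \<open>Complex inner products and linear maps in finite dimension\<close>

lemma cinner_add_right: "cinner x (y + z) = cinner x y + cinner x z"
  by (metis cinner_add_left cinner_commute complex_cnj_add)

lemma cinner_scaleC_right: "cinner x (a *\<^sub>C y) = cnj a * cinner x y"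
  by (metis cinner_scaleC_left cinner_commute complex_cnj_mult)

lemma cinner_zero_left [simp]: "cinner 0 x = 0"
  using cinner_add_left[of 0 0 x] by simp

lemma cinner_zero_right [simp]: "cinner x 0 = 0"
  using cinner_add_right[of x 0 0] by simp

lemma cinner_minus_left: "cinner (- x) y = - cinner x y"
  using cinner_add_left[of x "- x" y] by (simp add: eq_neg_iff_add_eq_0 add.commute)

lemma cinner_minus_right: "cinner x (- y) = - cinner x y"
  using cinner_add_right[of x y "- y"] by (simp add: eq_neg_iff_add_eq_0 add.commute)

lemma cinner_diff_left: "cinner (x - y) z = cinner x z - cinner y z"
  using cinner_add_left[of x "- y" z] by (simp add: cinner_minus_left)

lemma cinner_diff_right: "cinner x (y - z) = cinner x y - cinner x z"
  using cinner_add_right[of x y "- z"] by (simp add: cinner_minus_right)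

lemma cinner_sum_left: "cinner (\<Sum>i\<in>I. f i) y = (\<Sum>i\<in>I. cinner (f i) y)"
  by (induction I rule: infinite_finite_induct) (simp_all add: cinner_add_left)

lemma cinner_sum_right: "cinner y (\<Sum>i\<in>I. f i) = (\<Sum>i\<in>I. cinner y (f i))"
  by (induction I rule: infinite_finite_induct) (simp_all add: cinner_add_right)

lemmas cinner_linear_simps =
  cinner_add_left cinner_add_right cinner_scaleC_left cinner_scaleC_right
  cinner_diff_left cinner_diff_right cinner_sum_left cinner_sum_right

lemma cinner_self: "cinner x x = of_real ((norm x)\<^sup>2)"
proof -
  have "Im (cinner x x) = 0"
    using cinner_commute[of x x] by (metis complex_cnj complex.sel(2) complex.collapse complex.inject equal_neg_zero)
  moreover have "Re (cinner x x) = (norm x)\<^sup>2"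
    by (simp add: inner_cinner[symmetric] power2_norm_eq_inner)
  ultimately show ?thesis
    by (simp add: complex_eq_iff)
qed

lemma norm_scaleC: "norm (a *\<^sub>C x) = cmod a * norm (x :: 'a::complex_inner)"
proof -
  have "complex_of_real ((norm (a *\<^sub>C x))\<^sup>2) = a * cnj a * of_real ((norm x)\<^sup>2)"
    by (simp only: cinner_self[symmetric] cinner_scaleC_left cinner_scaleC_right mult_ac)
  also have "a * cnj a = of_real ((cmod a)\<^sup>2)"
    by (rule complex_norm_square[symmetric])
  finally have "(norm (a *\<^sub>C x))\<^sup>2 = (cmod a)\<^sup>2 * (norm x)\<^sup>2"
    by (simp only: of_real_mult[symmetric] of_real_eq_iff)
  then have "(norm (a *\<^sub>C x))\<^sup>2 = (cmod a * norm x)\<^sup>2"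
    by (simp only: power_mult_distrib)
  then show ?thesis
    by (simp add: power2_eq_iff_nonneg)
qed

lemma cmod_cinner_le: "cmod (cinner x y) \<le> norm x * norm (y :: 'a::complex_inner)"
proof (cases "cinner x y = 0")
  case False
  define a where "a = cnj (cinner x y) / of_real (cmod (cinner x y))"
  have "cinner (a *\<^sub>C x) y = cinner x y * cnj (cinner x y) / of_real (cmod (cinner x y))"
    by (simp add: a_def cinner_scaleC_left)
  also have "\<dots> = of_real (cmod (cinner x y))"
    using False by (simp add: complex_norm_square[symmetric] power2_eq_square)
  finally have "cmod (cinner x y) = Re (cinner (a *\<^sub>C x) y)"
    by simp
  also have "\<dots> \<le> norm (a *\<^sub>C x) * norm y"
    by (metis inner_cinner norm_cauchy_schwarz)
  also have "norm (a *\<^sub>C x) = norm x"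
    using False by (simp add: norm_scaleC a_def norm_divide)
  finally show ?thesis .
qed simp

lemma bounded_bilinear_cinner:
  "bounded_bilinear (cinner :: 'a::complex_inner \<Rightarrow> 'a \<Rightarrow> complex)"
proof
  show "\<exists>K. \<forall>a b. norm (cinner a b) \<le> norm a * norm (b :: 'a) * K"
    by (rule exI[of _ 1]) (simp add: cmod_cinner_le)
qed (simp_all add: cinner_add_left cinner_add_right scaleR_scaleC cinner_scaleC_left
      cinner_scaleC_right scaleR_conv_of_real)

lemma bounded_bilinear_scaleC:
  "bounded_bilinear (scaleC :: complex \<Rightarrow> 'a \<Rightarrow> 'a::complex_inner)"
proof
  show "\<exists>K. \<forall>a b. norm (a *\<^sub>C (b :: 'a)) \<le> norm a * norm b * K"
    by (rule exI[of _ 1]) (simp add: norm_scaleC)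
qed (simp_all add: scaleC_add_right scaleC_add_left scaleR_scaleC scaleC_scaleC
      scaleR_conv_of_real mult.commute)

lemmas tendsto_cinner = bounded_bilinear.tendsto[OF bounded_bilinear_cinner]
lemmas tendsto_scaleC = bounded_bilinear.tendsto[OF bounded_bilinear_scaleC]

lemma clinear_iff:
  "clinear T \<longleftrightarrow> (\<forall>x y. T (x + y) = T x + T y) \<and> (\<forall>c x. T (c *\<^sub>C x) = c *\<^sub>C T x)"
  unfolding clinear_def Vector_Spaces.linear_iff
  using complex_vector.vector_space_axioms by auto

context
  fixes T :: "'a::complex_inner \<Rightarrow> 'a"
  assumes T: "clinear T"
begin

interpretation T: Vector_Spaces.linear scaleC scaleC T
  using T by (simp add: clinear_def)

lemma clinear_add: "T (x + y) = T x + T y" by (rule T.add)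
lemma clinear_scaleC: "T (c *\<^sub>C x) = c *\<^sub>C T x" by (rule T.scale)
lemma clinear_diff: "T (x - y) = T x - T y" by (rule T.diff)
lemma clinear_zero: "T 0 = 0" by (rule T.zero)
lemma clinear_sum: "T (\<Sum>i\<in>I. f i) = (\<Sum>i\<in>I. T (f i))" by (rule T.sum)
lemma clinear_inj_iff: "inj T \<longleftrightarrow> (\<forall>x. T x = 0 \<longrightarrow> x = 0)" by (rule T.inj_iff_eq_0)

end

text \<open>An orthonormal basis, in the form in which it bounds linear maps.\<close>

definition unit_frame :: "'a::complex_inner set \<Rightarrow> bool" where
  "unit_frame E \<longleftrightarrow> finite E \<and> (\<forall>e\<in>E. norm e = 1) \<and> (\<forall>x. x = (\<Sum>e\<in>E. cinner x e *\<^sub>C e))"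

text \<open>Gram-Schmidt orthonormalisation of a finite spanning set, by induction on the set.\<close>

lemma unit_frame_exists:
  assumes "cfinite_dim TYPE('a::complex_inner)"
  shows "\<exists>E :: 'a::complex_inner set. unit_frame E"
proof -
  have ind: "\<exists>E :: 'a set. finite E \<and> (\<forall>e\<in>E. norm e = 1) \<and>
      (\<forall>e\<in>E. \<forall>e'\<in>E. e \<noteq> e' \<longrightarrow> cinner e e' = 0) \<and> (\<forall>b\<in>B. (\<Sum>e\<in>E. cinner b e *\<^sub>C e) = b)"
    if "finite B" for B
    using that
  proof induction
    case empty
    then show ?case by (intro exI[of _ "{}"]) auto
  next
    case (insert b B)
    from insert.IH obtain E :: "'a set" where E0: "finite E" "\<forall>e\<in>E. norm e = 1"
      "\<forall>e\<in>E. \<forall>e'\<in>E. e \<noteq> e' \<longrightarrow> cinner e e' = 0"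
      "\<forall>b\<in>B. (\<Sum>e\<in>E. cinner b e *\<^sub>C e) = b"
      by (elim exE conjE)
    note E = E0(1) bspec[OF E0(2)] E0(3)[rule_format] bspec[OF E0(4)]
    define b' where "b' = b - (\<Sum>e\<in>E. cinner b e *\<^sub>C e)"
    have orth: "cinner b' e = 0" if "e \<in> E" for e
    proof -
      have "(\<Sum>e'\<in>E. cinner b e' * cinner e' e) = (\<Sum>e'\<in>E. if e' = e then cinner b e else 0)"
        using that E by (intro sum.cong) (auto simp: cinner_self)
      then show ?thesis
        using that E(1) by (simp add: b'_def cinner_diff_left cinner_sum_left cinner_scaleC_left)
    qed
    show ?case
    proof (cases "b' = 0")
      case True
      then have "(\<Sum>e\<in>E. cinner b e *\<^sub>C e) = b"
        unfolding b'_def by (metis eq_iff_diff_eq_0)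
      then show ?thesis
        using E by (intro exI[of _ E]) simp
    next
      case False
      define u where "u = (1 / complex_of_real (norm b')) *\<^sub>C b'"
      have nu: "norm u = 1" using False by (simp add: u_def norm_scaleC norm_divide)
      have ue: "cinner u e = 0" "cinner e u = 0" if "e \<in> E" for e
        using orth[OF that] cinner_commute[of b' e]
        by (simp_all add: u_def cinner_scaleC_left cinner_scaleC_right)
      have "u \<notin> E"
      proof
        assume "u \<in> E"
        then have "cinner u u = 0" by (rule ue)
        then show False using nu by (simp add: cinner_self)
      qed
      moreover have "cinner x u = 0" if "x \<in> B" for x
      proof -
        have "cinner x u = cinner (\<Sum>e\<in>E. cinner x e *\<^sub>C e) u"
          using E(4)[OF that] by simp
        also have "\<dots> = 0"
          using ue(2) by (simp add: cinner_add_left cinner_sum_left cinner_scaleC_left)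
        finally show ?thesis .
      qed
      moreover have "(\<Sum>e\<in>E. cinner b e *\<^sub>C e) + cinner b u *\<^sub>C u = b"
      proof -
        have "cinner b u = cinner (b' + (\<Sum>e\<in>E. cinner b e *\<^sub>C e)) u"
          by (simp add: b'_def)
        also have "\<dots> = cinner b' u"
          using ue(2) by (simp add: cinner_add_left cinner_sum_left cinner_scaleC_left)
        also have "\<dots> = norm b'"
          using False by (simp add: u_def cinner_scaleC_right cinner_self power2_eq_square)
        finally have "cinner b u *\<^sub>C u = b'"
          using False by (simp add: u_def scaleC_scaleC)
        then show ?thesis by (simp add: b'_def)
      qed
      ultimately show ?thesis
        using E nu ue by (intro exI[of _ "insert u E"]) (auto simp: add.commute)
    qed
  qed
  from assms obtain B :: "'a set" where B: "finite B" "complex_vector.span B = UNIV"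
    by (auto simp: cfinite_dim_def)
  from ind[OF B(1)] obtain E :: "'a set" where E0: "finite E" "\<forall>e\<in>E. norm e = 1"
      "\<forall>b\<in>B. (\<Sum>e\<in>E. cinner b e *\<^sub>C e) = b"
    by (elim exE conjE)
  note E = E0(1) bspec[OF E0(2)] bspec[OF E0(3)]
  have "complex_vector.subspace {x. (\<Sum>e\<in>E. cinner x e *\<^sub>C e) = x}"
    unfolding complex_vector.subspace_def
  proof (intro conjI allI ballI impI CollectI; (elim CollectE)?)
    fix x y
    assume "(\<Sum>e\<in>E. cinner x e *\<^sub>C e) = x" "(\<Sum>e\<in>E. cinner y e *\<^sub>C e) = y"
    then show "(\<Sum>e\<in>E. cinner (x + y) e *\<^sub>C e) = x + y"
      by (simp add: cinner_add_left scaleC_add_left sum.distrib)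
  next
    fix c x assume x: "(\<Sum>e\<in>E. cinner x e *\<^sub>C e) = x"
    have "(\<Sum>e\<in>E. cinner (c *\<^sub>C x) e *\<^sub>C e) = c *\<^sub>C (\<Sum>e\<in>E. cinner x e *\<^sub>C e)"
      by (simp add: cinner_scaleC_left complex_vector.scale_sum_right)
    then show "(\<Sum>e\<in>E. cinner (c *\<^sub>C x) e *\<^sub>C e) = c *\<^sub>C x" by (simp only: x)
  qed simp
  then have "complex_vector.span B \<subseteq> {x. (\<Sum>e\<in>E. cinner x e *\<^sub>C e) = x}"
    using E(3) by (intro complex_vector.span_minimal) auto
  then have sub: "UNIV \<subseteq> {x. (\<Sum>e\<in>E. cinner x e *\<^sub>C e) = x}"
    unfolding B(2) .
  have "x = (\<Sum>e\<in>E. cinner x e *\<^sub>C e)" for x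
    by (rule sym, rule CollectD, rule subsetD[OF sub UNIV_I])
  then have "unit_frame E"
    unfolding unit_frame_def using E0(1,2) by (intro conjI allI)
  then show ?thesis by (rule exI)
qed

lemma unit_frame_finite: "unit_frame E \<Longrightarrow> finite E"
  by (simp add: unit_frame_def)

lemma unit_frame_expand:
  assumes "unit_frame E" "clinear T"
  shows "T x = (\<Sum>e\<in>E. cinner x e *\<^sub>C T e)"
proof -
  have "x = (\<Sum>e\<in>E. cinner x e *\<^sub>C e)"
    using assms(1) unfolding unit_frame_def by (elim conjE allE)
  then have "T x = T (\<Sum>e\<in>E. cinner x e *\<^sub>C e)"
    by (rule arg_cong)
  then show ?thesis
    by (simp only: clinear_sum[OF assms(2)] clinear_scaleC[OF assms(2)])
qed

lemma unit_frame_sum_le: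
  assumes E: "unit_frame E" and b: "\<And>e. b e \<ge> 0"
  shows "(\<Sum>e\<in>E. cmod (cinner x e) * b e) \<le> (\<Sum>e\<in>E. b e) * norm x"
proof -
  have "(\<Sum>e\<in>E. cmod (cinner x e) * b e) \<le> (\<Sum>e\<in>E. norm x * b e)"
  proof (intro sum_mono mult_right_mono b)
    fix e assume "e \<in> E"
    then have "norm e = 1" using E by (simp add: unit_frame_def)
    then show "cmod (cinner x e) \<le> norm x"
      using cmod_cinner_le[of x e] by simp
  qed
  then show ?thesis by (simp add: sum_distrib_left mult.commute)
qed

lemma clinear_norm_le:
  assumes "unit_frame E" "clinear T"
  shows "norm (T x) \<le> (\<Sum>e\<in>E. norm (T e)) * norm x"
proof -
  have "norm (T x) \<le> (\<Sum>e\<in>E. cmod (cinner x e) * norm (T e))"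
    unfolding unit_frame_expand[OF assms, of x]
    by (rule order_trans[OF norm_sum]) (simp add: norm_scaleC)
  also have "\<dots> \<le> (\<Sum>e\<in>E. norm (T e)) * norm x"
    by (rule unit_frame_sum_le[OF assms(1)]) simp
  finally show ?thesis .
qed

lemma clinear_bounded:
  fixes T :: "'a::complex_inner \<Rightarrow> 'a"
  assumes "cfinite_dim TYPE('a)" "clinear T"
  obtains C where "C > 0" "\<And>x. norm (T x) \<le> C * norm x"
proof -
  obtain E :: "'a set" where E: "unit_frame E"
    using unit_frame_exists[OF assms(1)] by blast
  show ?thesis
  proof (rule that[of "(\<Sum>e\<in>E. norm (T e)) + 1"])
    show "(\<Sum>e\<in>E. norm (T e)) + 1 > 0"
      by (simp add: add_nonneg_pos sum_nonneg)
    show "norm (T x) \<le> ((\<Sum>e\<in>E. norm (T e)) + 1) * norm x" for x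
      using clinear_norm_le[OF E assms(2), of x] by (simp add: distrib_right add_increasing2)
  qed
qed

lemma clinear_bounded_linear:
  assumes "cfinite_dim TYPE('a::complex_inner)" "clinear (T :: 'a::complex_inner \<Rightarrow> 'a)"
  shows "bounded_linear T"
proof -
  obtain C where "\<And>x. norm (T x) \<le> C * norm x"
    using clinear_bounded[OF assms] by blast
  then show ?thesis
    using assms(2)
    by (intro bounded_linear_intro[of T C])
      (auto simp: clinear_iff scaleR_scaleC mult.commute)
qed

lemma clinear_inj_imp_bij:
  assumes "cfinite_dim TYPE('a::complex_inner)" "clinear (T :: 'a::complex_inner \<Rightarrow> 'a)" "inj T"
  shows "bij T"
proof -
  from assms(1) obtain B0 :: "'a set" where B0: "finite B0" "complex_vector.span B0 = UNIV"
    by (auto simp: cfinite_dim_def)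
  obtain B where B: "B \<subseteq> B0" "complex_vector.independent B"
      "complex_vector.span B = UNIV"
  proof -
    obtain B where B: "B \<subseteq> B0" "complex_vector.independent B"
        "B0 \<subseteq> complex_vector.span B"
      by (rule complex_vector.maximal_independent_subset)
    have "complex_vector.span B = UNIV"
      using complex_vector.span_minimal[OF B(3) complex_vector.subspace_span] B0(2) by auto
    then show ?thesis using that B by blast
  qed
  interpret fd: finite_dimensional_vector_space "scaleC :: complex \<Rightarrow> 'a \<Rightarrow> 'a" B
    using B B0 finite_subset by unfold_locales auto
  have "surj T"
    using fd.linear_inj_imp_surj assms(2,3) by (simp add: clinear_def)
  then show ?thesis
    using assms(3) by (simp add: bij_def)
qed

lemma clinear_inv:
  assumes "clinear T" "bij T"
  shows "clinear (inv T)"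
  unfolding clinear_iff
proof (intro conjI allI)
  show "inv T (x + y) = inv T x + inv T y" for x y
    by (rule inv_f_eq[OF bij_is_inj[OF assms(2)]])
      (simp add: clinear_add[OF assms(1)] surj_f_inv_f[OF bij_is_surj[OF assms(2)]])
  show "inv T (c *\<^sub>C x) = c *\<^sub>C inv T x" for c x
    by (rule inv_f_eq[OF bij_is_inj[OF assms(2)]])
      (simp add: clinear_scaleC[OF assms(1)] surj_f_inv_f[OF bij_is_surj[OF assms(2)]])
qed

text \<open>The operator \<open>y \<mapsto> \<Sum>\<^sub>e (y, T e) e\<close> has the property that defines the adjoint, and only one operator
  can have it; so the definite description denotes.\<close>

lemma cadjoint_cinner:
  fixes T :: "'a::complex_inner \<Rightarrow> 'a"
  assumes "cfinite_dim TYPE('a)" "clinear T"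
  shows "cinner (T x) y = cinner x (cadjoint T y)"
proof -
  obtain E :: "'a set" where E: "unit_frame E"
    using unit_frame_exists[OF assms(1)] by blast
  define S where "S = (\<lambda>y. \<Sum>e\<in>E. cinner y (T e) *\<^sub>C e)"
  have S: "\<forall>x y. cinner (T x) y = cinner x (S y)"
  proof (intro allI)
    fix x y
    have "cinner (T x) y = (\<Sum>e\<in>E. cinner x e * cinner (T e) y)"
      unfolding unit_frame_expand[OF E assms(2), of x] by (simp add: cinner_linear_simps)
    also have "\<dots> = cinner x (S y)"
      unfolding S_def cinner_sum_right cinner_scaleC_right
      by (intro sum.cong refl) (simp add: cinner_commute[where y = "T _" and x = y] mult.commute)
    finally show "cinner (T x) y = cinner x (S y)" .
  qed
  have "cadjoint T = S"
    unfolding cadjoint_def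
  proof (rule the_equality)
    show "\<forall>x y. cinner (T x) y = cinner x (S y)" by (rule S)
    fix R assume R: "\<forall>x y. cinner (T x) y = cinner x (R y)"
    show "R = S"
    proof
      fix y
      have "cinner (R y - S y) (R y - S y) = 0"
        using R[rule_format, of "R y - S y" y] S[rule_format, of "R y - S y" y]
        by (simp add: cinner_diff_right)
      then show "R y = S y" by (simp add: cinner_self)
    qed
  qed
  then show ?thesis using S by simp
qed

lemma cinner_ext:
  assumes "\<And>x. cinner x y = cinner x z"
  shows "y = z"
  using assms[of "y - z"] cinner_self[of "y - z"] by (simp add: cinner_diff_right)

lemma clinear_cadjoint:
  fixes T :: "'a::complex_inner \<Rightarrow> 'a"
  assumes "cfinite_dim TYPE('a)" "clinear T"
  shows "clinear (cadjoint T)"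
  unfolding clinear_iff
proof (intro conjI allI)
  note adj = cadjoint_cinner[OF assms, symmetric]
  show "cadjoint T (x + y) = cadjoint T x + cadjoint T y" for x y
    by (rule cinner_ext) (simp add: adj cinner_add_right)
  show "cadjoint T (c *\<^sub>C x) = c *\<^sub>C cadjoint T x" for c x
    by (rule cinner_ext) (simp add: adj cinner_scaleC_right)
qed

text \<open>In finite dimension pointwise convergence \<open>S\<^sub>\<mu> \<rightarrow> T\<close> is convergence in norm, so a lower bound for \<open>T\<close>
  survives. The filter is arbitrary because the lemma serves three purposes: regular points, infinity,
  and (for an auxiliary family) eigenvalues.\<close>

lemma perturbed_inverse_bounded:
  fixes T :: "'a::complex_inner \<Rightarrow> 'a" and S :: "'b \<Rightarrow> 'a \<Rightarrow> 'a"
  assumes fd: "cfinite_dim TYPE('a)" and T: "clinear T" "inj T"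
    and S: "\<And>\<mu>. clinear (S \<mu>)" and lim: "\<And>x. ((\<lambda>\<mu>. S \<mu> x) \<longlongrightarrow> T x) F"
  obtains C where "C > 0" "\<forall>\<^sub>F \<mu> in F. bij (S \<mu>) \<and> (\<forall>x. norm x \<le> C * norm (S \<mu> x))"
proof -
  obtain E :: "'a set" where E: "unit_frame E"
    using unit_frame_exists[OF fd] by blast
  have bT: "bij T" by (rule clinear_inj_imp_bij[OF fd T])
  obtain C where C: "C > 0" "\<And>x. norm (inv T x) \<le> C * norm x"
    using clinear_bounded[OF fd clinear_inv[OF T(1) bT]] by blast
  have low: "norm x \<le> C * norm (T x)" for x
    using C(2)[of "T x"] bT by (simp add: bij_is_inj)
  define d where "d \<mu> = (\<Sum>e\<in>E. norm (S \<mu> e - T e))" for \<mu>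
  have diff: "norm (S \<mu> x - T x) \<le> d \<mu> * norm x" for \<mu> x
    unfolding d_def
  proof (rule clinear_norm_le[OF E])
    show "clinear (\<lambda>x. S \<mu> x - T x)"
      using S[of \<mu>] T(1) by (auto simp: clinear_iff complex_vector.scale_right_diff_distrib)
  qed
  have "(d \<longlongrightarrow> (\<Sum>e\<in>E. norm (T e - T e))) F"
    unfolding d_def by (intro tendsto_intros lim)
  then have "\<forall>\<^sub>F \<mu> in F. d \<mu> < 1 / (2 * C)"
    using C(1) by (intro order_tendstoD(2)[of d 0]) auto
  then have "\<forall>\<^sub>F \<mu> in F. bij (S \<mu>) \<and> (\<forall>x. norm x \<le> 2 * C * norm (S \<mu> x))"
  proof eventually_elim
    case (elim \<mu>)
    have *: "norm x \<le> 2 * C * norm (S \<mu> x)" for x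
    proof -
      have "norm (T x) \<le> norm (S \<mu> x) + norm (S \<mu> x - T x)"
        by (metis add.commute norm_minus_commute norm_triangle_sub)
      also have "\<dots> \<le> norm (S \<mu> x) + 1 / (2 * C) * norm x"
        using diff[where \<mu> = \<mu> and x = x] mult_right_mono[OF less_imp_le[OF elim] norm_ge_zero[of x]] by linarith
      finally have "C * norm (T x) \<le> C * norm (S \<mu> x) + norm x / 2"
        using C(1) by (simp add: field_simps)
      with low[of x] show ?thesis by simp
    qed
    have "inj (S \<mu>)"
      unfolding clinear_inj_iff[OF S]
    proof (intro allI impI)
      fix x assume "S \<mu> x = 0"
      then show "x = 0" using *[of x] by simp
    qed
    then have "bij (S \<mu>)" by (rule clinear_inj_imp_bij[OF fd S])
    with * show ?case by simp
  qed
  then show ?thesis using that[of "2 * C"] C(1) by simp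
qed

section \<open>Vector polynomials, eigenchains and Keldysh derived chains\<close>

text \<open>Vector polynomials in powers of \<open>\<mu> - c\<close>. A chain of length \<open>p + 1\<close> enters with \<open>m = p + 1\<close>, and a vector
  of \<open>H\<^sup>l\<close> with \<open>m = l\<close> and \<open>c = 0\<close>.\<close>

definition vpoly :: "nat \<Rightarrow> complex \<Rightarrow> (nat \<Rightarrow> 'a::complex_inner) \<Rightarrow> complex \<Rightarrow> 'a" where
  "vpoly m c w \<mu> = (\<Sum>r<m. (\<mu> - c) ^ r *\<^sub>C w r)"

lemma vpoly_factor:
  assumes "\<And>h. h < q \<Longrightarrow> a h = 0"
  shows "vpoly (q + m) c a \<mu> = (\<mu> - c) ^ q *\<^sub>C vpoly m c (\<lambda>h. a (q + h)) \<mu>"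
proof -
  have "vpoly (q + m) c a \<mu> = (\<Sum>r\<in>{q..<q + m}. (\<mu> - c) ^ r *\<^sub>C a r)"
    unfolding vpoly_def using assms by (intro sum.mono_neutral_right) auto
  also have "\<dots> = (\<Sum>r<m. (\<mu> - c) ^ (q + r) *\<^sub>C a (q + r))"
    by (rule sum.reindex_bij_witness[where i = "\<lambda>r. q + r" and j = "\<lambda>r. r - q"]) auto
  finally show ?thesis
    by (simp add: vpoly_def complex_vector.scale_sum_right power_add)
qed

lemma tendsto_vpoly: "((\<lambda>\<mu>. vpoly m c w \<mu>) \<longlongrightarrow> vpoly m c w \<mu>0) (at \<mu>0)"
  unfolding vpoly_def by (intro tendsto_sum tendsto_scaleC tendsto_intros)

lemma vpoly_at_centre: "m > 0 \<Longrightarrow> vpoly m c w c = w 0"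
proof -
  assume "m > 0"
  then have "vpoly m c w c = (\<Sum>r<m. if r = 0 then w r else 0)"
    unfolding vpoly_def by (intro sum.cong) auto
  with \<open>m > 0\<close> show ?thesis by simp
qed

lemma higher_deriv_monomial:
  "(deriv ^^ j) (\<lambda>\<zeta>. \<zeta> ^ i) \<mu> = fact j * of_nat (i choose j) * (\<mu> :: complex) ^ (i - j)"
proof (induction j arbitrary: \<mu>)
  case (Suc j)
  have "(deriv ^^ Suc j) (\<lambda>\<zeta>. \<zeta> ^ i) \<mu>
      = deriv (\<lambda>\<mu>. fact j * of_nat (i choose j) * \<mu> ^ (i - j)) \<mu>"
    by (simp add: Suc.IH cong: deriv_cong_ev) (metis Suc.IH ext)
  also have "\<dots> = fact j * of_nat (i choose j) * (of_nat (i - j) * \<mu> ^ (i - j - 1))"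
    by (rule DERIV_imp_deriv) (auto intro!: derivative_eq_intros)
  also have "\<dots> = fact j * of_nat ((i - j) * (i choose j)) * \<mu> ^ (i - Suc j)"
    by simp
  also have "(i - j) * (i choose j) = Suc j * (i choose Suc j)"
    by (metis binomial_absorption binomial_absorb_comp)
  finally show ?case
    by (simp add: algebra_simps)
qed simp

text \<open>The coefficient of \<open>(\<mu> - c)\<^sup>h\<close> in the product \<open>A(\<mu>) w(\<mu>)\<close> of Taylor expansions at \<open>c\<close>; a chain is a
  sequence for which these coefficients vanish up to its length.\<close>

definition chain_defect ::
    "(nat \<Rightarrow> 'a::complex_inner \<Rightarrow> 'a) \<Rightarrow> nat \<Rightarrow> complex \<Rightarrow> (nat \<Rightarrow> 'a) \<Rightarrow> nat \<Rightarrow> 'a" where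
  "chain_defect A n c w h = (\<Sum>j\<le>h. (1 / fact j) *\<^sub>C pencil_deriv A n j c (w (h - j)))"

lemma eigen_chain_iff: "eigen_chain A n c p w \<longleftrightarrow> w 0 \<noteq> 0 \<and> (\<forall>s\<le>p. chain_defect A n c w s = 0)"
  by (simp add: eigen_chain_def chain_defect_def)

lemma chain_defect_cong:
  "(\<And>i. i \<le> h \<Longrightarrow> w i = w' i) \<Longrightarrow> chain_defect A n c w h = chain_defect A n c w' h"
  by (simp add: chain_defect_def)

lemma taylor_coeff:
  "(1 / fact j) *\<^sub>C pencil_deriv A n j c x = (\<Sum>i\<le>n. (of_nat (i choose j) * c ^ (i - j)) *\<^sub>C A i x)"
  by (simp add: pencil_deriv_def higher_deriv_monomial complex_vector.scale_sum_right)

text \<open>Expand \<open>\<mu>\<^sup>i = (\<mu> - c + c)\<^sup>i\<close> by the binomial theorem. For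
  constant maps \<open>A\<^sub>i\<close> this is the re-centring of a vector polynomial.\<close>

lemma pencil_taylor:
  assumes "n < N"
  shows "pencil A n \<mu> x = (\<Sum>j<N. (\<mu> - c) ^ j *\<^sub>C ((1 / fact j) *\<^sub>C pencil_deriv A n j c x))"
proof -
  have *: "\<mu> ^ i = (\<Sum>j<N. (\<mu> - c) ^ j * (of_nat (i choose j) * c ^ (i - j)))" if "i \<le> n" for i
  proof -
    have "\<mu> ^ i = (\<mu> - c + c) ^ i" by simp
    also have "\<dots> = (\<Sum>j\<le>i. of_nat (i choose j) * (\<mu> - c) ^ j * c ^ (i - j))"
      by (rule binomial_ring)
    also have "\<dots> = (\<Sum>j<N. of_nat (i choose j) * (\<mu> - c) ^ j * c ^ (i - j))"
      using that assms by (intro sum.mono_neutral_left) auto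
    finally show ?thesis by (simp add: mult_ac)
  qed
  have "pencil A n \<mu> x = (\<Sum>i\<le>n. \<Sum>j<N. ((\<mu> - c) ^ j * (of_nat (i choose j) * c ^ (i - j))) *\<^sub>C A i x)"
    unfolding pencil_def complex_vector.scale_sum_left[symmetric]
    by (intro sum.cong refl) (use * in force)
  also have "\<dots> = (\<Sum>j<N. \<Sum>i\<le>n. ((\<mu> - c) ^ j * (of_nat (i choose j) * c ^ (i - j))) *\<^sub>C A i x)"
    by (rule sum.swap)
  finally show ?thesis
    unfolding taylor_coeff complex_vector.scale_sum_right complex_vector.scale_scale .
qed

lemma pencil_deriv_beyond: "n < j \<Longrightarrow> pencil_deriv A n j c x = 0"
  by (auto simp: pencil_deriv_def higher_deriv_monomial intro!: sum.neutral)

lemma pencil_deriv_clinear: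
  assumes "\<And>i. i \<le> n \<Longrightarrow> clinear (A i)"
  shows "clinear (pencil_deriv A n j c)"
  unfolding clinear_iff pencil_deriv_def
  using assms
  by (auto simp: clinear_add clinear_scaleC scaleC_add_right sum.distrib
      complex_vector.scale_sum_right mult.commute intro!: sum.cong)

lemma pencil_clinear:
  assumes "\<And>i. i \<le> n \<Longrightarrow> clinear (A i)"
  shows "clinear (pencil A n \<mu>)"
  unfolding clinear_iff pencil_def
  using assms
  by (auto simp: clinear_add clinear_scaleC scaleC_add_right sum.distrib
      complex_vector.scale_sum_right mult.commute intro!: sum.cong)

text \<open>Cauchy product of the Taylor expansion of the pencil and the polynomial. The product has length
  \<open>m + n\<close>; one zero coefficient is carried along, so that the first coefficient after the vanishing
  ones is available for every chain and every \<open>n\<close>.\<close>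

lemma pencil_vpoly:
  assumes A: "\<And>i. i \<le> n \<Longrightarrow> clinear (A i)" and w: "\<And>r. r \<ge> m \<Longrightarrow> w r = 0"
  shows "pencil A n \<mu> (vpoly m c w \<mu>) = vpoly (m + Suc n) c (chain_defect A n c w) \<mu>"
proof -
  define N where "N = m + Suc n"
  define T where "T j x = (1 / fact j) *\<^sub>C pencil_deriv A n j c x" for j x
  have linT: "clinear (T j)" for j
    using pencil_deriv_clinear[OF A] unfolding T_def[abs_def] clinear_iff
    by (simp add: scaleC_add_right mult.commute)
  have "vpoly m c w \<mu> = (\<Sum>r<N. (\<mu> - c) ^ r *\<^sub>C w r)"
    unfolding vpoly_def using w by (intro sum.mono_neutral_left) (auto simp: N_def)
  moreover have "pencil A n \<mu> x = (\<Sum>j<N. (\<mu> - c) ^ j *\<^sub>C T j x)" for x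
    unfolding T_def by (rule pencil_taylor) (simp add: N_def)
  ultimately have "pencil A n \<mu> (vpoly m c w \<mu>)
      = (\<Sum>j<N. \<Sum>r<N. (\<mu> - c) ^ (j + r) *\<^sub>C T j (w r))"
    by (simp add: clinear_sum[OF linT] clinear_scaleC[OF linT] complex_vector.scale_sum_right power_add)
  also have "\<dots> = (\<Sum>(j, r)\<in>{..<N} \<times> {..<N}. (\<mu> - c) ^ (j + r) *\<^sub>C T j (w r))"
    by (rule sum.cartesian_product)
  also have "\<dots> = (\<Sum>(j, r)\<in>{(j, r). j + r < N}. (\<mu> - c) ^ (j + r) *\<^sub>C T j (w r))"
  proof (rule sum.mono_neutral_right)
    have "T j (w r) = 0" if "\<not> j + r < N" for j r
    proof (cases "n < j")
      case True
      then show ?thesis by (simp add: T_def pencil_deriv_beyond)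
    next
      case False
      then have "w r = 0" using that w by (simp add: N_def)
      then show ?thesis by (simp add: clinear_zero[OF linT])
    qed
    then show "\<forall>i\<in>{..<N} \<times> {..<N} - {(j, r). j + r < N}.
        (case i of (j, r) \<Rightarrow> (\<mu> - c) ^ (j + r) *\<^sub>C T j (w r)) = 0"
      by (simp add: split_beta)
  qed auto
  also have "\<dots> = (\<Sum>k<N. \<Sum>i\<le>k. (\<mu> - c) ^ (i + (k - i)) *\<^sub>C T i (w (k - i)))"
    by (rule sum.triangle_reindex)
  also have "\<dots> = vpoly N c (chain_defect A n c w) \<mu>"
    unfolding vpoly_def chain_defect_def T_def[symmetric] complex_vector.scale_sum_right
    by (intro sum.cong refl) simp
  finally show ?thesis by (simp add: N_def)
qed

text \<open>The values of a chain beyond its length are arbitrary, but the later coefficients of the product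
  \<open>A(\<mu>) w(\<mu>)\<close> depend on them; cutting off makes that product the one for the polynomial \<open>w(\<mu>)\<close>.\<close>

definition truncate_at :: "nat \<Rightarrow> (nat \<Rightarrow> 'a::zero) \<Rightarrow> nat \<Rightarrow> 'a" where
  "truncate_at m w r = (if r < m then w r else 0)"

lemma vpoly_truncate [simp]: "vpoly m c (truncate_at m w) = vpoly m c w"
  by (simp add: fun_eq_iff vpoly_def truncate_at_def)

lemma chain_defect_truncate:
  "h \<le> p \<Longrightarrow> chain_defect A n c (truncate_at (Suc p) w) h = chain_defect A n c w h"
  by (rule chain_defect_cong) (simp add: truncate_at_def)

lemma eigen_chain_factor:
  assumes A: "\<And>i. i \<le> n \<Longrightarrow> clinear (A i)" and w: "eigen_chain A n c p w"
  shows "pencil A n \<mu> (vpoly (Suc p) c w \<mu>) = (\<mu> - c) ^ Suc p *\<^sub>C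
    vpoly (Suc n) c (\<lambda>h. chain_defect A n c (truncate_at (Suc p) w) (Suc p + h)) \<mu>"
proof -
  have "pencil A n \<mu> (vpoly (Suc p) c w \<mu>)
      = vpoly (Suc p + Suc n) c (chain_defect A n c (truncate_at (Suc p) w)) \<mu>"
    by (subst vpoly_truncate[symmetric], rule pencil_vpoly[OF A]) (simp_all add: truncate_at_def)
  also have "\<dots> = (\<mu> - c) ^ Suc p *\<^sub>C
    vpoly (Suc n) c (\<lambda>h. chain_defect A n c (truncate_at (Suc p) w) (Suc p + h)) \<mu>"
    using w by (intro vpoly_factor) (simp add: chain_defect_truncate eigen_chain_iff)
  finally show ?thesis .
qed

text \<open>The coefficient of \<open>(\<mu> - c)\<^sup>h\<close> in \<open>\<mu>\<^sup>j w(\<mu>)\<close>; the recursion comes from \<open>\<mu> = c + (\<mu> - c)\<close>.\<close>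

fun keldysh_coeff :: "complex \<Rightarrow> (nat \<Rightarrow> 'a::complex_inner) \<Rightarrow> nat \<Rightarrow> nat \<Rightarrow> 'a" where
  "keldysh_coeff c w 0 h = w h"
| "keldysh_coeff c w (Suc j) h =
    c *\<^sub>C keldysh_coeff c w j h + (if h = 0 then 0 else keldysh_coeff c w j (h - 1))"

lemma has_vector_derivative_scaleC_left:
  assumes "(\<phi> has_vector_derivative d) (at t)"
  shows "((\<lambda>t. \<phi> t *\<^sub>C x) has_vector_derivative (d *\<^sub>C x)) (at t)"
  by (rule bounded_linear.has_vector_derivative
      [OF bounded_bilinear.bounded_linear_left[OF bounded_bilinear_scaleC] assms])

lemma has_vector_derivative_scaleC_right:
  assumes "(v has_vector_derivative d) (at t)"
  shows "((\<lambda>t. a *\<^sub>C v t) has_vector_derivative (a *\<^sub>C d)) (at t)"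
  by (rule bounded_linear.has_vector_derivative
      [OF bounded_bilinear.bounded_linear_right[OF bounded_bilinear_scaleC] assms])

lemma elementary_solution_derivative:
  "(elementary_solution c w h has_vector_derivative
     \<i> *\<^sub>C elementary_solution c (\<lambda>h. c *\<^sub>C w h + (if h = 0 then 0 else w (h - 1))) h t) (at t)"
proof -
  define \<phi> where "\<phi> r t = exp (\<i> * c * of_real t) * ((\<i> * of_real t) ^ r / fact r)" for r and t :: real
  have es: "elementary_solution c u h = (\<lambda>t. \<Sum>r\<le>h. \<phi> r t *\<^sub>C u (h - r))" for u
    by (simp add: fun_eq_iff elementary_solution_def \<phi>_def complex_vector.scale_sum_right)
  have d: "(\<phi> r has_vector_derivative \<i> * (c * \<phi> r t + (if r = 0 then 0 else \<phi> (r - 1) t))) (at t)" for r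
  proof -
    have "((\<lambda>z. exp (\<i> * c * z) * ((\<i> * z) ^ r / fact r)) has_field_derivative
        \<i> * (c * \<phi> r t + (if r = 0 then 0 else \<phi> (r - 1) t))) (at (of_real t))"
    proof (cases r)
      case 0
      then show ?thesis
        by (auto intro!: derivative_eq_intros simp: \<phi>_def)
    next
      case (Suc q)
      have "fact r = (of_nat (Suc q) * fact q :: complex)" using Suc by simp
      then show ?thesis
        using Suc
        by (auto intro!: derivative_eq_intros simp: \<phi>_def divide_simps simp del: of_nat_Suc fact_Suc)
          (cases q; simp add: algebra_simps)
    qed
    from has_vector_derivative_real_field[OF this] show ?thesis
      by (simp add: \<phi>_def[abs_def])
  qed
  have "((\<lambda>t. \<Sum>r\<le>h. \<phi> r t *\<^sub>C w (h - r)) has_vector_derivative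
      (\<Sum>r\<le>h. (\<i> * (c * \<phi> r t + (if r = 0 then 0 else \<phi> (r - 1) t))) *\<^sub>C w (h - r))) (at t)"
    by (intro has_vector_derivative_sum has_vector_derivative_scaleC_left d)
  also have "(\<Sum>r\<le>h. (\<i> * (c * \<phi> r t + (if r = 0 then 0 else \<phi> (r - 1) t))) *\<^sub>C w (h - r))
      = \<i> *\<^sub>C ((\<Sum>r\<le>h. \<phi> r t *\<^sub>C (c *\<^sub>C w (h - r)))
          + (\<Sum>r\<le>h. (if r = 0 then 0 else \<phi> (r - 1) t) *\<^sub>C w (h - r)))"
    by (simp add: complex_vector.scale_sum_right scaleC_add_right scaleC_add_left
        ring_distribs mult_ac sum.distrib)
  also have "(\<Sum>r\<le>h. (if r = 0 then 0 else \<phi> (r - 1) t) *\<^sub>C w (h - r))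
      = (\<Sum>r\<le>h. \<phi> r t *\<^sub>C (if h - r = 0 then 0 else w (h - r - 1)))"
  proof (cases h)
    case (Suc h')
    have "(\<Sum>r\<le>h. (if r = 0 then 0 else \<phi> (r - 1) t) *\<^sub>C w (h - r)) = (\<Sum>r\<le>h'. \<phi> r t *\<^sub>C w (h' - r))"
      unfolding Suc sum.atMost_Suc_shift by simp
    also have "\<dots> = (\<Sum>r\<le>h. \<phi> r t *\<^sub>C (if h - r = 0 then 0 else w (h - r - 1)))"
      unfolding Suc sum.atMost_Suc by (auto intro!: sum.cong)
    finally show ?thesis .
  qed simp
  finally show ?thesis
    unfolding es by (simp add: scaleC_add_right sum.distrib)
qed

text \<open>The operator \<open>-\<i> d/dt\<close> maps the elementary solution of \<open>w\<close> to that of \<open>h \<mapsto> c w\<^sup>h + w\<^sup>h\<^sup>-\<^sup>1\<close>, that is, it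
  acts on the coefficients as multiplication by \<open>\<mu>\<close>.\<close>

lemma keldysh_chain_eq:
  "keldysh_chain m c w h j = (if j < m then keldysh_coeff c w j h else 0)"
proof -
  have "((\<lambda>v t. vector_derivative v (at t)) ^^ j) (elementary_solution c w h)
      = (\<lambda>t. \<i> ^ j *\<^sub>C elementary_solution c (keldysh_coeff c w j) h t)"
  proof (induction j)
    case 0
    have "keldysh_coeff c w 0 = w" by (simp add: fun_eq_iff)
    then show ?case by simp
  next
    case (Suc j)
    have ks: "keldysh_coeff c w (Suc j) =
        (\<lambda>h. c *\<^sub>C keldysh_coeff c w j h + (if h = 0 then 0 else keldysh_coeff c w j (h - 1)))"
      by (simp add: fun_eq_iff)
    have "vector_derivative (\<lambda>t. \<i> ^ j *\<^sub>C elementary_solution c (keldysh_coeff c w j) h t) (at t)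
        = \<i> ^ j *\<^sub>C \<i> *\<^sub>C elementary_solution c (keldysh_coeff c w (Suc j)) h t" for t
      by (rule vector_derivative_at, rule has_vector_derivative_scaleC_right)
        (use elementary_solution_derivative[of c "keldysh_coeff c w j" h t]
          in \<open>simp add: ks\<close>)
    then show ?case by (simp add: Suc.IH mult.commute ks)
  qed
  moreover have "elementary_solution c u h 0 = u h" for u :: "nat \<Rightarrow> 'a"
  proof -
    have "(\<Sum>r\<le>h. ((\<i> * complex_of_real 0) ^ r / fact r) *\<^sub>C u (h - r))
        = (\<Sum>r\<le>h. if r = 0 then u h else 0)"
      by (intro sum.cong refl) (simp add: power_0_left)
    then show ?thesis by (simp add: elementary_solution_def)
  qed
  ultimately show ?thesis
    by (simp add: keldysh_chain_def flip: power_mult_distrib)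
qed

text \<open>The scalar function \<open>(w(\<mu>), F(cnj \<mu>))\<close> as a polynomial in \<open>\<mu> - c\<close>. The next two lemmas are the bridge
  between orthogonality to derived chains and orders of vanishing.\<close>

definition pairing_poly ::
    "nat \<Rightarrow> complex \<Rightarrow> (nat \<Rightarrow> 'a::complex_inner) \<Rightarrow> nat \<Rightarrow> (nat \<Rightarrow> 'a) \<Rightarrow> complex poly" where
  "pairing_poly m c w l f = (\<Sum>j<l. [:c, 1:] ^ j * (\<Sum>r<m. monom (cinner (w r) (f j)) r))"

lemma poly_pairing_poly:
  "poly (pairing_poly m c w l f) (\<mu> - c) = cinner (vpoly m c w \<mu>) (vpoly l 0 f (cnj \<mu>))"
  by (simp add: pairing_poly_def vpoly_def poly_sum poly_monom cinner_linear_simps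
      sum_distrib_left mult_ac)

lemma coeff_pairing_poly:
  assumes "h < m"
  shows "coeff (pairing_poly m c w l f) h = cnj (Hpow_inner l f (keldysh_chain l c w h))"
proof -
  have *: "coeff ([:c, 1:] ^ j * (\<Sum>r<m. monom (cinner (w r) y) r)) h
      = cinner (keldysh_coeff c w j h) y" if "h < m" for j h and y :: 'a
    using that
  proof (induction j arbitrary: h)
    case 0
    then show ?case by (simp add: coeff_sum)
  next
    case (Suc j)
    have "coeff ([:c, 1:] ^ Suc j * (\<Sum>r<m. monom (cinner (w r) y) r)) h
        = coeff ([:c, 1:] * ([:c, 1:] ^ j * (\<Sum>r<m. monom (cinner (w r) y) r))) h"
      by (simp only: power_Suc mult.assoc)
    also have "\<dots> = cinner (keldysh_coeff c w (Suc j) h) y"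
      using Suc by (cases h)
        (simp_all add: mult_pCons_left cinner_add_left cinner_scaleC_left)
    finally show ?case .
  qed
  have "coeff (pairing_poly m c w l f) h = (\<Sum>j<l. cinner (keldysh_coeff c w j h) (f j))"
    unfolding pairing_poly_def coeff_sum using * assms by simp
  also have "\<dots> = cnj (Hpow_inner l f (keldysh_chain l c w h))"
    by (simp add: Hpow_inner_def keldysh_chain_eq cinner_commute[symmetric])
  finally show ?thesis .
qed

section \<open>A vanishing criterion on the real line\<close>

text \<open>Riemann's removable singularity theorem, applied to the points of \<open>K\<close> one after the other.\<close>

lemma holomorphic_extend_finite:
  assumes "finite K" "open S" "f holomorphic_on (S - K)"
    and "\<And>c. c \<in> K \<Longrightarrow> c \<in> S \<Longrightarrow> \<exists>B. \<forall>\<^sub>F z in at c. norm (f z) \<le> B"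
  shows "\<exists>g. g holomorphic_on S \<and> (\<forall>z\<in>S - K. g z = f z)"
  using assms
proof (induction K arbitrary: S)
  case (insert c K)
  have "S - insert c K = (S - {c}) - K" by auto
  then obtain g where g: "g holomorphic_on (S - {c})" "\<And>z. z \<in> S - insert c K \<Longrightarrow> g z = f z"
    using insert.IH[of "S - {c}"] insert.prems by (auto simp: open_Diff)
  show ?case
  proof (cases "c \<in> S")
    case True
    have "\<forall>\<^sub>F z in at c. z \<in> S - K - {c}"
    proof -
      have "c \<in> S - (K - {c})" "open (S - (K - {c}))"
        using True insert by (auto intro!: open_Diff finite_imp_closed)
      then have "\<forall>\<^sub>F z in at c. z \<in> S - (K - {c}) \<and> z \<noteq> c"
        by (auto simp: eventually_at_topological)
      then show ?thesis by eventually_elim auto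
    qed
    moreover obtain B where "\<forall>\<^sub>F z in at c. norm (f z) \<le> B"
      using insert.prems(3)[of c] True by auto
    ultimately have "\<forall>\<^sub>F z in at c. norm (g z) \<le> B"
      by eventually_elim (use g(2) in auto)
    moreover have "c \<in> interior S"
      using True insert.prems(1) by (simp add: interior_open)
    ultimately obtain g' where "g' holomorphic_on S" "\<And>z. z \<in> S - {c} \<Longrightarrow> g' z = g z"
      using holomorphic_on_extend_bounded[OF g(1)] by blast
    then show ?thesis
      using g(2) by (intro exI[of _ g']) auto
  next
    case False
    then show ?thesis using g by auto
  qed
qed auto

text \<open>Cauchy's theorem on the upper half disc of radius \<open>R\<close>: the term \<open>\<rho> / z\<close> contributes \<open>\<i> \<pi> \<rho>\<close> on the arc,
  and the rest of \<open>h\<close> at most \<open>C / R\<^sup>2\<close> times the length \<open>\<pi> R\<close>.\<close>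

lemma half_plane_integral:
  assumes h: "h holomorphic_on {z. Im z \<ge> 0}" and R: "R > 0" "R \<ge> R0"
    and decay: "\<And>z. Im z \<ge> 0 \<Longrightarrow> norm z \<ge> R0 \<Longrightarrow> norm (h z - of_real \<rho> / z) \<le> C / (norm z)\<^sup>2"
  shows "norm (integral {-R..R} (\<lambda>t. h (of_real t)) + of_real (\<rho> * pi) * \<i>) \<le> C * pi / R"
proof -
  let ?H = "{z. Im z \<ge> 0}" and ?arc = "part_circlepath 0 R 0 pi"
  have C: "C \<ge> 0"
    using order_trans[OF norm_ge_zero decay[of "of_real R"]] R by (auto simp: zero_le_divide_iff)
  have conv: "convex ?H"
    using convex_halfspace_Im_ge[of 0] by simp
  have arc: "path_image ?arc \<subseteq> ?H" "\<And>z. z \<in> path_image ?arc \<Longrightarrow> norm z = R"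
    using R by (auto simp: path_image_part_circlepath Im_exp norm_mult sin_ge_zero
        in_path_image_part_circlepath)
  have line: "path_image (linepath (- of_real R) (of_real R)) \<subseteq> ?H"
    by (simp add: path_image_linepath closed_segment_subset[OF _ _ conv])
  have int: "h contour_integrable_on (linepath (- of_real R) (of_real R))"
    "h contour_integrable_on ?arc"
    using holomorphic_on_imp_continuous_on[OF h] line arc(1)
    by (auto intro!: contour_integrable_continuous_linepath contour_integrable_continuous_part_circlepath
        intro: continuous_on_subset simp: path_image_linepath)
  have "(h has_contour_integral 0) (linepath (- of_real R) (of_real R) +++ ?arc)"
    using R line arc(1) by (intro Cauchy_theorem_convex_simple[OF h conv])
      (auto simp: path_image_join exp_pi_i' exp_Euler)
  then have zero: "contour_integral (linepath (- of_real R) (of_real R)) h + contour_integral ?arc h = 0"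
    using int by (simp add: contour_integral_join[symmetric] contour_integral_unique)
  have "contour_integral (linepath (of_real (-R)) (of_real R)) h = integral {-R..R} (\<lambda>t. h (of_real t))"
    using R by (subst contour_integral_linepath_Reals_eq) auto
  moreover have "contour_integral ?arc (\<lambda>z. of_real \<rho> / z) = of_real (\<rho> * pi) * \<i>"
    using R by (simp add: contour_integral_part_circlepath_eq scaleR_conv_of_real)
  moreover have rint: "(\<lambda>z. of_real \<rho> / z) contour_integrable_on ?arc"
    using R arc(2)[of 0] by (intro contour_integrable_continuous_part_circlepath continuous_intros) auto
  moreover have "norm (contour_integral ?arc (\<lambda>z. h z - of_real \<rho> / z)) \<le> C / R\<^sup>2 * R * (pi - 0)"
    using decay arc R C contour_integrable_diff[OF int(2) rint]
    by (intro has_contour_integral_bound_part_circlepath[OF has_contour_integral_integral])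
      (auto simp: subset_iff)
  moreover have "contour_integral ?arc (\<lambda>z. h z - of_real \<rho> / z)
      = contour_integral ?arc h - contour_integral ?arc (\<lambda>z. of_real \<rho> / z)"
    by (rule contour_integral_diff[OF int(2) rint])
  ultimately have "norm (- integral {-R..R} (\<lambda>t. h (of_real t)) - of_real (\<rho> * pi) * \<i>) \<le> C / R\<^sup>2 * R * pi"
    using zero by (simp add: eq_neg_iff_add_eq_0[symmetric] add.commute)
  also have "norm (- integral {-R..R} (\<lambda>t. h (of_real t)) - of_real (\<rho> * pi) * \<i>)
      = norm (integral {-R..R} (\<lambda>t. h (of_real t)) + of_real (\<rho> * pi) * \<i>)"
    by (metis add_uminus_conv_diff minus_add_distrib norm_minus_cancel)
  also have "C / R\<^sup>2 * R * pi = C * pi / R"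
    using R by (simp add: power2_eq_square)
  finally show ?thesis .
qed

text \<open>The imaginary part of the integral of \<open>h\<close> over \<open>[-R, R]\<close> is non-negative, but by Cauchy's theorem it
  tends to \<open>- \<pi> \<rho> \<le> 0\<close>. So \<open>\<rho> = 0\<close> and the non-negative function \<open>Im h\<close> has integral \<open>0\<close>.\<close>

lemma half_plane_nonneg_imp_zero:
  assumes h: "h holomorphic_on {z. Im z \<ge> 0}" and "\<rho> \<ge> 0"
    and decay: "\<And>z. Im z \<ge> 0 \<Longrightarrow> norm z \<ge> R0 \<Longrightarrow> norm (h z - of_real \<rho> / z) \<le> C / (norm z)\<^sup>2"
    and nonneg: "\<And>t::real. Im (h (of_real t)) \<ge> 0"
  shows "\<rho> = 0" "Im (h (of_real t)) = 0"
proof -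
  define J where "J R = integral {-R..R} (\<lambda>t. Im (h (of_real t)))" for R :: real
  have cont: "continuous_on A (\<lambda>t. h (of_real t))" for A :: "real set"
    by (rule continuous_on_compose2[OF holomorphic_on_imp_continuous_on[OF h]])
      (auto intro!: continuous_intros)
  have cont_Im: "continuous_on A (\<lambda>t. Im (h (of_real t)))" for A :: "real set"
    by (intro continuous_intros cont)
  have J0: "J R \<ge> 0" for R
    unfolding J_def by (intro integral_nonneg integrable_continuous_real cont_Im nonneg)
  have J_le: "J R + \<rho> * pi \<le> C * pi / R" if "R \<ge> max R0 1" for R
  proof -
    have "Im (integral {-R..R} (\<lambda>t. h (of_real t))) = J R"
      unfolding J_def using integral_linear[OF integrable_continuous_real[OF cont] bounded_linear_Im, of "-R" R]
      by (simp add: o_def)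
    then have "J R + \<rho> * pi = Im (integral {-R..R} (\<lambda>t. h (of_real t)) + of_real (\<rho> * pi) * \<i>)"
      by simp
    also have "\<dots> \<le> norm (integral {-R..R} (\<lambda>t. h (of_real t)) + of_real (\<rho> * pi) * \<i>)"
      using abs_Im_le_cmod order_trans abs_ge_self by blast
    also have "\<dots> \<le> C * pi / R"
      by (rule half_plane_integral[OF h _ _ decay]) (use that in auto)
    finally show ?thesis .
  qed
  have lim: "((\<lambda>R. C * pi / R) \<longlongrightarrow> 0) at_top"
    by (rule real_tendsto_divide_at_top[OF tendsto_const filterlim_ident])
  \<comment> \<open>\<open>R \<ge> 1\<close> keeps the radius positive\<close>
  have ev: "\<forall>\<^sub>F R in at_top. R \<ge> max R0 1"
    by (rule eventually_ge_at_top)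
  have "\<rho> * pi \<le> 0"
  proof (rule tendsto_lowerbound[OF lim])
    show "\<forall>\<^sub>F R in at_top. \<rho> * pi \<le> C * pi / R"
      using ev
    proof eventually_elim
      case (elim R)
      then show ?case using J_le[OF elim] J0[of R] by simp
    qed
  qed simp
  then show rho: "\<rho> = 0"
    using assms(2) pi_gt_zero by (simp add: mult_le_0_iff)
  define R1 where "R1 = \<bar>t\<bar> + 1"
  have "J R1 \<le> 0"
  proof (rule tendsto_lowerbound[OF lim])
    show "\<forall>\<^sub>F R in at_top. J R1 \<le> C * pi / R"
      using ev eventually_ge_at_top[of R1]
    proof eventually_elim
      case (elim R)
      have "J R1 \<le> J R"
        unfolding J_def using elim
        by (intro integral_subset_le integrable_continuous_real cont_Im nonneg ballI) auto
      then show ?case using J_le[OF elim(1)] rho by simp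
    qed
  qed simp
  then have "J R1 = 0" using J0[of R1] by simp
  then have "\<forall>x\<in>{-R1..R1}. Im (h (of_real x)) = 0"
    unfolding J_def by (subst (asm) integral_eq_0_iff) (auto simp: R1_def intro!: cont_Im nonneg)
  moreover have "t \<in> {-R1..R1}" by (auto simp: R1_def)
  ultimately show "Im (h (of_real t)) = 0" by blast
qed

text \<open>Subtract the real poles. The result \<open>h\<close> is holomorphic on the closed upper half plane, has the same
  imaginary part on the real line as \<open>G\<close>, and behaves like \<open>\<rho> / z\<close> at infinity, where
  \<open>\<rho> = - \<Sum> r c \<ge> 0\<close>. Hence \<open>h\<close> is real on the real line and \<open>\<rho> = 0\<close>, so that no pole was subtracted. Now
  \<open>\<i> h\<^sup>2\<close> satisfies the same assumptions, because its imaginary part on the real line is \<open>(Re h)\<^sup>2\<close>; so \<open>h\<close>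
  vanishes there.\<close>

lemma real_line_vanishing:
  fixes G :: "complex \<Rightarrow> complex" and r :: "complex \<Rightarrow> real"
  assumes K: "finite K" and G: "G holomorphic_on - K"
    and upper: "\<And>c. c \<in> K \<Longrightarrow> Im c > 0 \<Longrightarrow> \<exists>B. \<forall>\<^sub>F z in at c. norm (G z) \<le> B"
    and real: "\<And>c. c \<in> K \<Longrightarrow> Im c = 0 \<Longrightarrow> r c \<le> 0"
      "\<And>c. c \<in> K \<Longrightarrow> Im c = 0 \<Longrightarrow> \<exists>B. \<forall>\<^sub>F z in at c. norm (G z - of_real (r c) / (z - c)) \<le> B"
    and decay: "\<And>z. norm z \<ge> R0 \<Longrightarrow> norm (G z) \<le> C / (norm z)\<^sup>2"
    and nonneg: "\<And>t::real. of_real t \<notin> K \<Longrightarrow> Im (G (of_real t)) \<ge> 0"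
    and t: "of_real t \<notin> K"
  shows "G (of_real t) = 0"
proof -
  define K0 where "K0 = {c \<in> K. Im c = 0}"
  have K0: "finite K0" "K0 \<subseteq> K" using K by (auto simp: K0_def)
  define P where "P z = (\<Sum>c\<in>K0. of_real (r c) / (z - c))" for z
  define S where "S = - {c \<in> K. Im c < 0}"
  have S: "open S" using K by (auto simp: S_def intro!: finite_imp_closed)
  \<comment> \<open>near \<open>c\<close> only the pole at \<open>c\<close> itself is unbounded\<close>
  have bounded_terms: "\<exists>B. \<forall>\<^sub>F z in at c. norm (\<Sum>c'\<in>K0 - {c}. of_real (r c') / (z - c')) \<le> B" for c
  proof -
    have "((\<lambda>z. \<Sum>c'\<in>K0 - {c}. of_real (r c') / (z - c')) \<longlongrightarrow>
        (\<Sum>c'\<in>K0 - {c}. of_real (r c') / (c - c'))) (at c)"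
      by (intro tendsto_intros) auto
    then have "\<forall>\<^sub>F z in at c. norm (\<Sum>c'\<in>K0 - {c}. of_real (r c') / (z - c'))
        < norm (\<Sum>c'\<in>K0 - {c}. of_real (r c') / (c - c')) + 1"
      by (intro order_tendstoD(2)[OF tendsto_norm]) auto
    then show ?thesis by (blast intro: eventually_mono less_imp_le)
  qed
  have "\<exists>h. h holomorphic_on S \<and> (\<forall>z\<in>S - {c \<in> K. Im c \<ge> 0}. h z = G z - P z)"
  proof (rule holomorphic_extend_finite)
    have eq: "S - {c \<in> K. Im c \<ge> 0} = - K" by (auto simp: S_def)
    show "(\<lambda>z. G z - P z) holomorphic_on S - {c \<in> K. Im c \<ge> 0}"
      unfolding eq P_def using K0(2) by (intro holomorphic_intros G) auto
  next
    fix c assume "c \<in> {c \<in> K. Im c \<ge> 0}"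
    then have c: "c \<in> K" "Im c \<ge> 0" by auto
    obtain B1 where B1: "\<forall>\<^sub>F z in at c. norm (\<Sum>c'\<in>K0 - {c}. of_real (r c') / (z - c')) \<le> B1"
      using bounded_terms by blast
    obtain B2 where B2: "\<forall>\<^sub>F z in at c.
        norm (G z - (if c \<in> K0 then of_real (r c) / (z - c) else 0)) \<le> B2"
    proof (cases "c \<in> K0")
      case True
      then show ?thesis using that real(2)[of c] by (auto simp: K0_def)
    next
      case False
      then show ?thesis using that upper[of c] c by (auto simp: K0_def)
    qed
    have P_eq: "P z = (if c \<in> K0 then of_real (r c) / (z - c) else 0) + (\<Sum>c'\<in>K0 - {c}. of_real (r c') / (z - c'))"
      for z using K0(1) by (auto simp: P_def sum.remove)
    from B1 B2 have "\<forall>\<^sub>F z in at c. norm (G z - P z) \<le> B2 + B1"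
    proof (eventually_elim)
      case (elim z)
      then show ?case
        using norm_triangle_ineq4[of "G z - (if c \<in> K0 then of_real (r c) / (z - c) else 0)"
            "\<Sum>c'\<in>K0 - {c}. of_real (r c') / (z - c')"]
        by (simp add: P_eq diff_diff_eq)
    qed
    then show "\<exists>B. \<forall>\<^sub>F z in at c. norm (G z - P z) \<le> B" by blast
  qed (use K S in auto)
  then obtain h where h: "h holomorphic_on S" "\<And>z. z \<in> S \<Longrightarrow> z \<notin> K \<Longrightarrow> h z = G z - P z"
    by auto
  have HS: "{z. Im z \<ge> 0} \<subseteq> S" by (auto simp: S_def)
  have hH: "h holomorphic_on {z. Im z \<ge> 0}"
    using h(1) HS by (rule holomorphic_on_subset)
  have P_real: "Im (P (of_real s)) = 0" for s
    unfolding P_def Im_sum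
  proof (intro sum.neutral ballI)
    fix c assume "c \<in> K0"
    then have "c = of_real (Re c)" by (simp add: K0_def complex_eq_iff)
    then have "of_real (r c) / (of_real s - c) = complex_of_real (r c / (s - Re c))"
      by (metis of_real_diff of_real_divide)
    then show "Im (of_real (r c) / (of_real s - c)) = 0" by (simp only: Im_complex_of_real)
  qed
  have h_nonneg: "Im (h (of_real s)) \<ge> 0" for s :: real
  proof (rule tendsto_lowerbound)
    have "continuous_on UNIV (\<lambda>s::real. Im (h (of_real s)))"
      by (intro continuous_intros continuous_on_compose2[OF holomorphic_on_imp_continuous_on[OF hH]])
        auto
    then show "((\<lambda>s::real. Im (h (of_real s))) \<longlongrightarrow> Im (h (of_real s))) (at s)"
      by (simp add: continuous_on_def)
    have "finite (Re ` K)" using K by simp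
    then have "open (- (Re ` K - {s}))"
      by (intro open_Compl finite_imp_closed) simp
    then have "\<forall>\<^sub>F x in at s. x \<notin> Re ` K - {s}"
      unfolding eventually_at_topological by (intro exI[of _ "- (Re ` K - {s})"]) auto
    moreover have "\<forall>\<^sub>F x in at s. x \<noteq> s" by (simp add: eventually_at_filter)
    ultimately show "\<forall>\<^sub>F x in at s. 0 \<le> Im (h (of_real x))"
    proof eventually_elim
      case (elim x)
      then have "of_real x \<notin> K" by (metis Diff_iff Re_complex_of_real empty_iff image_eqI insert_iff)
      moreover have "of_real x \<in> S" using HS by auto
      ultimately show ?case
        using h(2)[of "of_real x"] nonneg[of x] P_real[of x] by simp
    qed
  qed simp
  define \<rho> where "\<rho> = - (\<Sum>c\<in>K0. r c)"
  have rho: "\<rho> \<ge> 0" using real(1) by (auto simp: \<rho>_def K0_def intro!: sum_nonpos)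
  \<comment> \<open>for \<open>norm z \<ge> R1\<close> the poles are so far away that \<open>norm (z - c) \<ge> norm z / 2\<close>\<close>
  define R1 where "R1 = Max (insert 1 (insert R0 ((\<lambda>c. 2 * norm c + 1) ` K)))"
  have R1: "R1 \<ge> 1" "R1 \<ge> R0" "\<And>c. c \<in> K \<Longrightarrow> R1 \<ge> 2 * norm c + 1"
    unfolding R1_def by (rule Max_ge; use K in auto)+
  define C' where "C' = C + (\<Sum>c\<in>K0. \<bar>r c\<bar> * (2 * norm c))"
  have h_decay: "norm (h z - of_real \<rho> / z) \<le> C' / (norm z)\<^sup>2" if z: "Im z \<ge> 0" "norm z \<ge> R1" for z
  proof -
    have zK: "z \<notin> K"
    proof
      assume "z \<in> K"
      then show False using R1(3)[of z] z(2) norm_ge_zero[of z] by linarith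
    qed
    have "of_real \<rho> / z = - (\<Sum>c\<in>K0. of_real (r c) / z)"
      by (simp add: \<rho>_def sum_divide_distrib)
    then have "h z - of_real \<rho> / z = G z + (\<Sum>c\<in>K0. of_real (r c) * (1 / z - 1 / (z - c)))"
      using h(2)[OF subsetD[OF HS] zK] z(1) by (simp add: P_def sum_subtractf right_diff_distrib)
    also have "norm \<dots> \<le> norm (G z) + (\<Sum>c\<in>K0. norm (of_real (r c) * (1 / z - 1 / (z - c))))"
      by (intro norm_triangle_mono order_refl norm_sum)
    also have "\<dots> \<le> C / (norm z)\<^sup>2 + (\<Sum>c\<in>K0. \<bar>r c\<bar> * (2 * norm c) / (norm z)\<^sup>2)"
    proof (intro add_mono sum_mono)
      show "norm (G z) \<le> C / (norm z)\<^sup>2" using decay z R1(2) by simp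
      fix c assume c: "c \<in> K0"
      then have big: "norm z \<ge> 2 * norm c + 1" using R1(3)[of c] K0(2) z by auto
      have "norm z > 0" "norm z > norm c"
        using big norm_ge_zero[of c] by linarith+
      then have nz: "z \<noteq> 0" "z \<noteq> c" by auto
      have zc: "norm (z - c) \<ge> norm z / 2"
        using norm_triangle_ineq2[of z c] big by simp
      have "1 / z - 1 / (z - c) = - c / (z * (z - c))"
        using nz by (simp add: field_simps)
      then have "norm (of_real (r c) * (1 / z - 1 / (z - c))) = \<bar>r c\<bar> * (norm c / (norm z * norm (z - c)))"
        by (simp add: norm_mult norm_divide)
      also have "\<dots> \<le> \<bar>r c\<bar> * (norm c / (norm z * (norm z / 2)))"
        using zc nz by (intro mult_left_mono divide_left_mono) auto
      finally show "norm (of_real (r c) * (1 / z - 1 / (z - c))) \<le> \<bar>r c\<bar> * (2 * norm c) / (norm z)\<^sup>2"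
        by (simp add: power2_eq_square mult_ac)
    qed
    also have "\<dots> = C' / (norm z)\<^sup>2"
      by (simp add: C'_def sum_divide_distrib[symmetric] add_divide_distrib)
    finally show ?thesis .
  qed
  have step1: "\<rho> = 0" "Im (h (of_real s)) = 0" for s
    using half_plane_nonneg_imp_zero(1)[OF hH rho _ h_nonneg, of R1 C']
      half_plane_nonneg_imp_zero(2)[OF hH rho _ h_nonneg, of R1 C' s] h_decay by blast+
  have "\<rho> = 0" by (rule step1(1))
  then have "\<forall>c\<in>K0. - r c = 0"
    using real(1) by (subst sum_nonneg_eq_0_iff[symmetric, OF K0(1)]) (auto simp: \<rho>_def K0_def sum_negf)
  then have "P z = 0" for z by (simp add: P_def)
  moreover have "of_real t \<in> S" using HS by auto
  ultimately have hG: "h (of_real t) = G (of_real t)"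
    using h(2)[of "of_real t"] t by simp
  \<comment> \<open>\<open>h\<close> is already known to be real on the real line; the same criterion for \<open>\<i> h\<^sup>2\<close> removes the real part\<close>
  have "Im (\<i> * (h (of_real t))\<^sup>2) = 0"
  proof (rule half_plane_nonneg_imp_zero(2)[where h = "\<lambda>z. \<i> * (h z)\<^sup>2" and t = t
        and \<rho> = 0 and ?R0.0 = R1 and C = "C'\<^sup>2"])
    show "(\<lambda>z. \<i> * (h z)\<^sup>2) holomorphic_on {z. Im z \<ge> 0}"
      by (intro holomorphic_intros hH)
    show "Im (\<i> * (h (of_real s))\<^sup>2) \<ge> 0" for s :: real
      using step1(2)[of s] by (simp add: power2_eq_square)
    show "norm (\<i> * (h z)\<^sup>2 - of_real 0 / z) \<le> C'\<^sup>2 / (norm z)\<^sup>2"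
      if z: "Im z \<ge> 0" "norm z \<ge> R1" for z
    proof -
      have "norm (h z) \<le> C' / (norm z)\<^sup>2" using h_decay[OF z] \<open>\<rho> = 0\<close> by simp
      then have "(norm (h z))\<^sup>2 \<le> (C' / (norm z)\<^sup>2)\<^sup>2" by (intro power_mono) auto
      also have "\<dots> = C'\<^sup>2 / (norm z)\<^sup>2 / (norm z)\<^sup>2" by (simp add: power_divide power2_eq_square)
      also have "\<dots> \<le> C'\<^sup>2 / (norm z)\<^sup>2 / 1"
        using z R1(1) by (intro divide_left_mono) (auto intro: one_le_power)
      finally show ?thesis by (simp add: norm_mult norm_power)
    qed
  qed simp
  then have "Re (h (of_real t)) = 0" using step1(2)[of t] by (simp add: power2_eq_square)
  then show ?thesis using step1(2)[of t] hG by (simp add: complex_eq_iff)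
qed

section \<open>The resolvent form\<close>

lemma tendsto_imp_norm_bounded:
  assumes "(f \<longlongrightarrow> L) F"
  shows "\<exists>B. \<forall>\<^sub>F z in F. norm (f z) \<le> B"
proof -
  have "\<forall>\<^sub>F z in F. norm (f z) < norm L + 1"
    using assms by (intro order_tendstoD(2)[OF tendsto_norm]) auto
  then show ?thesis by (blast intro: eventually_mono less_imp_le)
qed

lemma bij_inv_cancel: "bij T \<Longrightarrow> T (inv T x) = x" "bij T \<Longrightarrow> inv T (T x) = x"
  by (simp_all add: bij_is_surj surj_f_inv_f bij_is_inj)

lemma tendsto_pencil:
  assumes fd: "cfinite_dim TYPE('a::complex_inner)"
    and A: "\<And>i. i \<le> n \<Longrightarrow> clinear (A i :: 'a::complex_inner \<Rightarrow> 'a)"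
    and "(a \<longlongrightarrow> c) F" "(x \<longlongrightarrow> u) F"
  shows "((\<lambda>\<mu>. pencil A n (a \<mu>) (x \<mu>)) \<longlongrightarrow> pencil A n c u) F"
  unfolding pencil_def
proof (intro tendsto_sum tendsto_scaleC tendsto_power assms(3))
  fix i assume "i \<in> {..n}"
  then have "bounded_linear (A i)"
    by (intro clinear_bounded_linear[OF fd] A) simp
  then show "((\<lambda>\<mu>. A i (x \<mu>)) \<longlongrightarrow> A i u) F"
    using assms(4) by (rule bounded_linear.tendsto)
qed

lemma not_eigenvalue_iff_inj:
  assumes A: "\<And>i. i \<le> n \<Longrightarrow> clinear (A i)"
  shows "\<not> eigenvalue A n c \<longleftrightarrow> inj (pencil A n c)"
  using clinear_inj_iff[OF pencil_clinear, of n A c] A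
  by (auto simp: eigenvalue_def pencil_ker_def)

lemma not_eigenvalue_imp_bij:
  assumes "cfinite_dim TYPE('a::complex_inner)"
    and "\<And>i. i \<le> n \<Longrightarrow> clinear (A i :: 'a::complex_inner \<Rightarrow> 'a)" and "\<not> eigenvalue A n c"
  shows "bij (pencil A n c)"
proof (rule clinear_inj_imp_bij[OF assms(1)])
  show "clinear (pencil A n c)" by (rule pencil_clinear) (rule assms(2))
  have "\<not> eigenvalue A n c \<longleftrightarrow> inj (pencil A n c)"
    by (rule not_eigenvalue_iff_inj) (rule assms(2))
  then show "inj (pencil A n c)" using assms(3) by blast
qed

text \<open>From \<open>A(\<mu>) (A(\<mu>)\<^sup>-\<^sup>1 x\<^sub>\<mu> - v) = x\<^sub>\<mu> - A(\<mu>) v\<close> with \<open>v = A(c)\<^sup>-\<^sup>1 u\<close>, and the bound for \<open>A(\<mu>)\<^sup>-\<^sup>1\<close> near \<open>c\<close>.\<close>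

lemma resolvent_tendsto:
  fixes A :: "nat \<Rightarrow> 'a::complex_inner \<Rightarrow> 'a"
  assumes fd: "cfinite_dim TYPE('a)" and A: "\<And>i. i \<le> n \<Longrightarrow> clinear (A i)"
    and c: "\<not> eigenvalue A n c" and x: "(x \<longlongrightarrow> u) (at c)"
  shows "((\<lambda>\<mu>. inv (pencil A n \<mu>) (x \<mu>)) \<longlongrightarrow> inv (pencil A n c) u) (at c)"
    and "\<forall>\<^sub>F \<mu> in at c. bij (pencil A n \<mu>)"
proof -
  have linP: "clinear (pencil A n \<mu>)" for \<mu> by (rule pencil_clinear) (rule A)
  have bij: "bij (pencil A n c)" by (rule not_eigenvalue_imp_bij[OF fd A c])
  have "((\<lambda>\<mu>. pencil A n \<mu> x) \<longlongrightarrow> pencil A n c x) (at c)" for x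
    by (intro tendsto_pencil[OF fd A] tendsto_intros)
  from perturbed_inverse_bounded[OF fd linP bij_is_inj[OF bij] linP this]
  obtain C where C: "C > 0"
    "\<forall>\<^sub>F \<mu> in at c. bij (pencil A n \<mu>) \<and> (\<forall>x. norm x \<le> C * norm (pencil A n \<mu> x))"
    by blast
  then show "\<forall>\<^sub>F \<mu> in at c. bij (pencil A n \<mu>)" by (auto elim: eventually_mono)
  define v where "v = inv (pencil A n c) u"
  have "((\<lambda>\<mu>. x \<mu> - pencil A n \<mu> v) \<longlongrightarrow> u - pencil A n c v) (at c)"
    by (intro tendsto_diff x tendsto_pencil[OF fd A] tendsto_intros)
  then have "((\<lambda>\<mu>. C * norm (x \<mu> - pencil A n \<mu> v)) \<longlongrightarrow> C * 0) (at c)"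
    by (intro tendsto_mult tendsto_const tendsto_norm_zero) (simp add: v_def bij_inv_cancel[OF bij])
  then have "((\<lambda>\<mu>. C * norm (x \<mu> - pencil A n \<mu> v)) \<longlongrightarrow> 0) (at c)" by simp
  then have "((\<lambda>\<mu>. inv (pencil A n \<mu>) (x \<mu>) - v) \<longlongrightarrow> 0) (at c)"
  proof (rule Lim_null_comparison[rotated])
    show "\<forall>\<^sub>F \<mu> in at c. norm (inv (pencil A n \<mu>) (x \<mu>) - v) \<le> C * norm (x \<mu> - pencil A n \<mu> v)"
      using C(2)
    proof eventually_elim
      case (elim \<mu>)
      then have "norm (inv (pencil A n \<mu>) (x \<mu>) - v)
          \<le> C * norm (pencil A n \<mu> (inv (pencil A n \<mu>) (x \<mu>) - v))" by blast
      also have "pencil A n \<mu> (inv (pencil A n \<mu>) (x \<mu>) - v) = x \<mu> - pencil A n \<mu> v"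
        using elim by (simp add: clinear_diff[OF linP] bij_inv_cancel)
      finally show ?case .
    qed
  qed
  then show "((\<lambda>\<mu>. inv (pencil A n \<mu>) (x \<mu>)) \<longlongrightarrow> inv (pencil A n c) u) (at c)"
    unfolding v_def by (simp only: Lim_null[symmetric])
qed

text \<open>The difference quotient of \<open>v(\<mu>) = A(\<mu>)\<^sup>-\<^sup>1 x\<close> at \<open>c\<close> is \<open>- A(c)\<^sup>-\<^sup>1 q(\<mu>)\<close>, where
  \<open>q(\<mu>) = ((A(\<mu>) - A(c)) / (\<mu> - c)) v(\<mu>)\<close>; continuity of \<open>v\<close> gives its limit.\<close>

lemma resolvent_holomorphic:
  fixes A :: "nat \<Rightarrow> 'a::complex_inner \<Rightarrow> 'a"
  assumes fd: "cfinite_dim TYPE('a)" and A: "\<And>i. i \<le> n \<Longrightarrow> clinear (A i)"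
  shows "(\<lambda>\<mu>. cinner (inv (pencil A n \<mu>) x) y) holomorphic_on {c. \<not> eigenvalue A n c}"
  unfolding holomorphic_on_def
proof
  have linP: "clinear (pencil A n \<mu>)" for \<mu> by (rule pencil_clinear) (rule A)
  fix c assume "c \<in> {c. \<not> eigenvalue A n c}"
  then have c: "\<not> eigenvalue A n c" by simp
  define v where "v \<mu> = inv (pencil A n \<mu>) x" for \<mu>
  have bij: "bij (pencil A n c)" by (rule not_eigenvalue_imp_bij[OF fd A c])
  have v: "(v \<longlongrightarrow> v c) (at c)" "\<forall>\<^sub>F \<mu> in at c. bij (pencil A n \<mu>)"
    unfolding v_def by (rule resolvent_tendsto[OF fd A c tendsto_const]; assumption)+
  define B where "B = inv (pencil A n c)"
  have linB: "clinear B" unfolding B_def by (rule clinear_inv[OF linP bij])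
  define q where "q \<mu> = (\<Sum>i\<le>n. ((\<mu> ^ i - c ^ i) / (\<mu> - c)) *\<^sub>C A i (v \<mu>))" for \<mu>
  define q0 where "q0 = (\<Sum>i\<le>n. (of_nat i * c ^ (i - 1)) *\<^sub>C A i (v c))"
  have "((\<lambda>\<mu>. (\<mu> ^ i - c ^ i) / (\<mu> - c)) \<longlongrightarrow> of_nat i * c ^ (i - 1)) (at c)" for i
  proof -
    have "((\<lambda>\<mu>. \<mu> ^ i) has_field_derivative of_nat i * c ^ (i - 1)) (at c)"
      by (auto intro!: derivative_eq_intros)
    then show ?thesis by (simp only: has_field_derivative_iff)
  qed
  moreover have "((\<lambda>\<mu>. A i (v \<mu>)) \<longlongrightarrow> A i (v c)) (at c)" if "i \<le> n" for i
    using v(1) by (rule bounded_linear.tendsto[OF clinear_bounded_linear[OF fd A[OF that]]])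
  ultimately have "(q \<longlongrightarrow> q0) (at c)"
    unfolding q_def q0_def by (intro tendsto_sum tendsto_scaleC) auto
  then have lim: "((\<lambda>\<mu>. - cinner (B (q \<mu>)) y) \<longlongrightarrow> - cinner (B q0) y) (at c)"
    by (intro tendsto_minus tendsto_cinner tendsto_const
        bounded_linear.tendsto[OF clinear_bounded_linear[OF fd linB]])
  have "\<forall>\<^sub>F \<mu> in at c. - cinner (B (q \<mu>)) y = (cinner (v \<mu>) y - cinner (v c) y) / (\<mu> - c)"
    using v(2) eventually_neq_at_within[of c c UNIV]
  proof eventually_elim
    case (elim \<mu>)
    have cancel: "c ^ i - \<mu> ^ i = - (\<mu> - c) * ((\<mu> ^ i - c ^ i) / (\<mu> - c))" for i
    proof -
      define d where "d = \<mu> - c"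
      have "d \<noteq> 0" using elim(2) by (simp add: d_def)
      then have "- d * ((\<mu> ^ i - c ^ i) / d) = - (\<mu> ^ i - c ^ i)" by simp
      then show ?thesis by (simp add: d_def)
    qed
    have "pencil A n c (v c) = pencil A n \<mu> (v \<mu>)"
      unfolding v_def bij_inv_cancel(1)[OF elim(1)] bij_inv_cancel(1)[OF bij] ..
    then have "pencil A n c (v \<mu> - v c) = pencil A n c (v \<mu>) - pencil A n \<mu> (v \<mu>)"
      by (simp add: clinear_diff[OF linP])
    also have "\<dots> = (\<Sum>i\<le>n. (c ^ i - \<mu> ^ i) *\<^sub>C A i (v \<mu>))"
      unfolding pencil_def complex_vector.scale_left_diff_distrib sum_subtractf ..
    also have "\<dots> = (- (\<mu> - c)) *\<^sub>C q \<mu>"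
      unfolding q_def complex_vector.scale_sum_right complex_vector.scale_scale
      by (simp only: cancel)
    finally have "B (pencil A n c (v \<mu> - v c)) = B ((- (\<mu> - c)) *\<^sub>C q \<mu>)"
      by (rule arg_cong)
    then have "v \<mu> - v c = (- (\<mu> - c)) *\<^sub>C B (q \<mu>)"
      unfolding clinear_scaleC[OF linB] by (simp only: B_def bij_inv_cancel(2)[OF bij])
    then have "cinner (v \<mu> - v c) y = - (\<mu> - c) * cinner (B (q \<mu>)) y"
      by (simp only: cinner_scaleC_left)
    then show ?case
      using elim(2) by (simp add: cinner_diff_left nonzero_eq_divide_eq algebra_simps)
  qed
  then have "((\<lambda>\<mu>. (cinner (v \<mu>) y - cinner (v c) y) / (\<mu> - c)) \<longlongrightarrow> - cinner (B q0) y) (at c)"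
    using lim by (rule Lim_transform_eventually[rotated])
  then have "((\<lambda>\<mu>. cinner (v \<mu>) y) has_field_derivative - cinner (B q0) y) (at c)"
    by (simp add: has_field_derivative_iff)
  then show "(\<lambda>\<mu>. cinner (inv (pencil A n \<mu>) x) y) field_differentiable at c within {c. \<not> eigenvalue A n c}"
    unfolding v_def field_differentiable_def by (blast intro: has_field_derivative_at_within)
qed

text \<open>The conjugate in the second argument makes the function holomorphic in \<open>\<mu>\<close>; on the real line it is a
  quadratic form.\<close>

definition resolvent_form ::
    "(nat \<Rightarrow> 'a::complex_inner \<Rightarrow> 'a) \<Rightarrow> nat \<Rightarrow> nat \<Rightarrow> (nat \<Rightarrow> 'a) \<Rightarrow> complex \<Rightarrow> complex" where
  "resolvent_form A n l f \<mu> =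
     cinner (inv (pencil A n \<mu>) (vpoly l 0 f \<mu>)) (vpoly l 0 f (cnj \<mu>))"

lemma resolvent_form_holomorphic:
  fixes A :: "nat \<Rightarrow> 'a::complex_inner \<Rightarrow> 'a"
  assumes fd: "cfinite_dim TYPE('a)" and A: "\<And>i. i \<le> n \<Longrightarrow> clinear (A i)"
  shows "resolvent_form A n l f holomorphic_on {c. \<not> eigenvalue A n c}"
proof -
  have linP: "clinear (pencil A n \<mu>)" for \<mu> by (rule pencil_clinear) (rule A)
  have "(\<lambda>\<mu>. \<Sum>i<l. \<Sum>j<l. \<mu> ^ i * \<mu> ^ j * cinner (inv (pencil A n \<mu>) (f i)) (f j))
      holomorphic_on {c. \<not> eigenvalue A n c}"
    by (intro holomorphic_intros resolvent_holomorphic[OF fd A])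
  then show ?thesis
  proof (rule holomorphic_transform)
    fix \<mu> assume "\<mu> \<in> {c. \<not> eigenvalue A n c}"
    then have "bij (pencil A n \<mu>)" using not_eigenvalue_imp_bij[OF fd A] by simp
    then have lin: "clinear (inv (pencil A n \<mu>))" by (rule clinear_inv[OF linP])
    show "(\<Sum>i<l. \<Sum>j<l. \<mu> ^ i * \<mu> ^ j * cinner (inv (pencil A n \<mu>) (f i)) (f j)) = resolvent_form A n l f \<mu>"
      by (simp add: resolvent_form_def vpoly_def clinear_sum[OF lin] clinear_scaleC[OF lin]
          cinner_linear_simps sum_distrib_left mult_ac)
        (subst sum.swap, intro sum.cong refl mult.left_commute)
  qed
qed

text \<open>The family \<open>\<mu>\<^sup>-\<^sup>n A(\<mu>)\<close> tends to \<open>A\<^sub>n\<close> at infinity, so the inverse of \<open>A(\<mu>)\<close> is \<open>O(\<mu>\<^sup>-\<^sup>2\<^sup>l)\<close>, while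
  both factors \<open>F\<close> are \<open>O(\<mu>\<^sup>l\<^sup>-\<^sup>1)\<close>.\<close>

lemma resolvent_form_decay:
  fixes A :: "nat \<Rightarrow> 'a::complex_inner \<Rightarrow> 'a"
  assumes fd: "cfinite_dim TYPE('a)" and A: "\<And>i. i \<le> n \<Longrightarrow> clinear (A i)"
    and lead: "{x. A n x = 0} = {0}" and n: "n = 2 * l" and l: "l > 0"
  obtains R C where "\<And>\<mu>. norm \<mu> \<ge> R \<Longrightarrow> norm (resolvent_form A n l f \<mu>) \<le> C / (norm \<mu>)\<^sup>2"
proof -
  have linP: "clinear (pencil A n \<mu>)" for \<mu> by (rule pencil_clinear) (rule A)
  define S where "S \<mu> x = (1 / \<mu> ^ n) *\<^sub>C pencil A n \<mu> x" for \<mu> x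
  have linS: "clinear (S \<mu>)" for \<mu>
    using linP[of \<mu>] by (auto simp: S_def[abs_def] clinear_iff scaleC_add_right mult.commute)
  have inj: "inj (A n)" using lead by (subst clinear_inj_iff[OF A]) auto
  have "((\<lambda>\<mu>. S \<mu> x) \<longlongrightarrow> A n x) at_infinity" for x
  proof -
    have "((\<lambda>\<mu>. \<mu> ^ i / \<mu> ^ n) \<longlongrightarrow> (if i = n then 1 else 0)) (at_infinity :: complex filter)"
      if "i \<le> n" for i
    proof (cases "i = n")
      case True
      have "\<forall>\<^sub>F \<mu> in at_infinity. 1 = \<mu> ^ i / (\<mu> :: complex) ^ n"
        using eventually_not_equal_at_infinity[of "0::complex"]
        by eventually_elim (simp add: True)
      then show ?thesis using True by (auto intro: Lim_transform_eventually[OF tendsto_const])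
    next
      case False
      then have lt: "n - i > 0" using that by simp
      have "((\<lambda>\<mu>. inverse \<mu> ^ (n - i)) \<longlongrightarrow> 0 ^ (n - i)) (at_infinity :: complex filter)"
        by (intro tendsto_power tendsto_inverse_0)
      then have *: "((\<lambda>\<mu>. inverse \<mu> ^ (n - i)) \<longlongrightarrow> 0) (at_infinity :: complex filter)"
        using lt by (simp add: power_0_left)
      have "\<forall>\<^sub>F \<mu> in at_infinity. inverse \<mu> ^ (n - i) = \<mu> ^ i / (\<mu> :: complex) ^ n"
        using eventually_not_equal_at_infinity[of "0::complex"]
        by eventually_elim (simp add: power_diff that field_simps)
      then show ?thesis using False Lim_transform_eventually[OF *] by simp
    qed
    then have "((\<lambda>\<mu>. \<Sum>i\<le>n. (\<mu> ^ i / \<mu> ^ n) *\<^sub>C A i x) \<longlongrightarrow> (\<Sum>i\<le>n. (if i = n then 1 else 0) *\<^sub>C A i x)) at_infinity"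
      by (intro tendsto_sum tendsto_scaleC tendsto_const) auto
    also have "(\<lambda>\<mu>. \<Sum>i\<le>n. (\<mu> ^ i / \<mu> ^ n) *\<^sub>C A i x) = (\<lambda>\<mu>. S \<mu> x)"
      by (simp add: S_def pencil_def complex_vector.scale_sum_right)
    also have "(\<Sum>i\<le>n. (if i = n then 1 else 0) *\<^sub>C A i x) = (\<Sum>i\<le>n. if i = n then A i x else 0)"
      by (intro sum.cong) auto
    finally show ?thesis by simp
  qed
  from perturbed_inverse_bounded[OF fd A[OF order_refl] inj linS this]
  obtain C where C: "C > 0"
    "\<forall>\<^sub>F \<mu> in at_infinity. bij (S \<mu>) \<and> (\<forall>x. norm x \<le> C * norm (S \<mu> x))" by blast
  then obtain R where R: "\<And>\<mu> x. norm \<mu> \<ge> R \<Longrightarrow> norm x \<le> C * norm (S \<mu> x)"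
    unfolding eventually_at_infinity by blast
  define D where "D = (\<Sum>j<l. norm (f j))"
  have F: "norm (vpoly l 0 f \<mu>) \<le> norm \<mu> ^ (l - 1) * D" if "norm \<mu> \<ge> 1" for \<mu>
  proof -
    have "norm (vpoly l 0 f \<mu>) \<le> (\<Sum>j<l. norm \<mu> ^ j * norm (f j))"
      unfolding vpoly_def by (rule order_trans[OF norm_sum]) (simp add: norm_scaleC norm_power)
    also have "\<dots> \<le> (\<Sum>j<l. norm \<mu> ^ (l - 1) * norm (f j))"
      using that by (intro sum_mono mult_right_mono power_increasing) auto
    finally show ?thesis by (simp add: D_def sum_distrib_left)
  qed
  show ?thesis
  proof (rule that)
    fix \<mu> :: complex assume "max R 1 \<le> norm \<mu>"
    then have mu: "norm \<mu> \<ge> R" "norm \<mu> \<ge> 1" "\<mu> \<noteq> 0" by auto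
    define r where "r = norm \<mu>"
    have r: "r \<ge> 1" using mu by (simp add: r_def)
    have low: "norm x \<le> C * (norm (pencil A n \<mu> x) / r ^ n)" for x
      using R[OF mu(1), of x] by (simp add: S_def norm_scaleC norm_divide norm_power r_def)
    have "inj (pencil A n \<mu>)"
      unfolding clinear_inj_iff[OF linP]
    proof (intro allI impI)
      fix x assume "pencil A n \<mu> x = 0"
      then show "x = 0" using low[of x] by simp
    qed
    then have bij: "bij (pencil A n \<mu>)" by (rule clinear_inj_imp_bij[OF fd linP])
    have "norm (resolvent_form A n l f \<mu>)
        \<le> norm (inv (pencil A n \<mu>) (vpoly l 0 f \<mu>)) * norm (vpoly l 0 f (cnj \<mu>))"
      unfolding resolvent_form_def by (rule cmod_cinner_le)
    also have "\<dots> \<le> (C * (r ^ (l - 1) * D / r ^ n)) * (r ^ (l - 1) * D)"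
    proof (intro mult_mono)
      have "norm (inv (pencil A n \<mu>) (vpoly l 0 f \<mu>)) \<le> C * (norm (vpoly l 0 f \<mu>) / r ^ n)"
        using low[of "inv (pencil A n \<mu>) (vpoly l 0 f \<mu>)"] by (simp add: bij_inv_cancel[OF bij])
      also have "\<dots> \<le> C * (r ^ (l - 1) * D / r ^ n)"
        using F[OF mu(2)] C(1) r by (intro mult_left_mono divide_right_mono) (auto simp: r_def)
      finally show "norm (inv (pencil A n \<mu>) (vpoly l 0 f \<mu>)) \<le> C * (r ^ (l - 1) * D / r ^ n)" .
      show "norm (vpoly l 0 f (cnj \<mu>)) \<le> r ^ (l - 1) * D"
        using F[of "cnj \<mu>"] mu(2) by (simp add: r_def)
    qed (use C(1) r in \<open>auto simp: D_def intro!: mult_nonneg_nonneg divide_nonneg_nonneg sum_nonneg\<close>)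
    also have "\<dots> = C * D\<^sup>2 * ((r ^ (l - 1) * r ^ (l - 1)) / r ^ n)"
      by (simp add: power2_eq_square)
    also have "(r ^ (l - 1) * r ^ (l - 1)) / r ^ n = 1 / r\<^sup>2"
    proof -
      have "n = (l - 1) + (l - 1) + 2" using n l by simp
      then have "r ^ n = r ^ (l - 1) * r ^ (l - 1) * r\<^sup>2" by (simp only: power_add)
      then show ?thesis using r by simp
    qed
    finally show "norm (resolvent_form A n l f \<mu>) \<le> C * D\<^sup>2 / (norm \<mu>)\<^sup>2"
      by (simp add: r_def)
  qed
qed

lemma resolvent_form_Im_nonneg:
  fixes A :: "nat \<Rightarrow> 'a::complex_inner \<Rightarrow> 'a"
  assumes "bij (pencil A n (of_real t))"
    and "\<And>x. Im (cinner (pencil A n (of_real t) x) x) \<le> 0"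
  shows "Im (resolvent_form A n l f (of_real t)) \<ge> 0"
proof -
  define y where "y = inv (pencil A n (of_real t)) (vpoly l 0 f (of_real t))"
  have "pencil A n (of_real t) y = vpoly l 0 f (of_real t)"
    by (simp add: y_def bij_inv_cancel[OF assms(1)])
  then have "resolvent_form A n l f (of_real t) = cnj (cinner (pencil A n (of_real t) y) y)"
    by (simp add: resolvent_form_def y_def[symmetric] cinner_commute[symmetric])
  then show ?thesis using assms(2)[of y] by simp
qed

text \<open>Split off the power of \<open>\<mu> - c\<close> that belongs to the first non-zero coefficient.\<close>

lemma vpoly_leading_factor:
  assumes "\<exists>j<l. g j \<noteq> 0"
  obtains h where "h < l" "g h \<noteq> 0"
    "\<And>\<mu>. vpoly l c g \<mu> = (\<mu> - c) ^ h *\<^sub>C vpoly (l - h) c (\<lambda>i. g (h + i)) \<mu>"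
proof -
  define h where "h = (LEAST j. j < l \<and> g j \<noteq> 0)"
  have h: "h < l \<and> g h \<noteq> 0" unfolding h_def using assms by (rule LeastI_ex)
  have "g j = 0" if "j < h" for j
    using not_less_Least[of j "\<lambda>j. j < l \<and> g j \<noteq> 0"] that h by (auto simp: h_def)
  then have "vpoly (h + (l - h)) c g \<mu> = (\<mu> - c) ^ h *\<^sub>C vpoly (l - h) c (\<lambda>i. g (h + i)) \<mu>" for \<mu>
    by (rule vpoly_factor)
  then have "vpoly l c g \<mu> = (\<mu> - c) ^ h *\<^sub>C vpoly (l - h) c (\<lambda>i. g (h + i)) \<mu>" for \<mu>
    using h by (metis le_add_diff_inverse less_imp_le)
  then show ?thesis by (rule that[OF conjunct1[OF h] conjunct2[OF h]])
qed

lemma vpoly_eq_zero_imp: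
  assumes "\<And>\<mu>. vpoly l c g \<mu> = 0" "j < l"
  shows "g j = 0"
proof (rule ccontr)
  assume "g j \<noteq> 0"
  then obtain h where h: "h < l" "g h \<noteq> 0"
    "\<And>\<mu>. vpoly l c g \<mu> = (\<mu> - c) ^ h *\<^sub>C vpoly (l - h) c (\<lambda>i. g (h + i)) \<mu>"
    using vpoly_leading_factor[of l g c] assms(2) by blast
  let ?q = "vpoly (l - h) c (\<lambda>i. g (h + i))"
  have "(?q \<longlongrightarrow> ?q c) (at c)" by (rule tendsto_vpoly)
  moreover have "\<forall>\<^sub>F \<mu> in at c. ?q \<mu> = 0"
    using eventually_neq_at_within[of c c UNIV]
  proof eventually_elim
    case (elim \<mu>)
    then show ?case using assms(1)[of \<mu>] h(3)[of \<mu>] by simp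
  qed
  ultimately have "((\<lambda>_. 0) \<longlongrightarrow> ?q c) (at c)" by (rule Lim_transform_eventually)
  then have "?q c = 0" using tendsto_const_iff[of "at c" 0 "?q c"] by simp
  then show False using h vpoly_at_centre[of "l - h" c "\<lambda>i. g (h + i)"] by simp
qed

lemma vpoly_recentre: "\<exists>g. \<forall>\<mu>. vpoly l c g \<mu> = vpoly l 0 f \<mu>"
proof (cases l)
  case 0
  then show ?thesis by (simp add: vpoly_def)
next
  case (Suc k)
  define P where "P i x = f i" for i and x :: 'a
  have "vpoly l 0 f \<mu> = pencil P k \<mu> 0" for \<mu>
    by (simp add: vpoly_def pencil_def P_def Suc lessThan_Suc_atMost)
  also have "pencil P k \<mu> 0 = vpoly l c (\<lambda>j. (1 / fact j) *\<^sub>C pencil_deriv P k j c 0) \<mu>" for \<mu>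
    unfolding vpoly_def by (rule pencil_taylor) (simp add: Suc)
  finally show ?thesis by metis
qed

text \<open>If \<open>F\<close> is not zero, write \<open>F(\<mu>) = (\<mu> - \<tau>)\<^sup>h q(\<mu>)\<close> with \<open>q(\<tau>) \<noteq> 0\<close>. For real \<open>t \<noteq> \<tau>\<close> the power cancels, and
  \<open>(A(t)\<^sup>-\<^sup>1 q(t), q(t)) = 0\<close>. In the limit \<open>(A(\<tau>) y, y) = 0\<close> for \<open>y = A(\<tau>)\<^sup>-\<^sup>1 q(\<tau>) \<noteq> 0\<close>, which the numerical
  range at \<open>\<tau>\<close> forbids.\<close>

lemma resolvent_form_zero_imp:
  fixes A :: "nat \<Rightarrow> 'a::complex_inner \<Rightarrow> 'a"
  assumes fd: "cfinite_dim TYPE('a)" and A: "\<And>i. i \<le> n \<Longrightarrow> clinear (A i)"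
    and def: "0 \<notin> numerical_range (pencil A n (of_real \<tau>))"
    and zero: "\<And>t::real. \<not> eigenvalue A n (of_real t) \<Longrightarrow> resolvent_form A n l f (of_real t) = 0"
    and j: "j < l"
  shows "f j = 0"
proof -
  have linP: "clinear (pencil A n \<mu>)" for \<mu> by (rule pencil_clinear) (rule A)
  let ?c = "complex_of_real \<tau>"
  have form: "x = 0" if "cinner (pencil A n ?c x) x = 0" for x
  proof (rule ccontr)
    assume "x \<noteq> 0"
    define u where "u = (1 / complex_of_real (norm x)) *\<^sub>C x"
    have "norm u = 1" using \<open>x \<noteq> 0\<close> by (simp add: u_def norm_scaleC norm_divide)
    moreover have "cinner (pencil A n ?c u) u = 0"
      using that by (simp add: u_def clinear_scaleC[OF linP] cinner_linear_simps)
    ultimately have "0 \<in> numerical_range (pencil A n ?c)"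
      unfolding numerical_range_def by (metis (mono_tags, lifting) mem_Collect_eq)
    then show False using def by simp
  qed
  have c: "\<not> eigenvalue A n ?c"
    using form by (auto simp: eigenvalue_def pencil_ker_def)
  have bij: "bij (pencil A n ?c)" by (rule not_eigenvalue_imp_bij[OF fd A c])
  obtain g where g: "\<And>\<mu>. vpoly l ?c g \<mu> = vpoly l 0 f \<mu>"
    using vpoly_recentre by blast
  have "\<not> (\<exists>j<l. g j \<noteq> 0)"
  proof
    assume "\<exists>j<l. g j \<noteq> 0"
    then obtain h where h: "h < l" "g h \<noteq> 0"
      "\<And>\<mu>. vpoly l ?c g \<mu> = (\<mu> - ?c) ^ h *\<^sub>C vpoly (l - h) ?c (\<lambda>i. g (h + i)) \<mu>"
      using vpoly_leading_factor[of l g ?c] by blast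
    let ?q = "vpoly (l - h) ?c (\<lambda>i. g (h + i))"
    have q: "(?q \<longlongrightarrow> g h) (at ?c)"
      using tendsto_vpoly[of "l - h" ?c "\<lambda>i. g (h + i)" ?c] h(1) by (simp add: vpoly_at_centre)
    define \<Phi> where "\<Phi> \<mu> = cinner (inv (pencil A n \<mu>) (?q \<mu>)) (?q \<mu>)" for \<mu>
    have "(\<Phi> \<longlongrightarrow> cinner (inv (pencil A n ?c) (g h)) (g h)) (at ?c)"
      unfolding \<Phi>_def by (intro tendsto_cinner resolvent_tendsto(1)[OF fd A c] q)
    moreover have real: "filterlim complex_of_real (at ?c) (at \<tau>)"
      unfolding filterlim_at by (auto intro!: tendsto_intros simp: eventually_at_filter)
    ultimately have lim: "((\<lambda>t. \<Phi> (of_real t)) \<longlongrightarrow> cinner (inv (pencil A n ?c) (g h)) (g h)) (at \<tau>)"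
      by (rule filterlim_compose)
    have "\<forall>\<^sub>F t in at \<tau>. bij (pencil A n (of_real t))"
      using real resolvent_tendsto(2)[OF fd A c tendsto_const[of 0]]
      by (rule eventually_compose_filterlim[rotated])
    then have "\<forall>\<^sub>F t in at \<tau>. \<Phi> (of_real t) = 0"
      using eventually_neq_at_within[of \<tau> \<tau> UNIV]
    proof eventually_elim
      case (elim t)
      let ?s = "(complex_of_real t - ?c) ^ h"
      have "\<not> eigenvalue A n (of_real t) \<longleftrightarrow> inj (pencil A n (of_real t))"
        by (rule not_eigenvalue_iff_inj) (rule A)
      then have "\<not> eigenvalue A n (of_real t)"
        using elim(1) bij_is_inj by blast
      then have "0 = resolvent_form A n l f (of_real t)" by (simp add: zero)
      also have "\<dots> = ?s * cnj ?s * \<Phi> (of_real t)"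
        using clinear_scaleC[OF clinear_inv[OF linP elim(1)]]
        by (simp add: resolvent_form_def \<Phi>_def g[symmetric] h(3) cinner_linear_simps)
      finally show ?case using elim(2) by simp
    qed
    with lim have "((\<lambda>_. 0) \<longlongrightarrow> cinner (inv (pencil A n ?c) (g h)) (g h)) (at \<tau>)"
      by (rule Lim_transform_eventually)
    then have "cinner (inv (pencil A n ?c) (g h)) (g h) = 0"
      using tendsto_const_iff[of "at \<tau>" 0 "cinner (inv (pencil A n ?c) (g h)) (g h)"] by simp
    then have "cinner (pencil A n ?c (inv (pencil A n ?c) (g h))) (inv (pencil A n ?c) (g h)) = 0"
      by (metis bij_inv_cancel(1)[OF bij] cinner_commute complex_cnj_zero)
    then have "inv (pencil A n ?c) (g h) = 0" by (rule form)
    then have "g h = 0"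
      by (metis bij_inv_cancel(1)[OF bij] clinear_zero[OF linP])
    then show False using h(2) by simp
  qed
  then have "vpoly l 0 f \<mu> = 0" for \<mu>
    unfolding g[symmetric] by (auto simp: vpoly_def)
  then show "f j = 0" using j by (rule vpoly_eq_zero_imp)
qed

section \<open>Eigenvalues off the real line\<close>

lemma chain_defect_add:
  assumes A: "\<And>i. i \<le> n \<Longrightarrow> clinear (A i)"
  shows "chain_defect A n c (\<lambda>h. v h + w h) h = chain_defect A n c v h + chain_defect A n c w h"
proof -
  have lin: "clinear (pencil_deriv A n j c)" for j by (rule pencil_deriv_clinear) (rule A)
  show ?thesis
    unfolding chain_defect_def clinear_add[OF lin] scaleC_add_right sum.distrib ..
qed

lemma chain_defect_sum:
  assumes A: "\<And>i. i \<le> n \<Longrightarrow> clinear (A i)"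
  shows "chain_defect A n c (\<lambda>h. \<Sum>k\<in>J. a k *\<^sub>C v k h) h = (\<Sum>k\<in>J. a k *\<^sub>C chain_defect A n c (v k) h)"
proof -
  have lin: "clinear (pencil_deriv A n j c)" for j by (rule pencil_deriv_clinear) (rule A)
  show ?thesis
    unfolding chain_defect_def clinear_sum[OF lin] clinear_scaleC[OF lin]
      complex_vector.scale_sum_right complex_vector.scale_scale
    by (subst sum.swap) (simp add: mult.commute)
qed

text \<open>Multiplication of a power series by \<open>(\<mu> - c)\<^sup>d\<close>.\<close>

definition delay :: "nat \<Rightarrow> (nat \<Rightarrow> 'a::zero) \<Rightarrow> nat \<Rightarrow> 'a" where
  "delay d w h = (if d \<le> h then w (h - d) else 0)"

lemma chain_defect_delay:
  assumes A: "\<And>i. i \<le> n \<Longrightarrow> clinear (A i)"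
  shows "chain_defect A n c (delay d w) h = delay d (chain_defect A n c w) h"
proof -
  have lin: "clinear (pencil_deriv A n j c)" for j by (rule pencil_deriv_clinear) (rule A)
  show ?thesis
  proof (cases "d \<le> h")
    case True
    have "chain_defect A n c (delay d w) h
        = (\<Sum>j\<le>h - d. (1 / fact j) *\<^sub>C pencil_deriv A n j c (delay d w (h - j)))"
      unfolding chain_defect_def
      by (rule sum.mono_neutral_right) (auto simp: delay_def clinear_zero[OF lin])
    also have "\<dots> = chain_defect A n c w (h - d)"
      unfolding chain_defect_def using True
    proof (intro sum.cong refl)
      fix j assume "j \<in> {..h - d}"
      then have "d \<le> h - j" "h - j - d = h - d - j" using True by auto
      then show "(1 / fact j) *\<^sub>C pencil_deriv A n j c (delay d w (h - j))
          = (1 / fact j) *\<^sub>C pencil_deriv A n j c (w (h - d - j))"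
        by (simp add: delay_def)
    qed
    finally show ?thesis using True by (simp add: delay_def)
  next
    case False
    then show ?thesis
      by (auto simp: chain_defect_def delay_def clinear_zero[OF lin] intro!: sum.neutral)
  qed
qed

lemma pencil_deriv_0: "pencil_deriv A n 0 c x = pencil A n c x"
  by (simp add: pencil_deriv_def pencil_def)

lemma exchange_basis:
  assumes "vector_space sc" and inj: "inj_on b I" and ind: "\<not> module.dependent sc (b ` I)"
    and k0: "k0 \<in> I" and u: "u = sc a (b k0) + r" "a \<noteq> 0"
    and r: "r \<in> module.span sc (b ` (I - {k0}))"
  shows "inj_on (b(k0 := u)) I" "\<not> module.dependent sc ((b(k0 := u)) ` I)"
    "module.span sc ((b(k0 := u)) ` I) = module.span sc (b ` I)"
proof -
  interpret vector_space sc by fact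
  let ?W = "b ` (I - {k0})"
  have bI: "b ` I = insert (b k0) ?W" using k0 by auto
  have notin: "b k0 \<notin> ?W" using inj k0 by (simp add: inj_on_image_mem_iff)
  have "independent (insert (b k0) ?W)" using ind unfolding bI .
  then have indW: "independent ?W" and bk: "b k0 \<notin> span ?W"
    unfolding independent_insert using notin by simp_all
  have b_eq: "b k0 = sc (1 / a) (u - r)" using u by simp
  have uW: "u \<notin> span ?W"
  proof
    assume "u \<in> span ?W"
    then have "b k0 \<in> span ?W" unfolding b_eq using r by (intro span_scale span_diff)
    then show False using bk by simp
  qed
  have img: "(b(k0 := u)) ` I = insert u ?W" using k0 by auto
  show "independent ((b(k0 := u)) ` I)"
    unfolding img using uW indW by (rule independent_insertI)
  have ne: "b z \<noteq> u" if "z \<in> I" "z \<noteq> k0" for z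
    using uW span_base[of "b z" ?W] that by auto
  show "inj_on (b(k0 := u)) I"
  proof (rule inj_onI)
    fix x y assume xy: "x \<in> I" "y \<in> I" and eq: "(b(k0 := u)) x = (b(k0 := u)) y"
    show "x = y"
    proof (cases "x = k0 \<or> y = k0")
      case True
      then show ?thesis using eq ne[OF xy(1)] ne[OF xy(2)] by (auto split: if_splits)
    next
      case False
      then have "b x = b y" using eq by simp
      then show ?thesis using inj xy by (simp add: inj_on_eq_iff)
    qed
  qed
  show "span ((b(k0 := u)) ` I) = span (b ` I)"
    unfolding img bI
  proof (rule antisym; rule span_minimal[OF _ subspace_span])
    have r': "r \<in> span (insert v ?W)" for v
      using r by (rule subsetD[OF span_mono[OF subset_insertI]])
    have W: "?W \<subseteq> span (insert v ?W)" for v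
      by (rule order_trans[OF subset_insertI span_superset])
    have "b k0 \<in> span (insert (b k0) ?W)" by (rule span_base) simp
    then have "u \<in> span (insert (b k0) ?W)"
      unfolding u(1) by (intro span_add span_scale r')
    with W[of "b k0"] show "insert u ?W \<subseteq> span (insert (b k0) ?W)" by (simp only: insert_subset)
    have "u \<in> span (insert u ?W)" by (rule span_base) simp
    then have "b k0 \<in> span (insert u ?W)"
      by (subst b_eq) (intro span_diff span_scale r')
    with W[of u] show "insert (b k0) ?W \<subseteq> span (insert u ?W)" by (simp only: insert_subset)
  qed
qed

text \<open>Suppose that some \<open>\<beta> k\<close> is not zero, and among those let \<open>k0\<close> have the longest chain, \<open>p k0 = m\<close>. The
  combination \<open>\<Sum>\<^sub>k \<beta>\<^sub>k (\<mu> - c)\<^sup>m\<^sup>-\<^sup>p w\<^sub>k(\<mu>) + (\<mu> - c)\<^sup>m\<^sup>+\<^sup>1 e\<close> (with \<open>p = p k\<close>) is a chain of length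
  \<open>m + 2\<close>. Its eigenvector contains \<open>w\<^sub>k\<^sub>0\<^sup>0\<close>, so it may replace the chain \<open>k0\<close>, which contradicts the
  maximality of the total length.\<close>

lemma canonical_defect_independent:
  fixes A :: "nat \<Rightarrow> 'a::complex_inner \<Rightarrow> 'a"
  assumes A: "\<And>i. i \<le> n \<Longrightarrow> clinear (A i)" and can: "canonical_system A n c I p w"
    and zero: "(\<Sum>k\<in>I. \<beta> k *\<^sub>C chain_defect A n c (truncate_at (Suc (p k)) (w k)) (Suc (p k)))
      + pencil A n c e = 0"
    and k: "k \<in> I"
  shows "\<beta> k = 0"
proof (rule ccontr)
  assume "\<beta> k \<noteq> 0"
  have fam: "chain_family A n c I p w"
    and max: "\<And>p' w'. chain_family A n c I p' w' \<Longrightarrow> (\<Sum>k\<in>I. p' k + 1) \<le> (\<Sum>k\<in>I. p k + 1)"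
    using can by (auto simp: canonical_system_def)
  have I: "finite I" using fam by (simp add: chain_family_def)
  have chain: "chain_defect A n c (truncate_at (Suc (p k)) (w k)) h = 0" if "k \<in> I" "h \<le> p k" for k h
    using fam that by (simp add: chain_defect_truncate chain_family_def eigen_chain_iff)
  define J where "J = {k \<in> I. \<beta> k \<noteq> 0}"
  have J: "finite J" "J \<subseteq> I" "J \<noteq> {}" using I k \<open>\<beta> k \<noteq> 0\<close> by (auto simp: J_def)
  define m where "m = Max (p ` J)"
  have le_m: "p k \<le> m" if "k \<in> J" for k unfolding m_def using J that by auto
  have "m \<in> p ` J"
    unfolding m_def using J by (intro Max_in) auto
  then obtain k0 where k0: "k0 \<in> J" "p k0 = m" by auto
  define v where "v k = delay (m - p k) (truncate_at (Suc (p k)) (w k))" for k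
  define u where "u h = (\<Sum>k\<in>J. \<beta> k *\<^sub>C v k h) + delay (Suc m) (\<lambda>h. if h = 0 then e else 0) h" for h
  have defect: "chain_defect A n c u h = 0" if "h \<le> Suc m" for h
  proof -
    let ?t = "\<lambda>k. truncate_at (Suc (p k)) (w k)" and ?e = "\<lambda>h. if h = (0::nat) then e else 0"
    have e1: "chain_defect A n c u h = chain_defect A n c (\<lambda>h. \<Sum>k\<in>J. \<beta> k *\<^sub>C v k h) h
        + chain_defect A n c (delay (Suc m) ?e) h"
      unfolding u_def[abs_def] by (rule chain_defect_add) (rule A)
    have e2: "chain_defect A n c (\<lambda>h. \<Sum>k\<in>J. \<beta> k *\<^sub>C v k h) h
        = (\<Sum>k\<in>J. \<beta> k *\<^sub>C chain_defect A n c (v k) h)"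
      by (rule chain_defect_sum) (rule A)
    have e3: "chain_defect A n c (v k) h = delay (m - p k) (chain_defect A n c (?t k)) h" for k
      unfolding v_def by (rule chain_defect_delay) (rule A)
    have e4: "chain_defect A n c (delay (Suc m) ?e) h = delay (Suc m) (chain_defect A n c ?e) h"
      by (rule chain_defect_delay) (rule A)
    have eq: "chain_defect A n c u h
        = (\<Sum>k\<in>J. \<beta> k *\<^sub>C delay (m - p k) (chain_defect A n c (?t k)) h)
          + delay (Suc m) (chain_defect A n c ?e) h"
      by (simp only: e1 e2 e3 e4)
    show ?thesis
    proof (cases "h = Suc m")
      case True
      have "h - (m - p k) = Suc (p k)" if "k \<in> J" for k
        using le_m[OF that] True by simp
      then have "chain_defect A n c u h
          = (\<Sum>k\<in>J. \<beta> k *\<^sub>C chain_defect A n c (truncate_at (Suc (p k)) (w k)) (Suc (p k))) + pencil A n c e"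
        unfolding eq using True by (simp add: delay_def chain_defect_def pencil_deriv_0 le_diff_conv)
      also have "(\<Sum>k\<in>J. \<beta> k *\<^sub>C chain_defect A n c (truncate_at (Suc (p k)) (w k)) (Suc (p k)))
          = (\<Sum>k\<in>I. \<beta> k *\<^sub>C chain_defect A n c (truncate_at (Suc (p k)) (w k)) (Suc (p k)))"
        using I by (intro sum.mono_neutral_left) (auto simp: J_def)
      finally show ?thesis using zero by simp
    next
      case False
      have "delay (m - p k) (chain_defect A n c (truncate_at (Suc (p k)) (w k))) h = 0" if "k \<in> J" for k
        using le_m[OF that] J(2) that \<open>h \<le> Suc m\<close> False by (auto simp: delay_def intro!: chain)
      then show ?thesis
        unfolding eq using False that by (simp add: delay_def)
    qed
  qed
  have u0: "u 0 = \<beta> k0 *\<^sub>C w k0 0 + (\<Sum>k\<in>J - {k0}. \<beta> k *\<^sub>C v k 0)"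
    unfolding u_def sum.remove[OF J(1) k0(1)]
    using k0(2) by (simp add: v_def delay_def truncate_at_def)
  have rest: "(\<Sum>k\<in>J - {k0}. \<beta> k *\<^sub>C v k 0) \<in> complex_vector.span ((\<lambda>k. w k 0) ` (I - {k0}))"
  proof (intro complex_vector.span_sum complex_vector.span_scale)
    fix k assume "k \<in> J - {k0}"
    then show "v k 0 \<in> complex_vector.span ((\<lambda>k. w k 0) ` (I - {k0}))"
      using J(2) by (auto simp: v_def delay_def truncate_at_def
          intro: complex_vector.span_base complex_vector.span_zero)
  qed
  have "k0 \<in> I" "\<beta> k0 \<noteq> 0" using k0 by (auto simp: J_def)
  note ex = exchange_basis[OF complex_vector.vector_space_axioms _ _ this(1) u0 this(2) rest]
  define w' where "w' = w(k0 := u)"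
  define p' where "p' = p(k0 := Suc m)"
  have upd: "(\<lambda>k. w' k 0) = (\<lambda>k. w k 0)(k0 := u 0)" by (auto simp: w'_def)
  have fam_w: "inj_on (\<lambda>k. w k 0) I" "complex_vector.independent ((\<lambda>k. w k 0) ` I)"
    "complex_vector.span ((\<lambda>k. w k 0) ` I) = pencil_ker A n c"
    using fam by (auto simp: chain_family_def)
  have ind: "complex_vector.independent ((\<lambda>k. w' k 0) ` I)"
    unfolding upd by (rule ex(2)[OF fam_w(1,2)])
  have "w' k0 0 \<in> (\<lambda>k. w' k 0) ` I" using \<open>k0 \<in> I\<close> by (rule imageI)
  then have "w' k0 0 \<noteq> 0"
    using ind complex_vector.dependent_zero by metis
  then have "u 0 \<noteq> 0" by (simp add: w'_def)
  then have "chain_family A n c I p' w'"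
    unfolding chain_family_def
  proof (intro conjI ballI I ind)
    show "inj_on (\<lambda>k. w' k 0) I" unfolding upd by (rule ex(1)[OF fam_w(1,2)])
    show "complex_vector.span ((\<lambda>k. w' k 0) ` I) = pencil_ker A n c"
      unfolding upd ex(3)[OF fam_w(1,2)] by (rule fam_w(3))
    fix k assume "k \<in> I"
    then show "eigen_chain A n c (p' k) (w' k)"
      using fam defect \<open>u 0 \<noteq> 0\<close> by (auto simp: eigen_chain_iff p'_def w'_def chain_family_def)
  qed
  then have "(\<Sum>k\<in>I. p' k + 1) \<le> (\<Sum>k\<in>I. p k + 1)" by (rule max)
  moreover have "(\<Sum>k\<in>I. p k + 1) < (\<Sum>k\<in>I. p' k + 1)"
    using I \<open>k0 \<in> I\<close> k0(2) by (intro sum_strict_mono_ex1) (auto simp: p'_def)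
  ultimately show False by simp
qed

text \<open>Let \<open>x = \<Sum>\<^sub>k \<beta>\<^sub>k(x) w\<^sub>k\<^sup>0 + pr x\<close> be the decomposition belonging to a complement of the kernel of
  \<open>A(c)\<close>. Replacing \<open>w\<^sub>k\<^sup>0\<close> by \<open>(\<mu> - c)\<^sup>-\<^sup>p\<^sup>-\<^sup>1 w\<^sub>k(\<mu>)\<close> gives \<open>Y \<mu> x\<close>; the operators
  \<open>S \<mu> = A(\<mu>) Y \<mu>\<close> have a limit \<open>T\<close> at \<open>c\<close>, and \<open>T\<close> is injective because the
  leading coefficients of \<open>A(\<mu>) w\<^sub>k(\<mu>)\<close> are independent modulo the range of \<open>A(c)\<close>. Thus
  \<open>A(\<mu>)\<^sup>-\<^sup>1 = Y \<mu> (S \<mu>)\<^sup>-\<^sup>1\<close> with bounded \<open>(S \<mu>)\<^sup>-\<^sup>1\<close>, and the negative powers in \<open>Y \<mu>\<close> are compensated by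
  the zeros of \<open>(w\<^sub>k(\<mu>), F(cnj \<mu>))\<close>.\<close>

lemma resolvent_form_bounded:
  fixes A :: "nat \<Rightarrow> 'a::complex_inner \<Rightarrow> 'a"
  assumes fd: "cfinite_dim TYPE('a)" and A: "\<And>i. i \<le> n \<Longrightarrow> clinear (A i)"
    and can: "canonical_system A n c I p w" and bij: "\<forall>\<^sub>F \<mu> in at c. bij (pencil A n \<mu>)"
    and orth: "\<And>k h. k \<in> I \<Longrightarrow> h \<le> p k \<Longrightarrow> coeff (pairing_poly (Suc (p k)) c (w k) l f) h = 0"
  shows "\<exists>B. \<forall>\<^sub>F \<mu> in at c. norm (resolvent_form A n l f \<mu>) \<le> B"
proof -
  have linP: "clinear (pencil A n \<mu>)" for \<mu> by (rule pencil_clinear) (rule A)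
  have fam: "chain_family A n c I p w" using can by (simp add: canonical_system_def)
  then have I: "finite I" and chains: "\<And>k. k \<in> I \<Longrightarrow> eigen_chain A n c (p k) (w k)"
    and inj0: "inj_on (\<lambda>k. w k 0) I" and ind: "complex_vector.independent ((\<lambda>k. w k 0) ` I)"
    and ker: "complex_vector.span ((\<lambda>k. w k 0) ` I) = pencil_ker A n c"
    by (auto simp: chain_family_def)
  define W where "W = (\<lambda>k. w k 0) ` I"
  define E where "E = complex_vector.extend_basis W"
  have E: "complex_vector.independent E" "W \<subseteq> E" "complex_vector.span E = UNIV"
    using ind unfolding E_def W_def
    by (simp_all add: complex_vector.independent_extend_basis complex_vector.extend_basis_superset)
  define \<beta> where "\<beta> k x = complex_vector.representation E x (w k 0)" for k x
  have beta_add: "\<beta> k (x + y) = \<beta> k x + \<beta> k y" and beta_scale: "\<beta> k (a *\<^sub>C x) = a * \<beta> k x" for k x y a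
    using E by (simp_all add: \<beta>_def complex_vector.representation_add complex_vector.representation_scale)
  define pr where "pr x = x - (\<Sum>k\<in>I. \<beta> k x *\<^sub>C w k 0)" for x
  define D where "D k = chain_defect A n c (truncate_at (Suc (p k)) (w k)) (Suc (p k))" for k
  \<comment> \<open>\<open>T\<close> is the limit of the operators \<open>S \<mu>\<close> below\<close>
  define T where "T x = (\<Sum>k\<in>I. \<beta> k x *\<^sub>C D k) + pencil A n c (pr x)" for x
  define Y where "Y \<mu> x = (\<Sum>k\<in>I. (\<beta> k x / (\<mu> - c) ^ Suc (p k)) *\<^sub>C vpoly (Suc (p k)) c (w k) \<mu>) + pr x" for \<mu> x
  define S where "S \<mu> x = pencil A n \<mu> (Y \<mu> x)" for \<mu> x
  have linpr: "clinear pr"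
    by (simp add: clinear_iff pr_def beta_add beta_scale scaleC_add_left sum.distrib
        complex_vector.scale_right_diff_distrib complex_vector.scale_sum_right)
  have linT: "clinear T"
    by (simp add: clinear_iff T_def beta_add beta_scale scaleC_add_left scaleC_add_right sum.distrib
        complex_vector.scale_sum_right clinear_add[OF linpr] clinear_scaleC[OF linpr]
        clinear_add[OF linP] clinear_scaleC[OF linP])
  have linY: "clinear (Y \<mu>)" for \<mu>
    by (simp add: clinear_iff Y_def beta_add beta_scale scaleC_add_left scaleC_add_right sum.distrib
        complex_vector.scale_sum_right clinear_add[OF linpr] clinear_scaleC[OF linpr] add_divide_distrib)
  have linS: "clinear (S \<mu>)" for \<mu>
    using linY[of \<mu>] linP[of \<mu>] by (simp add: clinear_iff S_def)
  have injT: "inj T"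
    unfolding clinear_inj_iff[OF linT]
  proof (intro allI impI)
    fix x assume "T x = 0"
    have beta0: "\<beta> k x = 0" if "k \<in> I" for k
      by (rule canonical_defect_independent[where \<beta> = "\<lambda>k. \<beta> k x" and e = "pr x",
            OF _ can \<open>T x = 0\<close>[unfolded T_def D_def] that]) (rule A)
    then have sum0: "(\<Sum>k\<in>I. \<beta> k x *\<^sub>C v k) = 0" for v :: "nat \<Rightarrow> 'a"
      by (intro sum.neutral) simp
    have "pencil A n c x = 0"
      using \<open>T x = 0\<close> unfolding T_def pr_def sum0 by simp
    then have xW: "x \<in> complex_vector.span W"
      using ker by (simp add: W_def pencil_ker_def)
    have indW: "complex_vector.independent W" using ind by (simp add: W_def)
    have rep: "complex_vector.representation W x b = 0" if "b \<in> W" for b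
    proof -
      obtain k where "k \<in> I" "b = w k 0"
        using \<open>b \<in> W\<close> unfolding W_def by (elim imageE)
      then have "complex_vector.representation E x b = 0" using beta0[of k] by (simp add: \<beta>_def)
      then show ?thesis
        using complex_vector.representation_extend[OF E(1) xW E(2)] by simp
    qed
    have "x = (\<Sum>b\<in>W. complex_vector.representation W x b *\<^sub>C b)"
      using I by (intro complex_vector.sum_representation_eq[symmetric] indW xW) (auto simp: W_def)
    also have "\<dots> = 0" using rep by (intro sum.neutral) simp
    finally show "x = 0" .
  qed
  have limS: "((\<lambda>\<mu>. S \<mu> x) \<longlongrightarrow> T x) (at c)" for x
  proof -
    let ?d = "\<lambda>k. vpoly (Suc n) c (\<lambda>h. chain_defect A n c (truncate_at (Suc (p k)) (w k)) (Suc (p k) + h))"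
    have tP: "((\<lambda>\<mu>. pencil A n \<mu> (pr x)) \<longlongrightarrow> pencil A n c (pr x)) (at c)"
      by (rule tendsto_pencil[OF fd]) (rule A, assumption, rule tendsto_ident_at, rule tendsto_const)
    have "((\<lambda>\<mu>. (\<Sum>k\<in>I. \<beta> k x *\<^sub>C ?d k \<mu>) + pencil A n \<mu> (pr x)) \<longlongrightarrow>
        (\<Sum>k\<in>I. \<beta> k x *\<^sub>C ?d k c) + pencil A n c (pr x)) (at c)"
      by (intro tendsto_add tendsto_sum tendsto_scaleC tendsto_const tendsto_vpoly tP)
    also have "(\<Sum>k\<in>I. \<beta> k x *\<^sub>C ?d k c) + pencil A n c (pr x) = T x"
      by (simp add: T_def D_def vpoly_at_centre)
    finally have lim: "((\<lambda>\<mu>. (\<Sum>k\<in>I. \<beta> k x *\<^sub>C ?d k \<mu>) + pencil A n \<mu> (pr x)) \<longlongrightarrow> T x) (at c)" .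
    have "\<forall>\<^sub>F \<mu> in at c. (\<Sum>k\<in>I. \<beta> k x *\<^sub>C ?d k \<mu>) + pencil A n \<mu> (pr x) = S \<mu> x"
      using eventually_neq_at_within[of c c UNIV]
    proof eventually_elim
      case (elim \<mu>)
      have "pencil A n \<mu> (vpoly (Suc (p k)) c (w k) \<mu>) = (\<mu> - c) ^ Suc (p k) *\<^sub>C ?d k \<mu>" if "k \<in> I" for k
        by (rule eigen_chain_factor[OF _ chains[OF that]]) (rule A)
      then show ?case
        unfolding S_def Y_def clinear_add[OF linP] clinear_sum[OF linP] clinear_scaleC[OF linP]
        using elim by (intro arg_cong2[where f = "(+)"] sum.cong refl) simp
    qed
    with lim show ?thesis by (rule Lim_transform_eventually)
  qed
  obtain C where C: "C > 0" "\<forall>\<^sub>F \<mu> in at c. bij (S \<mu>) \<and> (\<forall>x. norm x \<le> C * norm (S \<mu> x))"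
    using perturbed_inverse_bounded[OF fd linT injT linS limS] by blast
  obtain Cp where Cp: "Cp > 0" "\<And>x. norm (pr x) \<le> Cp * norm x"
    using clinear_bounded[OF fd linpr] by blast
  have "\<exists>b. \<forall>x. cmod (\<beta> k x) \<le> b * norm x \<and> b \<ge> 0" if "k \<in> I" for k
  proof -
    have nz: "w k 0 \<noteq> 0" using chains[OF that] by (simp add: eigen_chain_def)
    have "clinear (\<lambda>x. \<beta> k x *\<^sub>C w k 0)"
      by (simp add: clinear_iff beta_add beta_scale scaleC_add_left)
    then obtain b where b: "b > 0" "\<And>x. norm (\<beta> k x *\<^sub>C w k 0) \<le> b * norm x"
      using clinear_bounded[OF fd] by blast
    show ?thesis
      using b nz by (intro exI[of _ "b / norm (w k 0)"]) (simp add: norm_scaleC field_simps)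
  qed
  then have "\<forall>k\<in>I. \<exists>b. \<forall>x. cmod (\<beta> k x) \<le> b * norm x \<and> b \<ge> 0" by (rule ballI)
  from bchoice[OF this] obtain b where
    b0: "\<forall>k\<in>I. \<forall>x. cmod (\<beta> k x) \<le> b k * norm x \<and> b k \<ge> 0" by (rule exE)
  have b: "cmod (\<beta> k x) \<le> b k * norm x" "b k \<ge> 0" if "k \<in> I" for k x
    using b0 that by simp_all
  have "\<exists>q. pairing_poly (Suc (p k)) c (w k) l f = monom 1 (Suc (p k)) * q" if "k \<in> I" for k
  proof -
    have "monom 1 (Suc (p k)) dvd pairing_poly (Suc (p k)) c (w k) l f"
      using orth[OF that] by (simp add: monom_1_dvd_iff' less_Suc_eq_le)
    then show ?thesis by (simp only: dvd_def)
  qed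
  then have "\<forall>k\<in>I. \<exists>q. pairing_poly (Suc (p k)) c (w k) l f = monom 1 (Suc (p k)) * q"
    by (rule ballI)
  from bchoice[OF this] obtain q where
    q: "\<forall>k\<in>I. pairing_poly (Suc (p k)) c (w k) l f = monom 1 (Suc (p k)) * q k" by (rule exE)
  let ?F = "vpoly l 0 f"
  define bound where "bound \<mu> = (\<Sum>k\<in>I. (b k * (C * norm (?F \<mu>))) * norm (poly (q k) (\<mu> - c)))
    + (Cp * (C * norm (?F \<mu>))) * norm (?F (cnj \<mu>))" for \<mu>
  have tF: "(?F \<longlongrightarrow> ?F c) (at c)" "((\<lambda>\<mu>. ?F (cnj \<mu>)) \<longlongrightarrow> ?F (cnj c)) (at c)"
    unfolding vpoly_def by (intro tendsto_sum tendsto_scaleC tendsto_intros)+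
  have "(bound \<longlongrightarrow> (\<Sum>k\<in>I. (b k * (C * norm (?F c))) * norm (poly (q k) (c - c)))
    + (Cp * (C * norm (?F c))) * norm (?F (cnj c))) (at c)"
    unfolding bound_def by (intro tendsto_intros tF)
  then obtain B where B: "\<forall>\<^sub>F \<mu> in at c. norm (bound \<mu>) \<le> B"
    using tendsto_imp_norm_bounded by blast
  have "\<forall>\<^sub>F \<mu> in at c. norm (resolvent_form A n l f \<mu>) \<le> bound \<mu>"
    using C(2) bij eventually_neq_at_within[of c c UNIV]
  proof eventually_elim
    case (elim \<mu>)
    define x where "x = inv (S \<mu>) (?F \<mu>)"
    have Sx: "S \<mu> x = ?F \<mu>" unfolding x_def using elim(1) by (intro bij_inv_cancel(1)) simp
    have nx: "norm x \<le> C * norm (?F \<mu>)"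
      using conjunct2[OF elim(1), rule_format, of x] unfolding Sx .
    have "inv (pencil A n \<mu>) (?F \<mu>) = Y \<mu> x"
      unfolding Sx[symmetric] S_def by (rule bij_inv_cancel(2)[OF elim(2)])
    then have "resolvent_form A n l f \<mu> = cinner (Y \<mu> x) (?F (cnj \<mu>))"
      by (simp add: resolvent_form_def)
    also have "\<dots> = (\<Sum>k\<in>I. \<beta> k x / (\<mu> - c) ^ Suc (p k)
        * poly (pairing_poly (Suc (p k)) c (w k) l f) (\<mu> - c)) + cinner (pr x) (?F (cnj \<mu>))"
      unfolding Y_def by (simp only: cinner_add_left cinner_sum_left cinner_scaleC_left poly_pairing_poly)
    also have "\<dots> = (\<Sum>k\<in>I. \<beta> k x * poly (q k) (\<mu> - c)) + cinner (pr x) (?F (cnj \<mu>))"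
      using elim(3) by (intro arg_cong2[where f = "(+)"] sum.cong refl) (simp add: q poly_monom)
    also have "norm \<dots> \<le> (\<Sum>k\<in>I. norm (\<beta> k x * poly (q k) (\<mu> - c))) + norm (cinner (pr x) (?F (cnj \<mu>)))"
      by (intro norm_triangle_mono norm_sum order_refl)
    also have "\<dots> \<le> bound \<mu>"
      unfolding bound_def
    proof (intro add_mono sum_mono)
      fix k assume k: "k \<in> I"
      have "cmod (\<beta> k x) \<le> b k * norm x" by (rule b(1)[OF k])
      also have "\<dots> \<le> b k * (C * norm (?F \<mu>))" using nx b(2)[OF k] by (rule mult_left_mono)
      finally show "norm (\<beta> k x * poly (q k) (\<mu> - c)) \<le> b k * (C * norm (?F \<mu>)) * norm (poly (q k) (\<mu> - c))"
        unfolding norm_mult by (rule mult_right_mono) simp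
    next
      have "norm (pr x) \<le> Cp * norm x" by (rule Cp(2))
      also have "\<dots> \<le> Cp * (C * norm (?F \<mu>))" using nx Cp(1) by (intro mult_left_mono) auto
      finally have "norm (pr x) * norm (?F (cnj \<mu>)) \<le> Cp * (C * norm (?F \<mu>)) * norm (?F (cnj \<mu>))"
        by (rule mult_right_mono) simp
      with cmod_cinner_le show "norm (cinner (pr x) (?F (cnj \<mu>))) \<le> Cp * (C * norm (?F \<mu>)) * norm (?F (cnj \<mu>))"
        by (rule order_trans)
    qed
    finally show ?case .
  qed
  then have "\<forall>\<^sub>F \<mu> in at c. norm (resolvent_form A n l f \<mu>) \<le> B"
    using B by eventually_elim (auto intro: order_trans)
  then show ?thesis by blast
qed

section \<open>Real eigenvalues\<close>

lemma finite_uniform_bound: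
  assumes "finite I" "\<And>k. k \<in> I \<Longrightarrow> \<exists>B. \<forall>\<^sub>F x in F. f k x \<le> (B::real)"
  shows "\<exists>B\<ge>1. \<forall>\<^sub>F x in F. \<forall>k\<in>I. f k x \<le> B"
  using assms
proof (induction I)
  case empty
  then show ?case by (intro exI[of _ 1]) simp
next
  case (insert k I)
  then obtain B1 where B1: "B1 \<ge> 1" "\<forall>\<^sub>F x in F. \<forall>k\<in>I. f k x \<le> B1" by auto
  obtain B2 where B2: "\<forall>\<^sub>F x in F. f k x \<le> B2" using insert.prems by auto
  have "\<forall>\<^sub>F x in F. \<forall>k\<in>insert k I. f k x \<le> max B1 B2"
    using B1(2) B2 by eventually_elim (auto simp: le_max_iff_disj)
  then show ?case using B1(1) by (intro exI[of _ "max B1 B2"]) (simp add: le_max_iff_disj)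
qed

lemma poly_factor_monom:
  fixes q :: "complex poly"
  assumes "\<And>h. h < m \<Longrightarrow> coeff q h = 0"
  obtains r where "q = monom 1 m * r"
proof -
  have "monom 1 m dvd q" using assms by (simp add: monom_1_dvd_iff')
  then show ?thesis using that by (rule dvdE)
qed

lemma poly_factor_coeff: "coeff (monom 1 m * r) (m + i) = coeff (r :: complex poly) i"
  by (simp add: coeff_monom_mult)

subsection \<open>The polar part of the resolvent\<close>

text \<open>The untruncated product of the chain polynomials. It differs from the principal part by a polynomial
  and is easier to multiply out.\<close>

definition full_polar ::
    "complex \<Rightarrow> nat set \<Rightarrow> (nat \<Rightarrow> nat) \<Rightarrow> (nat \<Rightarrow> nat \<Rightarrow> 'a::complex_inner) \<Rightarrow>
     (nat \<Rightarrow> nat \<Rightarrow> 'a) \<Rightarrow> complex \<Rightarrow> 'a \<Rightarrow> 'a" where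
  "full_polar c I p w z \<mu> x = (\<Sum>k\<in>I. (1 / (\<mu> - c) ^ Suc (p k)) *\<^sub>C
     (cinner x (vpoly (Suc (p k)) (cnj c) (z k) (cnj \<mu>)) *\<^sub>C vpoly (Suc (p k)) c (w k) \<mu>))"

text \<open>The part of degree at most \<open>p\<close> of the product of two polynomials, divided by \<open>s\<^sup>p\<^sup>+\<^sup>1\<close>, is the principal
  part; the remaining part is divisible by \<open>s\<^sup>p\<^sup>+\<^sup>1\<close>.\<close>

lemma truncated_product:
  fixes b d :: "nat \<Rightarrow> complex"
  shows "\<exists>r. \<forall>s. s \<noteq> 0 \<longrightarrow>
    (\<Sum>a<Suc p. s ^ a * b a) * (\<Sum>i<Suc p. s ^ i * d i) / s ^ Suc p
      - (\<Sum>h\<le>p. (\<Sum>i\<le>h. b (h - i) * d i) / s ^ (p + 1 - h)) = poly r s"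
proof -
  define P where "P = (\<Sum>i<Suc p. monom (d i) i) * (\<Sum>a<Suc p. monom (b a) a)"
  have cP: "coeff P h = (\<Sum>i\<le>h. b (h - i) * d i)" if "h \<le> p" for h
    unfolding P_def coeff_mult
  proof (intro sum.cong refl)
    fix i assume "i \<in> {..h}"
    then have "i < Suc p" "h - i < Suc p" using that by auto
    then show "coeff (\<Sum>i<Suc p. monom (d i) i) i * coeff (\<Sum>a<Suc p. monom (b a) a) (h - i)
        = b (h - i) * d i"
      by (simp add: coeff_sum mult.commute)
  qed
  have cm: "coeff (\<Sum>h\<le>p. monom (coeff P h) h) h = (if h \<le> p then coeff P h else 0)" for h
    by (simp add: coeff_sum)
  obtain r where r: "P - (\<Sum>h\<le>p. monom (coeff P h) h) = monom 1 (Suc p) * r"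
  proof (rule poly_factor_monom)
    show "coeff (P - (\<Sum>h\<le>p. monom (coeff P h) h)) h = 0" if "h < Suc p" for h
      using that by (simp only: coeff_diff cm) simp
  qed
  show ?thesis
  proof (intro exI[of _ r] allI impI)
    fix s :: complex assume s: "s \<noteq> 0"
    have "poly P s - (\<Sum>h\<le>p. coeff P h * s ^ h) = s ^ Suc p * poly r s"
      using arg_cong[OF r, of "\<lambda>q. poly q s"] by (simp add: poly_sum poly_monom)
    then have "poly r s = poly P s / s ^ Suc p - (\<Sum>h\<le>p. coeff P h * s ^ h) / s ^ Suc p"
      using s by (simp add: field_simps)
    also have "(\<Sum>h\<le>p. coeff P h * s ^ h) / s ^ Suc p = (\<Sum>h\<le>p. coeff P h / s ^ (p + 1 - h))"
      unfolding sum_divide_distrib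
    proof (intro sum.cong refl)
      fix h assume "h \<in> {..p}"
      then have "s ^ Suc p = s ^ (p + 1 - h) * s ^ h"
        by (simp flip: power_add)
      then show "coeff P h * s ^ h / s ^ Suc p = coeff P h / s ^ (p + 1 - h)"
        using s by simp
    qed
    also have "\<dots> = (\<Sum>h\<le>p. (\<Sum>i\<le>h. b (h - i) * d i) / s ^ (p + 1 - h))"
      by (intro sum.cong refl) (simp add: cP)
    also have "poly P s = (\<Sum>a<Suc p. s ^ a * b a) * (\<Sum>i<Suc p. s ^ i * d i)"
      by (simp only: P_def poly_mult poly_sum poly_monom mult.commute)
    finally show "(\<Sum>a<Suc p. s ^ a * b a) * (\<Sum>i<Suc p. s ^ i * d i) / s ^ Suc p
      - (\<Sum>h\<le>p. (\<Sum>i\<le>h. b (h - i) * d i) / s ^ (p + 1 - h)) = poly r s" ..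
  qed
qed

lemma full_polar_bounded:
  "\<exists>B. \<forall>\<^sub>F \<mu> in at c. norm (cinner (full_polar c I p w z \<mu> x - polar_sum c I p w z \<mu> x) y) \<le> B"
proof -
  let ?b = "\<lambda>k a. cinner x (z k a)" and ?d = "\<lambda>k i. cinner (w k i) y"
  have "\<forall>k. \<exists>r. \<forall>s. s \<noteq> 0 \<longrightarrow>
    (\<Sum>a<Suc (p k). s ^ a * ?b k a) * (\<Sum>i<Suc (p k). s ^ i * ?d k i) / s ^ Suc (p k)
      - (\<Sum>h\<le>p k. (\<Sum>i\<le>h. ?b k (h - i) * ?d k i) / s ^ (p k + 1 - h)) = poly r s"
    by (rule allI, rule truncated_product)
  from choice[OF this] obtain r where r: "\<forall>k s. s \<noteq> 0 \<longrightarrow>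
    (\<Sum>a<Suc (p k). s ^ a * ?b k a) * (\<Sum>i<Suc (p k). s ^ i * ?d k i) / s ^ Suc (p k)
      - (\<Sum>h\<le>p k. (\<Sum>i\<le>h. ?b k (h - i) * ?d k i) / s ^ (p k + 1 - h)) = poly (r k) s"
    by (rule exE)
  have eq: "cinner (full_polar c I p w z \<mu> x - polar_sum c I p w z \<mu> x) y = (\<Sum>k\<in>I. poly (r k) (\<mu> - c))"
    if "\<mu> \<noteq> c" for \<mu>
  proof -
    have "\<mu> - c \<noteq> 0" using that by simp
    note rk = r[rule_format, OF this, symmetric]
    have "cinner (full_polar c I p w z \<mu> x) y = (\<Sum>k\<in>I.
        (\<Sum>a<Suc (p k). (\<mu> - c) ^ a * ?b k a) * (\<Sum>i<Suc (p k). (\<mu> - c) ^ i * ?d k i) / (\<mu> - c) ^ Suc (p k))"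
      unfolding full_polar_def vpoly_def by (simp only: cinner_linear_simps complex_cnj_power
          complex_cnj_diff complex_cnj_cnj) simp
    moreover have "cinner (polar_sum c I p w z \<mu> x) y = (\<Sum>k\<in>I.
        (\<Sum>h\<le>p k. (\<Sum>i\<le>h. ?b k (h - i) * ?d k i) / (\<mu> - c) ^ (p k + 1 - h)))"
      unfolding polar_sum_def by (simp only: cinner_linear_simps) simp
    ultimately show ?thesis
      unfolding rk cinner_diff_left sum_subtractf by simp
  qed
  have "((\<lambda>\<mu>. \<Sum>k\<in>I. poly (r k) (\<mu> - c)) \<longlongrightarrow> (\<Sum>k\<in>I. poly (r k) (c - c))) (at c)"
    by (intro tendsto_intros)
  then obtain B where "\<forall>\<^sub>F \<mu> in at c. norm (\<Sum>k\<in>I. poly (r k) (\<mu> - c)) \<le> B"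
    using tendsto_imp_norm_bounded by blast
  then have "\<forall>\<^sub>F \<mu> in at c. norm (cinner (full_polar c I p w z \<mu> x - polar_sum c I p w z \<mu> x) y) \<le> B"
    using eventually_neq_at_within[of c c UNIV]
  proof eventually_elim
    case (elim \<mu>)
    then show ?case using eq[of \<mu>] by simp
  qed
  then show ?thesis by blast
qed

text \<open>Regularity of the matrix elements gives a bound for each pair of vectors; expanding both arguments in
  a unit frame makes it uniform, so that it can be applied to vectors depending on \<open>\<mu>\<close>.\<close>

lemma resolvent_remainder_bounded:
  fixes A :: "nat \<Rightarrow> 'a::complex_inner \<Rightarrow> 'a"
  assumes fd: "cfinite_dim TYPE('a)" and A: "\<And>i. i \<le> n \<Longrightarrow> clinear (A i)"
    and adj: "adjoint_canonical_system A n c I p w z"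
  obtains C where "C > 0" "\<forall>\<^sub>F \<mu> in at c. bij (pencil A n \<mu>) \<and>
    (\<forall>x y. norm (cinner (inv (pencil A n \<mu>) x - full_polar c I p w z \<mu> x) y) \<le> C * norm x * norm y)"
proof -
  have linP: "clinear (pencil A n \<mu>)" for \<mu> by (rule pencil_clinear) (rule A)
  obtain E :: "'a set" where E: "unit_frame E" using unit_frame_exists[OF fd] by blast
  have finE: "finite E" by (rule unit_frame_finite[OF E])
  have reg: "\<exists>g. g analytic_on {c} \<and> (\<forall>\<^sub>F \<mu> in at c. bij (pencil A n \<mu>) \<and>
      cinner (inv (pencil A n \<mu>) x - polar_sum c I p w z \<mu> x) y = g \<mu>)" for x y
    using adj by (simp add: adjoint_canonical_system_def)
  define R where "R \<mu> x = inv (pencil A n \<mu>) x - full_polar c I p w z \<mu> x" for \<mu> x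
  have point: "\<exists>B. \<forall>\<^sub>F \<mu> in at c. norm (cinner (R \<mu> x) y) \<le> B" for x y
  proof -
    obtain g where g: "g analytic_on {c}" "\<forall>\<^sub>F \<mu> in at c. bij (pencil A n \<mu>) \<and>
      cinner (inv (pencil A n \<mu>) x - polar_sum c I p w z \<mu> x) y = g \<mu>" using reg by blast
    have "(g \<longlongrightarrow> g c) (at c)"
      using analytic_at_imp_isCont[OF g(1)] by (simp only: isCont_def)
    then obtain B1 where B1: "\<forall>\<^sub>F \<mu> in at c. norm (g \<mu>) \<le> B1"
      using tendsto_imp_norm_bounded[of g "g c" "at c"] by blast
    obtain B2 where B2: "\<forall>\<^sub>F \<mu> in at c.
        norm (cinner (full_polar c I p w z \<mu> x - polar_sum c I p w z \<mu> x) y) \<le> B2"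
      using full_polar_bounded[of c I p w z x y] by blast
    have "\<forall>\<^sub>F \<mu> in at c. norm (cinner (R \<mu> x) y) \<le> B1 + B2"
      using g(2) B1 B2
    proof eventually_elim
      case (elim \<mu>)
      have split: "cinner (R \<mu> x) y = g \<mu> - cinner (full_polar c I p w z \<mu> x - polar_sum c I p w z \<mu> x) y"
        unfolding conjunct2[OF elim(1), symmetric] R_def by (simp add: cinner_diff_left)
      have "norm (cinner (R \<mu> x) y) \<le> norm (g \<mu>)
          + norm (cinner (full_polar c I p w z \<mu> x - polar_sum c I p w z \<mu> x) y)"
        unfolding split by (rule norm_triangle_ineq4)
      with elim(2,3) show ?case by linarith
    qed
    then show ?thesis by blast
  qed
  obtain B where B: "B \<ge> 1" "\<forall>\<^sub>F \<mu> in at c. \<forall>ee\<in>E \<times> E. norm (cinner (R \<mu> (fst ee)) (snd ee)) \<le> B"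
    using finite_uniform_bound[of "E \<times> E" "\<lambda>ee \<mu>. norm (cinner (R \<mu> (fst ee)) (snd ee))" "at c",
        OF finite_cartesian_product[OF finE finE] point] by blast
  have "\<forall>\<^sub>F \<mu> in at c. bij (pencil A n \<mu>)"
    using reg[of 0 0] by (auto elim: eventually_mono)
  then have "\<forall>\<^sub>F \<mu> in at c. bij (pencil A n \<mu>) \<and>
    (\<forall>x y. norm (cinner (R \<mu> x) y) \<le> (real (card E * card E) * B) * norm x * norm y)"
    using B(2)
  proof eventually_elim
    case (elim \<mu>)
    have lin: "clinear (R \<mu>)"
      using clinear_inv[OF linP elim(1)]
      by (simp add: clinear_iff R_def full_polar_def cinner_add_left cinner_scaleC_left scaleC_add_left
          scaleC_add_right sum.distrib complex_vector.scale_right_diff_distrib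
          complex_vector.scale_sum_right mult_ac)
    have "norm (cinner (R \<mu> x) y) \<le> (real (card E * card E) * B) * norm x * norm y" for x y
    proof -
      have y: "y = (\<Sum>e\<in>E. cinner y e *\<^sub>C e)"
        using unit_frame_expand[OF E, of "\<lambda>x. x" y] by (simp add: clinear_iff)
      have "cinner (R \<mu> x) y = (\<Sum>e\<in>E. cinner x e * cinner (R \<mu> e) y)"
        unfolding unit_frame_expand[OF E lin, of x] by (simp only: cinner_sum_left cinner_scaleC_left)
      also have "\<dots> = (\<Sum>e\<in>E. cinner x e * (\<Sum>e'\<in>E. cnj (cinner y e') * cinner (R \<mu> e) e'))"
        by (subst (1) y) (simp only: cinner_sum_right cinner_scaleC_right)
      also have "norm \<dots> \<le> (\<Sum>e\<in>E. \<Sum>e'\<in>E. norm x * norm y * B)"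
      proof (rule order_trans[OF norm_sum], intro sum_mono)
        fix e assume e: "e \<in> E"
        have ce: "cmod (cinner v e) \<le> norm v" if "e \<in> E" for v e
          using cmod_cinner_le[of v e] E \<open>e \<in> E\<close> by (simp add: unit_frame_def)
        have "norm (\<Sum>e'\<in>E. cnj (cinner y e') * cinner (R \<mu> e) e') \<le> (\<Sum>e'\<in>E. norm y * B)"
        proof (rule order_trans[OF norm_sum], intro sum_mono)
          fix e' assume e': "e' \<in> E"
          have "norm (cinner (R \<mu> e) e') \<le> B" using elim(2) e e' by (auto dest: bspec[of _ _ "(e, e')"])
          then show "norm (cnj (cinner y e') * cinner (R \<mu> e) e') \<le> norm y * B"
            unfolding norm_mult complex_mod_cnj using ce[OF e'] by (intro mult_mono) auto
        qed
        then have "norm (cinner x e * (\<Sum>e'\<in>E. cnj (cinner y e') * cinner (R \<mu> e) e'))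
            \<le> norm x * (\<Sum>e'\<in>E. norm y * B)"
          unfolding norm_mult using ce[OF e] by (intro mult_mono) auto
        then show "norm (cinner x e * (\<Sum>e'\<in>E. cnj (cinner y e') * cinner (R \<mu> e) e'))
            \<le> (\<Sum>e'\<in>E. norm x * norm y * B)"
          by (simp add: mult_ac)
      qed
      also have "\<dots> = (real (card E * card E) * B) * norm x * norm y" by (simp add: mult_ac)
      finally show ?thesis .
    qed
    then show ?case using elim(1) by blast
  qed
  then have "\<forall>\<^sub>F \<mu> in at c. bij (pencil A n \<mu>) \<and>
    (\<forall>x y. norm (cinner (R \<mu> x) y) \<le> (real (card E * card E) * B + 1) * norm x * norm y)"
  proof eventually_elim
    case (elim \<mu>)
    have "(real (card E * card E) * B) * norm x * norm y
        \<le> (real (card E * card E) * B + 1) * norm x * norm y" for x y :: 'a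
      by (intro mult_right_mono) auto
    with elim show ?case by (blast intro: order_trans)
  qed
  moreover have "real (card E * card E) * B + 1 > 0"
    using B(1) by (simp add: add_nonneg_pos)
  ultimately show ?thesis
    using that unfolding R_def by blast
qed

subsection \<open>Dissipativity\<close>

lemma cmod_cinner_commute: "cmod (cinner x y) = cmod (cinner y x)"
  by (subst cinner_commute) (rule complex_mod_cnj)

text \<open>The Cauchy-Schwarz inequality for the positive semidefinite form belonging to the operator
  \<open>(T\<^sup>* - T) / 2\<i>\<close>.\<close>

lemma dissipative_cauchy_schwarz:
  assumes T: "clinear T" and diss: "\<And>x. Im (cinner (T x) x) \<le> 0"
  shows "(cmod (cinner (T x) y - cinner x (T y)))\<^sup>2 \<le> 4 * (- Im (cinner (T x) x)) * (- Im (cinner (T y) y))"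
proof -
  define b where "b = cinner (T x) y - cinner x (T y)"
  define Qx where "Qx = - Im (cinner (T x) x)"
  define Qy where "Qy = - Im (cinner (T y) y)"
  have Q: "Qx \<ge> 0" "Qy \<ge> 0" using diss by (auto simp: Qx_def Qy_def)
  have quad: "Qx + r\<^sup>2 * Qy - r * cmod b \<ge> 0" if "b \<noteq> 0" for r :: real
  proof -
    \<comment> \<open>the phase of \<open>t\<close> makes the mixed term real and as large as possible, namely \<open>r\<close> times \<open>cmod b\<close>\<close>
    define t where "t = of_real r * (- \<i>) * b / of_real (cmod b)"
    have tb: "cnj t * b = of_real r * \<i> * of_real (cmod b)"
    proof -
      have "cnj t * b = of_real r * \<i> * (b * cnj b) / of_real (cmod b)"
        by (simp add: t_def)
      also have "b * cnj b = of_real (cmod b) * of_real (cmod b)"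
        by (simp only: complex_norm_square[symmetric] power2_eq_square of_real_mult)
      finally show ?thesis using that by simp
    qed
    have tt: "t * cnj t = of_real (r\<^sup>2)"
      using that unfolding complex_norm_square[symmetric]
      by (simp add: t_def norm_mult norm_divide)
    have "cinner (T (x + t *\<^sub>C y)) (x + t *\<^sub>C y)
        = cinner (T x) x + (t * cnj t) * cinner (T y) y + (cnj t * cinner (T x) y + t * cinner (T y) x)"
      unfolding clinear_add[OF T] clinear_scaleC[OF T] cinner_add_left cinner_add_right
        cinner_scaleC_left cinner_scaleC_right by (simp add: algebra_simps)
    moreover have "Im (cnj t * cinner (T x) y + t * cinner (T y) x) = Im (cnj t * b)"
    proof -
      have "t * cinner (T y) x = cnj (cnj t * cinner x (T y))"
        by (simp add: cinner_commute[where y = "T y" and x = x])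
      then have "Im (t * cinner (T y) x) = - Im (cnj t * cinner x (T y))"
        by (simp only: cnj.simps(2))
      then show ?thesis
        by (simp only: b_def right_diff_distrib plus_complex.simps(2) minus_complex.simps(2))
    qed
    ultimately have "Im (cinner (T (x + t *\<^sub>C y)) (x + t *\<^sub>C y)) = - Qx - r\<^sup>2 * Qy + r * cmod b"
      unfolding tt tb by (simp add: Qx_def Qy_def)
    then show ?thesis using diss[of "x + t *\<^sub>C y"] by simp
  qed
  have "(cmod b)\<^sup>2 \<le> 4 * Qx * Qy"
  proof (cases "b = 0")
    case True
    then show ?thesis using Q by simp
  next
    case False
    show ?thesis
    proof (cases "Qy = 0")
      case True
      then show ?thesis using quad[OF False, of "(Qx + 1) / cmod b"] False by simp
    next
      case Qy: False
      then have "Qy > 0" using Q by simp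
      have "Qx + (cmod b / (2 * Qy))\<^sup>2 * Qy - cmod b / (2 * Qy) * cmod b = Qx - (cmod b)\<^sup>2 / (4 * Qy)"
        using Qy by (simp add: field_simps power2_eq_square)
      then have "(cmod b)\<^sup>2 / (4 * Qy) \<le> Qx"
        using quad[OF False, of "cmod b / (2 * Qy)"] by linarith
      then show ?thesis
        using \<open>Qy > 0\<close> by (simp add: pos_divide_le_eq mult_ac)
    qed
  qed
  then show ?thesis by (simp add: b_def Qx_def Qy_def)
qed

text \<open>The assumption on \<open>z\<close> says that \<open>T\<^sup>* z\<close> is of size \<open>a\<^sup>2\<close>. Dissipativity makes \<open>T z - T\<^sup>* z\<close>, and hence
  \<open>T z\<close>, of size \<open>a\<close>: half of the order survives.\<close>

lemma dissipative_small_vector: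
  assumes T: "clinear T" and diss: "\<And>x. Im (cinner (T x) x) \<le> 0"
    and Tz: "\<And>y. cmod (cinner (T y) z) \<le> a\<^sup>2 * norm y" and Tb: "\<And>y. norm (T y) \<le> M\<^sup>2 * norm y"
    and z: "norm z \<le> K\<^sup>2" and nn: "a \<ge> 0" "a \<le> 1" "M \<ge> 0" "K \<ge> 0"
  shows "norm (T z) \<le> (1 + 2 * K * M) * a"
proof -
  have Qz: "- Im (cinner (T z) z) \<le> (a * K)\<^sup>2"
  proof -
    have "- Im (cinner (T z) z) \<le> cmod (cinner (T z) z)"
      using abs_Im_le_cmod[of "cinner (T z) z"] by linarith
    also have "\<dots> \<le> a\<^sup>2 * K\<^sup>2" using Tz[of z] z by (meson mult_left_mono order_trans zero_le_power2)
    finally show ?thesis by (simp add: power_mult_distrib)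
  qed
  \<comment> \<open>testing \<open>T z\<close> against itself yields its norm\<close>
  define y where "y = T z"
  have Qy: "- Im (cinner (T y) y) \<le> (M * norm y)\<^sup>2"
  proof -
    have "- Im (cinner (T y) y) \<le> cmod (cinner (T y) y)"
      using abs_Im_le_cmod[of "cinner (T y) y"] by linarith
    also have "\<dots> \<le> norm (T y) * norm y" by (rule cmod_cinner_le)
    also have "\<dots> \<le> M\<^sup>2 * norm y * norm y" using Tb by (intro mult_right_mono) auto
    finally show ?thesis by (simp add: power2_eq_square mult_ac)
  qed
  have "(cmod (cinner (T z) y - cinner z (T y)))\<^sup>2 \<le> 4 * (- Im (cinner (T z) z)) * (- Im (cinner (T y) y))"
    by (rule dissipative_cauchy_schwarz[OF T diss])
  also have "\<dots> \<le> 4 * (a * K)\<^sup>2 * (M * norm y)\<^sup>2"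
    using Qz Qy diss[of z] diss[of y] by (intro mult_mono) auto
  also have "\<dots> = (2 * (a * K) * (M * norm y))\<^sup>2" by (simp add: power_mult_distrib)
  finally have b: "cmod (cinner (T z) y - cinner z (T y)) \<le> 2 * (a * K) * (M * norm y)"
    by (rule power2_le_imp_le) (use nn in \<open>auto intro!: mult_nonneg_nonneg\<close>)
  have "(norm y)\<^sup>2 = cmod (cinner (T z) y)" by (simp add: y_def cinner_self norm_power)
  also have "\<dots> \<le> cmod (cinner (T z) y - cinner z (T y)) + cmod (cinner z (T y))"
    using norm_triangle_sub[of "cinner (T z) y" "cinner z (T y)"] by simp
  also have "cmod (cinner z (T y)) = cmod (cinner (T y) z)"
    by (rule cmod_cinner_commute)
  also have "\<dots> \<le> a * norm y"
  proof -
    have "a\<^sup>2 \<le> a" using nn by (simp add: power2_eq_square mult_left_le)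
    then have "a\<^sup>2 * norm y \<le> a * norm y" by (rule mult_right_mono) simp
    then show ?thesis using Tz[of y] by simp
  qed
  finally have "norm y * norm y \<le> ((1 + 2 * K * M) * a) * norm y"
    using b by (simp add: power2_eq_square algebra_simps)
  then show ?thesis
    unfolding y_def[symmetric] using nn
    by (cases "norm y = 0") (auto intro!: mult_nonneg_nonneg add_nonneg_nonneg)
qed

text \<open>The mixed products inherit the geometric mean: one of the bounds \<open>a\<^sup>2\<close>, \<open>b\<^sup>2\<close> is below \<open>a b\<close>, and passing
  from \<open>(T x, y)\<close> to \<open>(x, T y)\<close> costs at most \<open>2 a b\<close>.\<close>

lemma dissipative_small_pairing:
  assumes T: "clinear T" and diss: "\<And>x. Im (cinner (T x) x) \<le> 0"
    and x: "cmod (cinner (T x) x) \<le> a\<^sup>2" and y: "cmod (cinner (T y) y) \<le> b\<^sup>2"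
    and xy: "cmod (cinner (T x) y) \<le> b\<^sup>2" and yx: "cmod (cinner (T y) x) \<le> a\<^sup>2"
    and nn: "a \<ge> 0" "b \<ge> 0"
  shows "cmod (cinner (T x) y) \<le> 3 * (a * b)"
proof (cases "b \<le> a")
  case True
  then have "b\<^sup>2 \<le> a * b" using nn by (simp add: power2_eq_square mult_right_mono)
  moreover have "0 \<le> a * b" using nn by simp
  ultimately show ?thesis using xy by linarith
next
  case False
  have "- Im (cinner (T x) x) \<le> a\<^sup>2" "- Im (cinner (T y) y) \<le> b\<^sup>2"
    using x y abs_Im_le_cmod[of "cinner (T x) x"] abs_Im_le_cmod[of "cinner (T y) y"] by linarith+
  then have "4 * (- Im (cinner (T x) x)) * (- Im (cinner (T y) y)) \<le> 4 * a\<^sup>2 * b\<^sup>2"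
    using diss[of x] diss[of y] by (intro mult_mono) auto
  with dissipative_cauchy_schwarz[OF T diss, of x y]
  have "(cmod (cinner (T x) y - cinner x (T y)))\<^sup>2 \<le> (2 * (a * b))\<^sup>2"
    by (simp add: power_mult_distrib)
  then have "cmod (cinner (T x) y - cinner x (T y)) \<le> 2 * (a * b)"
    by (rule power2_le_imp_le) (use nn in auto)
  moreover have "cmod (cinner x (T y)) \<le> a * b"
  proof -
    have "cmod (cinner x (T y)) = cmod (cinner (T y) x)"
      by (rule cmod_cinner_commute)
    moreover have "a\<^sup>2 \<le> a * b" using False nn by (simp add: power2_eq_square mult_left_mono)
    ultimately show ?thesis using yx by simp
  qed
  ultimately show ?thesis
    using norm_triangle_sub[of "cinner (T x) y" "cinner x (T y)"] by simp
qed

subsection \<open>Orders of vanishing along the real line\<close>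

lemma eventually_at_right_0: "0 < b \<Longrightarrow> \<forall>\<^sub>F \<sigma> in at_right (0::real). \<sigma> > 0 \<and> \<sigma> < b"
  using eventually_at_right_real[of 0 b] by simp

text \<open>The variable is \<open>\<sigma>\<close> with \<open>\<mu> - c = \<sigma>\<^sup>2\<close>, since dissipativity produces half-integral orders in
  \<open>\<mu> - c\<close>. The coefficients with \<open>2 h < p\<close> are those that belong to the lower half of a chain of length
  \<open>p + 1\<close>.\<close>

lemma low_coeffs_zero_imp_poly_small:
  assumes "\<And>h. 2 * h < p \<Longrightarrow> coeff q h = 0"
  shows "\<exists>B. \<forall>\<^sub>F \<sigma> in at_right 0. cmod (poly q (of_real (\<sigma>\<^sup>2))) / \<sigma> ^ p \<le> (B::real)"
proof -
  define m where "m = (p + 1) div 2"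
  obtain r where r: "q = monom 1 m * r"
  proof (rule poly_factor_monom)
    show "coeff q h = 0" if "h < m" for h using that by (intro assms) (simp add: m_def)
  qed
  have "((\<lambda>\<sigma>. poly r (of_real (\<sigma>\<^sup>2))) \<longlongrightarrow> poly r (of_real (0\<^sup>2))) (at_right (0::real))"
    by (intro tendsto_intros)
  then obtain B where "\<forall>\<^sub>F \<sigma> in at_right (0::real). norm (poly r (of_real (\<sigma>\<^sup>2))) \<le> B"
    using tendsto_imp_norm_bounded[of "\<lambda>\<sigma>. poly r (of_real (\<sigma>\<^sup>2))"] by blast
  moreover have "\<forall>\<^sub>F \<sigma> in at_right (0::real). \<sigma> > 0 \<and> \<sigma> < 1"
    by (rule eventually_at_right_0) simp
  ultimately have "\<forall>\<^sub>F \<sigma> in at_right (0::real). cmod (poly q (of_real (\<sigma>\<^sup>2))) / \<sigma> ^ p \<le> B"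
  proof eventually_elim
    case (elim \<sigma>)
    have "\<sigma> ^ (2 * m) \<le> \<sigma> ^ p"
      using elim(2) by (intro power_decreasing) (auto simp: m_def)
    have "cmod (poly q (of_real (\<sigma>\<^sup>2))) = \<sigma> ^ (2 * m) * cmod (poly r (of_real (\<sigma>\<^sup>2)))"
      using elim(2) by (simp add: r poly_monom norm_mult norm_power power_mult)
    also have "\<dots> \<le> \<sigma> ^ p * B"
      using \<open>\<sigma> ^ (2 * m) \<le> \<sigma> ^ p\<close> elim by (intro mult_mono) auto
    finally show ?case using elim(2) by (simp add: divide_le_eq mult.commute)
  qed
  then show ?thesis by blast
qed

lemma poly_small_imp_low_coeffs_zero:
  assumes "\<forall>\<^sub>F \<sigma> in at_right (0::real). cmod (poly q (of_real (\<sigma>\<^sup>2))) \<le> B * \<sigma> ^ p"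
    and "2 * h < p"
  shows "coeff q h = 0"
  using assms(2)
proof (induction h rule: less_induct)
  case (less h)
  obtain r where r: "q = monom 1 h * r"
  proof (rule poly_factor_monom)
    show "coeff q i = 0" if "i < h" for i using that less by simp
  qed
  have lim: "((\<lambda>\<sigma>. poly r (of_real (\<sigma>\<^sup>2))) \<longlongrightarrow> poly r (of_real (0\<^sup>2))) (at_right (0::real))"
    by (intro tendsto_intros)
  have "((\<lambda>\<sigma>. B * \<sigma> ^ (p - 2 * h)) \<longlongrightarrow> B * 0 ^ (p - 2 * h)) (at_right (0::real))"
    by (intro tendsto_intros)
  then have lim0: "((\<lambda>\<sigma>. B * \<sigma> ^ (p - 2 * h)) \<longlongrightarrow> 0) (at_right (0::real))"
    using less.prems by (simp add: power_0_left)
  have "\<forall>\<^sub>F \<sigma> in at_right (0::real). \<sigma> > 0 \<and> \<sigma> < 1"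
    by (rule eventually_at_right_0) simp
  with assms(1) have "\<forall>\<^sub>F \<sigma> in at_right (0::real). norm (poly r (of_real (\<sigma>\<^sup>2))) \<le> B * \<sigma> ^ (p - 2 * h)"
  proof eventually_elim
    case (elim \<sigma>)
    have "\<sigma> ^ p = \<sigma> ^ (2 * h) * \<sigma> ^ (p - 2 * h)" using less.prems by (simp flip: power_add)
    moreover have "cmod (poly q (of_real (\<sigma>\<^sup>2))) = \<sigma> ^ (2 * h) * cmod (poly r (of_real (\<sigma>\<^sup>2)))"
      using elim(2) by (simp add: r poly_monom norm_mult norm_power power_mult)
    ultimately have "\<sigma> ^ (2 * h) * cmod (poly r (of_real (\<sigma>\<^sup>2))) \<le> \<sigma> ^ (2 * h) * (B * \<sigma> ^ (p - 2 * h))"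
      using elim(1) by (simp add: mult_ac)
    then show ?case using elim(2) by simp
  qed
  then have "((\<lambda>\<sigma>. poly r (of_real (\<sigma>\<^sup>2))) \<longlongrightarrow> 0) (at_right (0::real))"
    using lim0 by (rule Lim_null_comparison)
  with lim have "poly r (of_real (0\<^sup>2)) = 0"
    by (rule tendsto_unique[OF trivial_limit_at_right_real])
  then have "coeff r 0 = 0" by (simp add: poly_0_coeff_0)
  then show ?case unfolding r using poly_factor_coeff[of h r 0] by simp
qed

lemma pencil_adjoint:
  fixes A :: "nat \<Rightarrow> 'a::complex_inner \<Rightarrow> 'a"
  assumes fd: "cfinite_dim TYPE('a)" and A: "\<And>i. i \<le> n \<Longrightarrow> clinear (A i)"
  shows "cinner (pencil A n \<mu> x) y = cinner x (pencil (adjoint_pencil A) n (cnj \<mu>) y)"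
proof -
  have "cinner (A i x) y = cinner x (cadjoint (A i) y)" if "i \<le> n" for i
    by (rule cadjoint_cinner[OF fd A[OF that]])
  then show ?thesis
    by (simp add: pencil_def adjoint_pencil_def cinner_linear_simps)
qed

text \<open>Let \<open>\<mu> = c + \<sigma>\<^sup>2\<close> be real. From \<open>A\<^sup>* z\<^sub>k = O(\<sigma>\<^sup>2\<^sup>p\<^sup>+\<^sup>2)\<close> (with \<open>p = p k\<close>) and dissipativity
  \<open>A z\<^sub>j = O(\<sigma>\<^sup>p\<^sup>+\<^sup>1)\<close> for \<open>p = p j\<close>, and \<open>(A z\<^sub>j, z\<^sub>k)\<close> has order \<open>p j + p k + 2\<close> in \<open>\<sigma>\<close>. Apply the
  expansion of \<open>A\<^sup>-\<^sup>1\<close> to \<open>z\<^sub>j = A\<^sup>-\<^sup>1 (A z\<^sub>j)\<close> and pair it with \<open>F\<close>: the \<open>k\<close>-th term is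
  \<open>(w\<^sub>k, F) (A z\<^sub>j, z\<^sub>k)\<close> divided by \<open>\<sigma>\<close> to the power \<open>2 (p k) + 2\<close>. As \<open>(w\<^sub>k, F)\<close> has order \<open>p k\<close>,
  every term has order \<open>p j\<close>, and so has \<open>(z\<^sub>j, F)\<close>.\<close>

lemma lower_half_orthogonal:
  fixes A :: "nat \<Rightarrow> 'a::complex_inner \<Rightarrow> 'a" and c :: real
  assumes fd: "cfinite_dim TYPE('a)" and A: "\<And>i. i \<le> n \<Longrightarrow> clinear (A i)"
    and diss: "\<And>x (t::real). Im (cinner (pencil A n (of_real t) x) x) \<le> 0"
    and I: "finite I" and adj: "adjoint_canonical_system A n (of_real c) I p w z"
    and orth: "\<And>k h. k \<in> I \<Longrightarrow> 2 * h < p k \<Longrightarrow> coeff (pairing_poly (Suc (p k)) (of_real c) (w k) l f) h = 0"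
    and j: "j \<in> I" and h: "2 * h < p j"
  shows "coeff (pairing_poly (Suc (p j)) (of_real c) (z j) l f) h = 0"
proof -
  let ?c = "complex_of_real c" and ?F = "vpoly l 0 f"
  define \<mu> where "\<mu> \<sigma> = complex_of_real (c + \<sigma>\<^sup>2)" for \<sigma>
  define Z where "Z k \<sigma> = vpoly (Suc (p k)) ?c (z k) (\<mu> \<sigma>)" for k \<sigma>
  define W where "W k \<sigma> = vpoly (Suc (p k)) ?c (w k) (\<mu> \<sigma>)" for k \<sigma>
  define T where "T \<sigma> = pencil A n (\<mu> \<sigma>)" for \<sigma>
  define T' where "T' \<sigma> = pencil (adjoint_pencil A) n (\<mu> \<sigma>)" for \<sigma>
  have linT: "clinear (T \<sigma>)" for \<sigma> unfolding T_def by (rule pencil_clinear) (rule A)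
  have A': "clinear (adjoint_pencil A i)" if "i \<le> n" for i
    unfolding adjoint_pencil_def by (rule clinear_cadjoint[OF fd A[OF that]])
  have TT': "cinner (T \<sigma> x) y = cinner x (T' \<sigma> y)" for \<sigma> x y
    unfolding T_def T'_def using pencil_adjoint[OF fd, of n A "\<mu> \<sigma>" x y] A by (simp add: \<mu>_def)
  have dissT: "Im (cinner (T \<sigma> x) x) \<le> 0" for \<sigma> x
    unfolding T_def \<mu>_def by (rule diss)
  have \<mu>_lim: "(\<mu> \<longlongrightarrow> ?c) (at_right 0)"
  proof -
    have "(\<mu> \<longlongrightarrow> of_real (c + 0\<^sup>2)) (at_right 0)" unfolding \<mu>_def by (intro tendsto_intros)
    then show ?thesis by simp
  qed
  have pos: "\<forall>\<^sub>F \<sigma> in at_right (0::real). \<sigma> > 0 \<and> \<sigma> < 1"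
    by (rule eventually_at_right_0) simp
  have \<mu>_at: "filterlim \<mu> (at ?c) (at_right 0)"
    unfolding filterlim_at
    by (intro conjI \<mu>_lim eventually_mono[OF pos]) (simp_all add: \<mu>_def)
  have v_lim: "((\<lambda>\<sigma>. vpoly m a v (\<mu> \<sigma>)) \<longlongrightarrow> vpoly m a v ?c) (at_right 0)"
    for m a and v :: "nat \<Rightarrow> 'a"
    unfolding vpoly_def by (intro tendsto_sum tendsto_scaleC tendsto_intros \<mu>_lim)
  have bound_vpoly: "\<exists>B. \<forall>\<^sub>F \<sigma> in at_right 0. norm (vpoly m a v (\<mu> \<sigma>)) \<le> B"
    for m a and v :: "nat \<Rightarrow> 'a"
    by (rule tendsto_imp_norm_bounded[OF v_lim])
  have \<mu>_gap: "\<mu> \<sigma> - ?c = of_real (\<sigma>\<^sup>2)" and \<mu>_real: "cnj (\<mu> \<sigma>) = \<mu> \<sigma>" for \<sigma>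
    by (simp_all add: \<mu>_def)
  have gap: "cmod ((\<mu> \<sigma> - ?c) ^ Suc k) = \<sigma> ^ (2 * k + 2)" for \<sigma> k
  proof -
    have "cmod ((\<mu> \<sigma> - ?c) ^ Suc k) = (\<sigma>\<^sup>2) ^ Suc k"
      unfolding \<mu>_gap norm_power norm_of_real abs_power2 ..
    also have "\<dots> = \<sigma> ^ (2 * Suc k)" by (simp only: power_mult)
    finally show ?thesis by simp
  qed
  obtain C where C: "C > 0" "\<forall>\<^sub>F \<mu> in at ?c. bij (pencil A n \<mu>) \<and>
    (\<forall>x y. norm (cinner (inv (pencil A n \<mu>) x - full_polar ?c I p w z \<mu> x) y) \<le> C * norm x * norm y)"
    by (rule resolvent_remainder_bounded[OF fd _ adj]) (rule A)
  have rem: "\<forall>\<^sub>F \<sigma> in at_right 0. bij (T \<sigma>) \<and>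
    (\<forall>x y. norm (cinner (inv (T \<sigma>) x - full_polar ?c I p w z (\<mu> \<sigma>) x) y) \<le> C * norm x * norm y)"
    unfolding T_def by (rule eventually_compose_filterlim[OF C(2) \<mu>_at])
  have chain: "eigen_chain (adjoint_pencil A) n ?c (p k) (z k)" if "k \<in> I" for k
    using adj that
    by (simp add: adjoint_canonical_system_def canonical_system_def chain_family_def)
  have K1b: "\<exists>B. \<forall>\<^sub>F \<sigma> in at_right 0. norm (Z k \<sigma>) \<le> B" if "k \<in> I" for k
    using bound_vpoly[of "Suc (p k)" ?c "z k"] by (simp only: Z_def)
  have "\<exists>B\<ge>1. \<forall>\<^sub>F \<sigma> in at_right 0. \<forall>k\<in>I. norm (Z k \<sigma>) \<le> B"
  proof (rule finite_uniform_bound[where f = "\<lambda>k \<sigma>. norm (Z k \<sigma>)", OF I])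
    fix k assume "k \<in> I"
    then show "\<exists>B. \<forall>\<^sub>F \<sigma> in at_right 0. norm (Z k \<sigma>) \<le> B" by (rule K1b)
  qed
  then obtain K1 where
    K1: "K1 \<ge> 1" "\<forall>\<^sub>F \<sigma> in at_right 0. \<forall>k\<in>I. norm (Z k \<sigma>) \<le> K1" by blast
  have K2b: "\<exists>B. \<forall>\<^sub>F \<sigma> in at_right 0. norm (T' \<sigma> (Z k \<sigma>)) / \<sigma> ^ (2 * p k + 2) \<le> B" if "k \<in> I" for k
  proof -
    define D where "D h = chain_defect (adjoint_pencil A) n ?c (truncate_at (Suc (p k)) (z k)) (Suc (p k) + h)" for h
    obtain B where B: "\<forall>\<^sub>F \<sigma> in at_right 0. norm (vpoly (Suc n) ?c D (\<mu> \<sigma>)) \<le> B"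
      using bound_vpoly[of "Suc n" ?c D] by blast
    have eq: "T' \<sigma> (Z k \<sigma>) = (\<mu> \<sigma> - ?c) ^ Suc (p k) *\<^sub>C vpoly (Suc n) ?c D (\<mu> \<sigma>)" for \<sigma>
      unfolding T'_def Z_def D_def by (rule eigen_chain_factor[OF A' chain[OF that]])
    have "\<forall>\<^sub>F \<sigma> in at_right 0. norm (T' \<sigma> (Z k \<sigma>)) / \<sigma> ^ (2 * p k + 2) \<le> B"
      using B pos
    proof eventually_elim
      case (elim \<sigma>)
      have "norm (T' \<sigma> (Z k \<sigma>)) = \<sigma> ^ (2 * p k + 2) * norm (vpoly (Suc n) ?c D (\<mu> \<sigma>))"
        unfolding eq norm_scaleC gap ..
      then show ?case using elim by simp
    qed
    then show ?thesis by blast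
  qed
  have "\<exists>B\<ge>1. \<forall>\<^sub>F \<sigma> in at_right 0. \<forall>k\<in>I. norm (T' \<sigma> (Z k \<sigma>)) / \<sigma> ^ (2 * p k + 2) \<le> B"
  proof (rule finite_uniform_bound[where f = "\<lambda>k \<sigma>. norm (T' \<sigma> (Z k \<sigma>)) / \<sigma> ^ (2 * p k + 2)", OF I])
    fix k assume "k \<in> I"
    then show "\<exists>B. \<forall>\<^sub>F \<sigma> in at_right 0. norm (T' \<sigma> (Z k \<sigma>)) / \<sigma> ^ (2 * p k + 2) \<le> B" by (rule K2b)
  qed
  then obtain K2 where K2: "K2 \<ge> 1" "\<forall>\<^sub>F \<sigma> in at_right 0.
      \<forall>k\<in>I. norm (T' \<sigma> (Z k \<sigma>)) / \<sigma> ^ (2 * p k + 2) \<le> K2" by blast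
  have K3b: "\<exists>B. \<forall>\<^sub>F \<sigma> in at_right 0. cmod (cinner (W k \<sigma>) (?F (\<mu> \<sigma>))) / \<sigma> ^ p k \<le> B" if "k \<in> I" for k
  proof -
    have eq: "cinner (W k \<sigma>) (?F (\<mu> \<sigma>)) = poly (pairing_poly (Suc (p k)) ?c (w k) l f) (of_real (\<sigma>\<^sup>2))" for \<sigma>
      using poly_pairing_poly[of "Suc (p k)" ?c "w k" l f "\<mu> \<sigma>"] unfolding W_def \<mu>_gap \<mu>_real ..
    show ?thesis
      unfolding eq
    proof (rule low_coeffs_zero_imp_poly_small)
      show "coeff (pairing_poly (Suc (p k)) ?c (w k) l f) h = 0" if "2 * h < p k" for h
        by (rule orth[OF \<open>k \<in> I\<close> that])
    qed
  qed
  have "\<exists>B\<ge>1. \<forall>\<^sub>F \<sigma> in at_right 0. \<forall>k\<in>I. cmod (cinner (W k \<sigma>) (?F (\<mu> \<sigma>))) / \<sigma> ^ p k \<le> B"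
  proof (rule finite_uniform_bound[where f = "\<lambda>k \<sigma>. cmod (cinner (W k \<sigma>) (?F (\<mu> \<sigma>))) / \<sigma> ^ p k", OF I])
    fix k assume "k \<in> I"
    then show "\<exists>B. \<forall>\<^sub>F \<sigma> in at_right 0. cmod (cinner (W k \<sigma>) (?F (\<mu> \<sigma>))) / \<sigma> ^ p k \<le> B" by (rule K3b)
  qed
  then obtain K3 where K3: "K3 \<ge> 1" "\<forall>\<^sub>F \<sigma> in at_right 0.
      \<forall>k\<in>I. cmod (cinner (W k \<sigma>) (?F (\<mu> \<sigma>))) / \<sigma> ^ p k \<le> K3" by blast
  obtain K4 where K4: "\<forall>\<^sub>F \<sigma> in at_right 0. norm (?F (\<mu> \<sigma>)) \<le> K4"
    using bound_vpoly[of l 0 f] by blast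
  obtain M where M: "\<forall>\<^sub>F \<sigma> in at_right 0. \<forall>y. norm (T \<sigma> y) \<le> M * norm y"
  proof -
    obtain E :: "'a set" where E: "unit_frame E" using unit_frame_exists[OF fd] by blast
    have "((\<lambda>\<sigma>. T \<sigma> e) \<longlongrightarrow> pencil A n ?c e) (at_right 0)" for e
      unfolding T_def by (rule tendsto_pencil[OF fd _ \<mu>_lim tendsto_const]) (rule A)
    then have "((\<lambda>\<sigma>. \<Sum>e\<in>E. norm (T \<sigma> e)) \<longlongrightarrow> (\<Sum>e\<in>E. norm (pencil A n ?c e))) (at_right 0)"
      by (intro tendsto_sum tendsto_norm)
    then obtain B where "\<forall>\<^sub>F \<sigma> in at_right 0. norm (\<Sum>e\<in>E. norm (T \<sigma> e)) \<le> B"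
      using tendsto_imp_norm_bounded[of "\<lambda>\<sigma>. \<Sum>e\<in>E. norm (T \<sigma> e)"] by blast
    then have "\<forall>\<^sub>F \<sigma> in at_right 0. \<forall>y. norm (T \<sigma> y) \<le> B * norm y"
    proof eventually_elim
      case (elim \<sigma>)
      then have "(\<Sum>e\<in>E. norm (T \<sigma> e)) \<le> B" by simp
      then have "(\<Sum>e\<in>E. norm (T \<sigma> e)) * norm y \<le> B * norm y" for y :: 'a
        by (rule mult_right_mono) simp
      then show ?case by (intro allI order_trans[OF clinear_norm_le[OF E linT]])
    qed
    then show ?thesis by (rule that)
  qed
  \<comment> \<open>one constant for all the bounded quantities; the smallness of \<open>\<sigma>\<close> makes \<open>K \<sigma>\<^sup>p\<^sup>+\<^sup>1 \<le> 1\<close>\<close>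
  define K where "K = Max {K1, K2, K3, K4, M}"
  have K: "K1 \<le> K" "K2 \<le> K" "K3 \<le> K" "K4 \<le> K" "M \<le> K" unfolding K_def by simp_all
  have K_ge: "K \<ge> 1" using K1(1) K(1) by simp
  have small: "\<forall>\<^sub>F \<sigma> in at_right (0::real). \<sigma> < 1 / K"
    by (rule eventually_mono[OF eventually_at_right_0[of "1 / K"]]) (use K_ge in auto)
  \<comment> \<open>the first summand comes from the regular part of \<open>A\<^sup>-\<^sup>1\<close>, the second from the polar part\<close>
  define B where "B = C * ((1 + 2 * K * K) * K) * K + (\<Sum>k\<in>I. 3 * (K\<^sup>2 * K\<^sup>2) * K)"
  have "\<forall>\<^sub>F \<sigma> in at_right (0::real).
      cmod (poly (pairing_poly (Suc (p j)) ?c (z j) l f) (of_real (\<sigma>\<^sup>2))) \<le> B * \<sigma> ^ p j"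
    using K1(2) K2(2) K3(2) K4 M rem pos small
  proof eventually_elim
    case (elim \<sigma>)
    have \<sigma>: "\<sigma> > 0" "\<sigma> < 1" using elim(7) by auto
    have bij: "bij (T \<sigma>)" using elim(6) by blast
    have nZ: "norm (Z k \<sigma>) \<le> K" if "k \<in> I" for k
      using elim(1) that K(1) by force
    have nT': "norm (T' \<sigma> (Z k \<sigma>)) \<le> K * \<sigma> ^ (2 * p k + 2)" if "k \<in> I" for k
    proof -
      have "norm (T' \<sigma> (Z k \<sigma>)) / \<sigma> ^ (2 * p k + 2) \<le> K" using elim(2) that K(2) by force
      then show ?thesis using \<sigma> by (simp add: divide_le_eq)
    qed
    have nW: "cmod (cinner (W k \<sigma>) (?F (\<mu> \<sigma>))) \<le> K * \<sigma> ^ p k" if "k \<in> I" for k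
    proof -
      have "cmod (cinner (W k \<sigma>) (?F (\<mu> \<sigma>))) / \<sigma> ^ p k \<le> K" using elim(3) that K(3) by force
      then show ?thesis using \<sigma> by (simp add: divide_le_eq)
    qed
    have nF: "norm (?F (\<mu> \<sigma>)) \<le> K" using elim(4) K(4) by simp
    have KK: "K \<le> K\<^sup>2" using K_ge by (simp add: power2_eq_square)
    have nT: "norm (T \<sigma> y) \<le> K\<^sup>2 * norm y" for y
    proof -
      have "norm (T \<sigma> y) \<le> M * norm y" using elim(5) by blast
      also have "\<dots> \<le> K\<^sup>2 * norm y" using K(5) KK by (intro mult_right_mono) auto
      finally show ?thesis .
    qed
    have pair: "cmod (cinner (T \<sigma> y) (Z k \<sigma>)) \<le> norm y * (K * \<sigma> ^ (2 * p k + 2))" if "k \<in> I" for k y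
    proof -
      have "cmod (cinner (T \<sigma> y) (Z k \<sigma>)) \<le> norm y * norm (T' \<sigma> (Z k \<sigma>))"
        unfolding TT' by (rule cmod_cinner_le)
      also have "\<dots> \<le> norm y * (K * \<sigma> ^ (2 * p k + 2))"
        using nT'[OF that] by (rule mult_left_mono) simp
      finally show ?thesis .
    qed
    define X where "X = T \<sigma> (Z j \<sigma>)"
    have nX: "norm X \<le> (1 + 2 * K * K) * (K * \<sigma> ^ (p j + 1))"
      unfolding X_def
    proof (rule dissipative_small_vector[OF linT dissT])
      show "cmod (cinner (T \<sigma> y) (Z j \<sigma>)) \<le> (K * \<sigma> ^ (p j + 1))\<^sup>2 * norm y" for y
      proof -
        have "(K * \<sigma> ^ (p j + 1))\<^sup>2 = K\<^sup>2 * \<sigma> ^ (2 * p j + 2)"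
          unfolding power_mult_distrib power_mult[symmetric] by (simp add: mult.commute)
        then have "K * \<sigma> ^ (2 * p j + 2) \<le> (K * \<sigma> ^ (p j + 1))\<^sup>2"
          using KK \<sigma> by (simp add: mult_right_mono)
        then have "norm y * (K * \<sigma> ^ (2 * p j + 2)) \<le> norm y * (K * \<sigma> ^ (p j + 1))\<^sup>2"
          by (rule mult_left_mono) simp
        with pair[OF j, of y] show ?thesis by (simp add: mult.commute)
      qed
      show "norm (T \<sigma> y) \<le> K\<^sup>2 * norm y" for y by (rule nT)
      show "norm (Z j \<sigma>) \<le> K\<^sup>2" using nZ[OF j] KK by linarith
      have "\<sigma> ^ (p j + 1) \<le> \<sigma> ^ 1" using \<sigma> by (intro power_decreasing) auto
      then have "K * \<sigma> ^ (p j + 1) \<le> K * (1 / K)"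
        using elim(8) K_ge by (intro mult_left_mono) auto
      then show "K * \<sigma> ^ (p j + 1) \<le> 1" using K_ge by simp
    qed (use K_ge \<sigma> in auto)
    have pairX: "cmod (cinner X (Z k \<sigma>)) \<le> 3 * ((K\<^sup>2 * \<sigma> ^ (p j + 1)) * (K\<^sup>2 * \<sigma> ^ (p k + 1)))"
      if k: "k \<in> I" for k
      unfolding X_def
    proof (rule dissipative_small_pairing[OF linT dissT])
      have *: "cmod (cinner (T \<sigma> (Z i \<sigma>)) (Z i' \<sigma>)) \<le> (K\<^sup>2 * \<sigma> ^ (p i' + 1))\<^sup>2"
        if "i \<in> I" "i' \<in> I" for i i'
      proof -
        have "cmod (cinner (T \<sigma> (Z i \<sigma>)) (Z i' \<sigma>)) \<le> norm (Z i \<sigma>) * (K * \<sigma> ^ (2 * p i' + 2))"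
          by (rule pair[OF that(2)])
        also have "\<dots> \<le> K * (K * \<sigma> ^ (2 * p i' + 2))"
          using nZ[OF that(1)] K_ge \<sigma> by (intro mult_right_mono) auto
        also have "\<dots> = K\<^sup>2 * \<sigma> ^ (2 * p i' + 2)" by (simp add: power2_eq_square)
        also have "\<dots> \<le> (K\<^sup>2)\<^sup>2 * \<sigma> ^ (2 * p i' + 2)"
          using K_ge \<sigma> self_le_power[of "K\<^sup>2" 2] by (intro mult_right_mono) (simp_all add: one_le_power)
        also have "\<dots> = (K\<^sup>2 * \<sigma> ^ (p i' + 1))\<^sup>2"
          unfolding power_mult_distrib power_mult[symmetric] by (simp add: mult.commute)
        finally show ?thesis .
      qed
      show "cmod (cinner (T \<sigma> (Z j \<sigma>)) (Z j \<sigma>)) \<le> (K\<^sup>2 * \<sigma> ^ (p j + 1))\<^sup>2" by (rule *[OF j j])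
      show "cmod (cinner (T \<sigma> (Z k \<sigma>)) (Z k \<sigma>)) \<le> (K\<^sup>2 * \<sigma> ^ (p k + 1))\<^sup>2" by (rule *[OF k k])
      show "cmod (cinner (T \<sigma> (Z j \<sigma>)) (Z k \<sigma>)) \<le> (K\<^sup>2 * \<sigma> ^ (p k + 1))\<^sup>2" by (rule *[OF j k])
      show "cmod (cinner (T \<sigma> (Z k \<sigma>)) (Z j \<sigma>)) \<le> (K\<^sup>2 * \<sigma> ^ (p j + 1))\<^sup>2" by (rule *[OF k j])
    qed (use K_ge \<sigma> in auto)
    let ?full = "full_polar ?c I p w z (\<mu> \<sigma>) X"
    have inv: "inv (T \<sigma>) X = Z j \<sigma>" unfolding X_def by (rule bij_inv_cancel(2)[OF bij])
    have rem1: "cmod (cinner (Z j \<sigma> - ?full) (?F (\<mu> \<sigma>))) \<le> C * ((1 + 2 * K * K) * K) * K * \<sigma> ^ p j"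
    proof -
      have "cmod (cinner (Z j \<sigma> - ?full) (?F (\<mu> \<sigma>))) \<le> C * norm X * norm (?F (\<mu> \<sigma>))"
        using conjunct2[OF elim(6), rule_format, of X "?F (\<mu> \<sigma>)"] unfolding inv .
      also have "\<dots> \<le> C * ((1 + 2 * K * K) * (K * \<sigma> ^ (p j + 1))) * K"
        using nX nF C(1) K_ge \<sigma> by (intro mult_mono mult_left_mono) auto
      also have "\<dots> = (C * ((1 + 2 * K * K) * K) * K) * \<sigma> ^ (p j + 1)" by (simp add: mult_ac)
      also have "\<dots> \<le> (C * ((1 + 2 * K * K) * K) * K) * \<sigma> ^ p j"
        using C(1) K_ge \<sigma> by (intro mult_left_mono power_decreasing) auto
      finally show ?thesis .
    qed
    have rem2: "cmod (cinner ?full (?F (\<mu> \<sigma>))) \<le> (\<Sum>k\<in>I. 3 * (K\<^sup>2 * K\<^sup>2) * K) * \<sigma> ^ p j"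
    proof -
      have "cinner ?full (?F (\<mu> \<sigma>)) = (\<Sum>k\<in>I. 1 / (\<mu> \<sigma> - ?c) ^ Suc (p k)
          * (cinner X (Z k \<sigma>) * cinner (W k \<sigma>) (?F (\<mu> \<sigma>))))"
        unfolding full_polar_def cinner_sum_left cinner_scaleC_left
        unfolding \<mu>_real complex_cnj_complex_of_real Z_def W_def ..
      also have "cmod \<dots> \<le> (\<Sum>k\<in>I. 3 * (K\<^sup>2 * K\<^sup>2) * K * \<sigma> ^ p j)"
      proof (rule order_trans[OF norm_sum], intro sum_mono)
        fix k assume k: "k \<in> I"
        have "cmod (1 / (\<mu> \<sigma> - ?c) ^ Suc (p k)) = 1 / \<sigma> ^ (2 * p k + 2)"
          unfolding norm_divide gap norm_one ..
        then have "cmod (1 / (\<mu> \<sigma> - ?c) ^ Suc (p k) * (cinner X (Z k \<sigma>) * cinner (W k \<sigma>) (?F (\<mu> \<sigma>))))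
            = 1 / \<sigma> ^ (2 * p k + 2) * (cmod (cinner X (Z k \<sigma>)) * cmod (cinner (W k \<sigma>) (?F (\<mu> \<sigma>))))"
          by (simp only: norm_mult)
        also have "\<dots> \<le> 1 / \<sigma> ^ (2 * p k + 2)
            * (3 * ((K\<^sup>2 * \<sigma> ^ (p j + 1)) * (K\<^sup>2 * \<sigma> ^ (p k + 1))) * (K * \<sigma> ^ p k))"
          using pairX[OF k] nW[OF k] K_ge \<sigma> by (intro mult_left_mono mult_mono) auto
        also have "\<dots> = 3 * (K\<^sup>2 * K\<^sup>2) * K * (\<sigma> ^ (p j + 1) * \<sigma> ^ (p k + 1) * \<sigma> ^ p k / \<sigma> ^ (2 * p k + 2))"
          by (simp add: mult_ac)
        also have "\<sigma> ^ (p j + 1) * \<sigma> ^ (p k + 1) * \<sigma> ^ p k / \<sigma> ^ (2 * p k + 2) = \<sigma> ^ p j"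
        proof -
          have "\<sigma> ^ (p j + 1) * \<sigma> ^ (p k + 1) * \<sigma> ^ p k = \<sigma> ^ p j * \<sigma> ^ (2 * p k + 2)"
            by (simp flip: power_add add: mult_2)
          then show ?thesis using \<sigma> by simp
        qed
        finally show "cmod (1 / (\<mu> \<sigma> - ?c) ^ Suc (p k) * (cinner X (Z k \<sigma>) * cinner (W k \<sigma>) (?F (\<mu> \<sigma>))))
            \<le> 3 * (K\<^sup>2 * K\<^sup>2) * K * \<sigma> ^ p j" .
      qed
      finally show ?thesis by (simp only: sum_distrib_right)
    qed
    have "cmod (cinner (Z j \<sigma>) (?F (\<mu> \<sigma>)))
        \<le> cmod (cinner (Z j \<sigma> - ?full) (?F (\<mu> \<sigma>))) + cmod (cinner ?full (?F (\<mu> \<sigma>)))"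
      unfolding cinner_diff_left using norm_triangle_sub[of "cinner (Z j \<sigma>) (?F (\<mu> \<sigma>))"] by (simp add: add.commute)
    also have "\<dots> \<le> B * \<sigma> ^ p j"
      using rem1 rem2 by (simp only: B_def distrib_right)
    also have "cinner (Z j \<sigma>) (?F (\<mu> \<sigma>)) = poly (pairing_poly (Suc (p j)) ?c (z j) l f) (of_real (\<sigma>\<^sup>2))"
      using poly_pairing_poly[of "Suc (p j)" ?c "z j" l f "\<mu> \<sigma>"] unfolding Z_def \<mu>_gap \<mu>_real ..
    finally show ?case .
  qed
  then show ?thesis using h by (rule poly_small_imp_low_coeffs_zero)
qed


text \<open>If \<open>p\<close> is odd, both polynomials vanish to order \<open>(p + 1) / 2\<close> and the quotient is regular. If \<open>p\<close> is even,
  they vanish to order \<open>p / 2\<close> and one power of \<open>s\<close> is missing.\<close>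

lemma polynomial_product_pole:
  fixes P Q :: "complex poly"
  assumes "\<And>h. 2 * h < p \<Longrightarrow> coeff P h = 0" "\<And>h. 2 * h < p \<Longrightarrow> coeff Q h = 0"
  shows "\<exists>r. \<forall>s. s \<noteq> 0 \<longrightarrow> poly P s * poly Q s / s ^ Suc p
    = (if even p then coeff P (p div 2) * coeff Q (p div 2) else 0) / s + poly r s"
proof -
  define m where "m = (p + 1) div 2"
  have m: "2 * h < p" if "h < m" for h using that by (simp add: m_def)
  obtain P' where P': "P = monom 1 m * P'"
  proof (rule poly_factor_monom)
    show "coeff P h = 0" if "h < m" for h by (rule assms(1)[OF m[OF that]])
  qed
  obtain Q' where Q': "Q = monom 1 m * Q'"
  proof (rule poly_factor_monom)
    show "coeff Q h = 0" if "h < m" for h by (rule assms(2)[OF m[OF that]])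
  qed
  show ?thesis
  proof (cases "even p")
    case True
    then have pm: "p div 2 = m" "p = m + m" by (auto simp: m_def)
    obtain a r where ar: "P' * Q' = pCons a r" by (cases "P' * Q'")
    have "coeff P (p div 2) * coeff Q (p div 2) = coeff P' 0 * coeff Q' 0"
      unfolding P' Q' pm(1) using poly_factor_coeff[of m P' 0] poly_factor_coeff[of m Q' 0] by simp
    also have "\<dots> = a" using arg_cong[OF ar, of "\<lambda>q. coeff q 0"] by (simp add: coeff_mult)
    finally have a: "coeff P (p div 2) * coeff Q (p div 2) = a" .
    have "poly P s * poly Q s / s ^ Suc p = a / s + poly r s" if "s \<noteq> 0" for s
    proof -
      have "poly P s * poly Q s = s ^ p * poly (P' * Q') s"
        by (simp add: P' Q' poly_monom pm(2) power_add)
      also have "\<dots> = s ^ p * (a + s * poly r s)" by (simp add: ar)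
      finally show ?thesis using that by (simp add: field_simps)
    qed
    then show ?thesis using True a by auto
  next
    case False
    then have pm: "Suc p = m + m" by (auto simp: m_def elim!: oddE)
    have "poly P s * poly Q s / s ^ Suc p = poly (P' * Q') s" if "s \<noteq> 0" for s
    proof -
      have "poly P s * poly Q s = s ^ Suc p * poly (P' * Q') s"
        unfolding pm by (simp add: P' Q' poly_monom power_add)
      then show ?thesis using that by simp
    qed
    then show ?thesis using False by (intro exI[of _ "P' * Q'"]) simp
  qed
qed

text \<open>The regular part of \<open>A\<^sup>-\<^sup>1\<close> contributes a bounded term. In the polar part the chain \<open>k\<close> contributes the
  product of \<open>(w\<^sub>k, F)\<close> and \<open>(F, z\<^sub>k)\<close> divided by \<open>(\<mu> - c)\<^sup>p\<^sup>+\<^sup>1\<close>, whose pole comes from the middle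
  coefficients.\<close>

lemma resolvent_form_simple_pole:
  fixes A :: "nat \<Rightarrow> 'a::complex_inner \<Rightarrow> 'a"
  assumes fd: "cfinite_dim TYPE('a)" and A: "\<And>i. i \<le> n \<Longrightarrow> clinear (A i)"
    and adj: "adjoint_canonical_system A n c I p w z"
    and w: "\<And>k h. k \<in> I \<Longrightarrow> 2 * h < p k \<Longrightarrow> coeff (pairing_poly (Suc (p k)) c (w k) l f) h = 0"
    and z: "\<And>k h. k \<in> I \<Longrightarrow> 2 * h < p k \<Longrightarrow> coeff (pairing_poly (Suc (p k)) (cnj c) (z k) l f) h = 0"
  shows "\<exists>B. \<forall>\<^sub>F \<mu> in at c. norm (resolvent_form A n l f \<mu>
    - (\<Sum>k\<in>{k \<in> I. even (p k)}. coeff (pairing_poly (Suc (p k)) c (w k) l f) (p k div 2)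
        * cnj (coeff (pairing_poly (Suc (p k)) (cnj c) (z k) l f) (p k div 2))) / (\<mu> - c)) \<le> B"
proof -
  have I: "finite I" using adj
    by (simp add: adjoint_canonical_system_def canonical_system_def chain_family_def)
  let ?F = "vpoly l 0 f"
  define P where "P k = pairing_poly (Suc (p k)) c (w k) l f" for k
  define Q where "Q k = map_poly cnj (pairing_poly (Suc (p k)) (cnj c) (z k) l f)" for k
  have cQ: "coeff (Q k) h = cnj (coeff (pairing_poly (Suc (p k)) (cnj c) (z k) l f) h)" for k h
    by (simp add: Q_def coeff_map_poly)
  have "\<forall>k\<in>I. \<exists>r. \<forall>s. s \<noteq> 0 \<longrightarrow> poly (P k) s * poly (Q k) s / s ^ Suc (p k)
      = (if even (p k) then coeff (P k) (p k div 2) * coeff (Q k) (p k div 2) else 0) / s + poly r s"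
    by (intro ballI polynomial_product_pole) (simp_all add: cQ P_def w z)
  from bchoice[OF this] obtain r where r: "\<forall>k\<in>I. \<forall>s. s \<noteq> 0 \<longrightarrow> poly (P k) s * poly (Q k) s / s ^ Suc (p k)
      = (if even (p k) then coeff (P k) (p k div 2) * coeff (Q k) (p k div 2) else 0) / s + poly (r k) s"
    by (rule exE)
  define \<rho> where "\<rho> = (\<Sum>k\<in>{k \<in> I. even (p k)}. coeff (P k) (p k div 2) * coeff (Q k) (p k div 2))"
  have \<rho>: "\<rho> = (\<Sum>k\<in>I. if even (p k) then coeff (P k) (p k div 2) * coeff (Q k) (p k div 2) else 0)"
    unfolding \<rho>_def by (rule sum.inter_filter[OF I])
  obtain C where C: "C > 0" "\<forall>\<^sub>F \<mu> in at c. bij (pencil A n \<mu>) \<and>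
    (\<forall>x y. norm (cinner (inv (pencil A n \<mu>) x - full_polar c I p w z \<mu> x) y) \<le> C * norm x * norm y)"
    by (rule resolvent_remainder_bounded[OF fd _ adj]) (rule A)
  have F_lim: "((\<lambda>\<mu>. C * norm (?F \<mu>) * norm (?F (cnj \<mu>))) \<longlongrightarrow> C * norm (?F c) * norm (?F (cnj c))) (at c)"
  proof -
    have "(?F \<longlongrightarrow> ?F c) (at c)" "((\<lambda>\<mu>. ?F (cnj \<mu>)) \<longlongrightarrow> ?F (cnj c)) (at c)"
      unfolding vpoly_def by (intro tendsto_sum tendsto_scaleC tendsto_intros)+
    then show ?thesis by (intro tendsto_intros)
  qed
  obtain B1 where B1: "\<forall>\<^sub>F \<mu> in at c. norm (C * norm (?F \<mu>) * norm (?F (cnj \<mu>))) \<le> B1"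
    using tendsto_imp_norm_bounded[OF F_lim] by blast
  have r_lim: "((\<lambda>\<mu>. \<Sum>k\<in>I. poly (r k) (\<mu> - c)) \<longlongrightarrow> (\<Sum>k\<in>I. poly (r k) (c - c))) (at c)"
    by (intro tendsto_intros)
  obtain B2 where B2: "\<forall>\<^sub>F \<mu> in at c. norm (\<Sum>k\<in>I. poly (r k) (\<mu> - c)) \<le> B2"
    using tendsto_imp_norm_bounded[OF r_lim] by blast
  have "\<forall>\<^sub>F \<mu> in at c. norm (resolvent_form A n l f \<mu> - \<rho> / (\<mu> - c)) \<le> B1 + B2"
    using C(2) B1 B2 eventually_neq_at_within[of c c UNIV]
  proof eventually_elim
    case (elim \<mu>)
    let ?full = "full_polar c I p w z \<mu> (?F \<mu>)"
    have polyQ: "cinner (?F \<mu>) (vpoly (Suc (p k)) (cnj c) (z k) (cnj \<mu>)) = poly (Q k) (\<mu> - c)" for k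
    proof -
      have "cinner (?F \<mu>) (vpoly (Suc (p k)) (cnj c) (z k) (cnj \<mu>))
          = cnj (cinner (vpoly (Suc (p k)) (cnj c) (z k) (cnj \<mu>)) (?F (cnj (cnj \<mu>))))"
        unfolding cinner_commute[symmetric] complex_cnj_cnj ..
      also have "\<dots> = cnj (poly (pairing_poly (Suc (p k)) (cnj c) (z k) l f) (cnj \<mu> - cnj c))"
        by (simp only: poly_pairing_poly)
      also have "\<dots> = poly (Q k) (\<mu> - c)" unfolding Q_def poly_cnj by simp
      finally show ?thesis .
    qed
    have "cinner ?full (?F (cnj \<mu>)) = (\<Sum>k\<in>I. poly (P k) (\<mu> - c) * poly (Q k) (\<mu> - c) / (\<mu> - c) ^ Suc (p k))"
      unfolding full_polar_def cinner_sum_left cinner_scaleC_left polyQ P_def poly_pairing_poly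
      by (simp add: mult_ac)
    also have "\<dots> = (\<Sum>k\<in>I. (if even (p k) then coeff (P k) (p k div 2) * coeff (Q k) (p k div 2) else 0) / (\<mu> - c)
        + poly (r k) (\<mu> - c))"
    proof (intro sum.cong refl)
      fix k assume "k \<in> I"
      moreover have "\<mu> - c \<noteq> 0" using elim(4) by simp
      ultimately show "poly (P k) (\<mu> - c) * poly (Q k) (\<mu> - c) / (\<mu> - c) ^ Suc (p k)
          = (if even (p k) then coeff (P k) (p k div 2) * coeff (Q k) (p k div 2) else 0) / (\<mu> - c)
          + poly (r k) (\<mu> - c)" by (rule r[rule_format])
    qed
    also have "\<dots> = \<rho> / (\<mu> - c) + (\<Sum>k\<in>I. poly (r k) (\<mu> - c))"
      by (simp only: sum.distrib \<rho> sum_divide_distrib)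
    finally have full: "cinner ?full (?F (cnj \<mu>)) = \<rho> / (\<mu> - c) + (\<Sum>k\<in>I. poly (r k) (\<mu> - c))" .
    have "resolvent_form A n l f \<mu> - \<rho> / (\<mu> - c)
        = cinner (inv (pencil A n \<mu>) (?F \<mu>) - ?full) (?F (cnj \<mu>)) + (\<Sum>k\<in>I. poly (r k) (\<mu> - c))"
      unfolding cinner_diff_left full resolvent_form_def by simp
    also have "norm \<dots> \<le> C * norm (?F \<mu>) * norm (?F (cnj \<mu>)) + norm (\<Sum>k\<in>I. poly (r k) (\<mu> - c))"
      by (rule norm_triangle_mono[OF conjunct2[OF elim(1), rule_format] order_refl])
    also have "\<dots> \<le> B1 + B2"
      using elim(2,3) abs_ge_self[of "C * norm (?F \<mu>) * norm (?F (cnj \<mu>))"]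
      unfolding real_norm_def by linarith
    finally show ?case .
  qed
  then show ?thesis unfolding \<rho>_def P_def cQ by (rule exI)
qed

section \<open>Completeness of the halves\<close>

text \<open>Orthogonality in \<open>H\<^sup>l\<close> is orthogonality in \<open>H\<^sup>n\<close> for the extension of \<open>f\<close> by zero. This links the
  half systems, made of derived chains of length \<open>l\<close>, with the regularity condition, which speaks of
  derived chains of length \<open>n\<close>.\<close>

lemma Hpow_inner_truncate:
  assumes "f \<in> Hpow l" "l \<le> n"
  shows "Hpow_inner n f (keldysh_chain n c w h) = Hpow_inner l f (keldysh_chain l c w h)"
proof -
  have "(\<Sum>j<l. cinner (f j) (keldysh_chain n c w h j)) = (\<Sum>j<n. cinner (f j) (keldysh_chain n c w h j))"
    using assms by (intro sum.mono_neutral_left) (auto simp: Hpow_def)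
  then have "Hpow_inner n f (keldysh_chain n c w h) = (\<Sum>j<l. cinner (f j) (keldysh_chain n c w h j))"
    by (simp only: Hpow_inner_def)
  also have "\<dots> = Hpow_inner l f (keldysh_chain l c w h)"
    unfolding Hpow_inner_def using assms(2) by (intro sum.cong refl) (simp add: keldysh_chain_eq)
  finally show ?thesis .
qed

lemma Hpow_inner_span:
  assumes "g \<in> Hpow.span S" "\<And>s. s \<in> S \<Longrightarrow> Hpow_inner n f s = 0"
  shows "Hpow_inner n f g = 0"
proof -
  have "Hpow.subspace {g. Hpow_inner n f g = 0}"
    unfolding Hpow.subspace_def
    by (auto simp: Hpow_inner_def Hpow_scale_def cinner_add_right cinner_scaleC_right sum.distrib
        simp flip: sum_distrib_left)
  then have "Hpow.span S \<subseteq> {g. Hpow_inner n f g = 0}"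
    using assms(2) by (intro Hpow.span_minimal) auto
  then show ?thesis using assms(1) by auto
qed

text \<open>Regularity says that the middle vectors of \<open>v\<close> and of \<open>e\<close> times \<open>u\<close> differ by lower halves, to which \<open>f\<close> is
  orthogonal.\<close>

lemma regular_system_middle:
  assumes f: "f \<in> Hpow l" "l \<le> n"
    and lower: "\<And>j h. j \<in> I \<Longrightarrow> 2 * h < p j \<Longrightarrow> Hpow_inner l f (keldysh_chain l c (w j) h) = 0"
    and rel: "keldysh_chain n (cnj c) v m - Hpow_scale (of_int e) (keldysh_chain n c u m)
      \<in> Hpow.span {keldysh_chain n c (w j) h | j h. j \<in> I \<and> int h \<le> (int (p j) - 1) div 2}"
  shows "Hpow_inner l f (keldysh_chain l (cnj c) v m) = of_int e * Hpow_inner l f (keldysh_chain l c u m)"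
proof -
  have "Hpow_inner n f (keldysh_chain n (cnj c) v m - Hpow_scale (of_int e) (keldysh_chain n c u m)) = 0"
  proof (rule Hpow_inner_span[OF rel])
    fix s assume "s \<in> {keldysh_chain n c (w j) h | j h. j \<in> I \<and> int h \<le> (int (p j) - 1) div 2}"
    then obtain j h where s: "s = keldysh_chain n c (w j) h" and j: "j \<in> I"
      and h: "int h \<le> (int (p j) - 1) div 2" by blast
    have "2 * h < p j" using h by linarith
    then show "Hpow_inner n f s = 0"
      unfolding s Hpow_inner_truncate[OF f] using j by (intro lower)
  qed
  then have "Hpow_inner n f (keldysh_chain n (cnj c) v m)
      = of_int e * Hpow_inner n f (keldysh_chain n c u m)"
    by (simp add: Hpow_inner_def Hpow_scale_def cinner_diff_right cinner_scaleC_right sum_subtractf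
        sum_distrib_left)
  then show ?thesis unfolding Hpow_inner_truncate[OF f] .
qed

lemma numbering_canonical:
  assumes "chain_numbering A n M \<Lambda> p w \<epsilon>" "eigenvalue A n c"
  shows "canonical_system A n c {k. k < M \<and> \<Lambda> k = c} p w"
  using assms by (cases "c \<in> \<real>") (auto simp: chain_numbering_def regular_system_def)

text \<open>Every eigenvalue has a non-trivial kernel, so it carries one of the \<open>M\<close> chains.\<close>

lemma finite_eigenvalues:
  assumes "chain_numbering A n M \<Lambda> p w \<epsilon>"
  shows "finite {c. eigenvalue A n c}"
proof (rule finite_subset)
  show "{c. eigenvalue A n c} \<subseteq> \<Lambda> ` {..<M}"
  proof
    fix c assume "c \<in> {c. eigenvalue A n c}"
    then have c: "eigenvalue A n c" by simp
    have "complex_vector.span ((\<lambda>k. w k 0) ` {k. k < M \<and> \<Lambda> k = c}) = pencil_ker A n c"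
      using numbering_canonical[OF assms c] by (simp add: canonical_system_def chain_family_def)
    moreover have "pencil_ker A n c \<noteq> {0}"
      using c by (auto simp: eigenvalue_def)
    ultimately have "{k. k < M \<and> \<Lambda> k = c} \<noteq> {}"
      using complex_vector.span_empty by (metis image_empty)
    then show "c \<in> \<Lambda> ` {..<M}" by auto
  qed
qed simp

text \<open>Both halves at once: multiplication by \<open>\<sigma>\<close> carries the half plane in question to the upper one, and
  \<open>\<mu> \<mapsto> G(\<sigma> \<mu>)\<close> satisfies the assumptions of the vanishing criterion. At a real eigenvalue the chain \<open>k\<close> of
  odd length contributes \<open>\<sigma> \<epsilon> k\<close> times a square to the residue of this function; if \<open>\<epsilon> k = \<sigma>\<close>, the
  half system contains the middle vector of the chain and the square is zero.\<close>

lemma half_system_complete: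
  fixes A :: "nat \<Rightarrow> 'a::complex_inner \<Rightarrow> 'a" and \<sigma> :: int
  assumes fd: "cfinite_dim TYPE('a)" and n: "n = 2 * l"
    and A: "\<And>i. i \<le> n \<Longrightarrow> clinear (A i)"
    and diss: "\<And>x (t::real). Im (cinner (pencil A n (of_real t) x) x) \<le> 0"
    and lead: "{x. A n x = 0} = {0}"
    and def: "\<exists>t::real. 0 \<notin> numerical_range (pencil A n (of_real t))"
    and num: "chain_numbering A n M \<Lambda> p w \<epsilon>" and \<sigma>: "\<sigma> \<in> {1, -1}"
  shows "complete_in_Hpow l (half_system \<sigma> l M \<Lambda> p w \<epsilon>)"
  unfolding complete_in_Hpow_def
proof (intro ballI impI)
  fix f :: "nat \<Rightarrow> 'a"
  assume f: "f \<in> Hpow l" and orth: "\<forall>g\<in>half_system \<sigma> l M \<Lambda> p w \<epsilon>. Hpow_inner l f g = 0"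
  let ?G = "resolvent_form A n l f" and ?s = "complex_of_int \<sigma>"
  have ss: "?s * ?s = 1" "?s \<noteq> 0" "norm ?s = 1" and s_real: "?s = of_real (of_int \<sigma>)"
    using \<sigma> by auto
  have ss': "?s * (?s * x) = x" for x using ss(1) by (simp flip: mult.assoc)
  define Ev where "Ev = {c. eigenvalue A n c}"
  have finEv: "finite Ev" unfolding Ev_def by (rule finite_eigenvalues[OF num])
  have bij: "bij (pencil A n c)" if "c \<notin> Ev" for c
    by (rule not_eigenvalue_imp_bij[OF fd A]) (use that in \<open>simp_all add: Ev_def\<close>)
  have ev_bij: "\<forall>\<^sub>F \<mu> in at c. bij (pencil A n \<mu>)" for c
  proof -
    have "open (- (Ev - {c}))" using finEv by (intro open_Compl finite_imp_closed) simp
    then have "\<forall>\<^sub>F \<mu> in at c. \<mu> \<notin> Ev"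
      unfolding eventually_at_topological by (intro exI[of _ "- (Ev - {c})"]) auto
    then show ?thesis by eventually_elim (rule bij)
  qed
  define P where "P k = pairing_poly (Suc (p k)) (\<Lambda> k) (w k) l f" for k
  have coeff0: "Hpow_inner l f (keldysh_chain l (\<Lambda> k) (w k) h) = 0" "h \<le> p k \<Longrightarrow> coeff (P k) h = 0"
    if "(k, h) \<in> half_index \<sigma> M \<Lambda> p \<epsilon>" for k h
  proof -
    have "keldysh_chain l (\<Lambda> k) (w k) h \<in> half_system \<sigma> l M \<Lambda> p w \<epsilon>"
      unfolding half_system_def using that by blast
    then show *: "Hpow_inner l f (keldysh_chain l (\<Lambda> k) (w k) h) = 0" using orth by blast
    show "coeff (P k) h = 0" if "h \<le> p k"
      unfolding P_def using that * by (subst coeff_pairing_poly) simp_all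
  qed
  \<comment> \<open>the singularities of \<open>\<mu> \<mapsto> G(\<sigma> \<mu>)\<close>\<close>
  define K where "K = {c. eigenvalue A n (?s * c)}"
  have finK: "finite K"
  proof -
    have "K \<subseteq> (\<lambda>c. ?s * c) ` Ev"
    proof
      fix c assume "c \<in> K"
      then have "?s * c \<in> Ev" by (simp add: K_def Ev_def)
      then show "c \<in> (\<lambda>c. ?s * c) ` Ev" using ss'[of c] by (metis imageI)
    qed
    then show ?thesis using finEv finite_surj by blast
  qed
  have flip: "filterlim (\<lambda>c. ?s * c) (at (?s * c)) (at c)" for c
    unfolding filterlim_at
  proof (intro conjI)
    show "((\<lambda>c. ?s * c) \<longlongrightarrow> ?s * c) (at c)" by (intro tendsto_intros)
    show "\<forall>\<^sub>F x in at c. ?s * x \<in> UNIV \<and> ?s * x \<noteq> ?s * c"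
      using eventually_neq_at_within[of c c UNIV] by eventually_elim (use ss(2) in simp)
  qed
  have "f j = 0" if j: "j < l" for j
  proof -
    obtain R C where decay: "\<And>\<mu>. norm \<mu> \<ge> R \<Longrightarrow> norm (?G \<mu>) \<le> C / (norm \<mu>)\<^sup>2"
    proof (rule resolvent_form_decay[where A = A and n = n and l = l and f = f, OF fd _ lead n])
      show "clinear (A i)" if "i \<le> n" for i by (rule A[OF that])
      show "l > 0" using j by simp
    qed (rule that)
    have pole: "\<exists>r. r \<le> 0 \<and> (\<exists>B. \<forall>\<^sub>F \<mu> in at c. norm (?G (?s * \<mu>) - of_real r / (\<mu> - c)) \<le> B)"
      if c: "c \<in> K" "Im c = 0" for c
    proof -
      define d where "d = Re (?s * c)"
      have d: "?s * c = of_real d"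
        unfolding d_def using c(2) by (simp add: complex_eq_iff)
      define I where "I = {k. k < M \<and> \<Lambda> k = of_real d}"
      have eig: "eigenvalue A n (of_real d)" using c(1) d by (simp add: K_def)
      then have "regular_system A n (of_real d) I p w \<epsilon>"
        using num unfolding chain_numbering_def I_def by auto
      then obtain z where adj: "adjoint_canonical_system A n (of_real d) I p w z"
        and eps: "\<And>k. k \<in> I \<Longrightarrow> even (p k) \<Longrightarrow> \<epsilon> k \<in> {1, -1}"
          "\<And>k. k \<in> I \<Longrightarrow> odd (p k) \<Longrightarrow> \<epsilon> k = 0"
        and rel: "\<And>k. k \<in> I \<Longrightarrow> even (p k) \<Longrightarrow> keldysh_chain n (cnj (of_real d)) (z k) (p k div 2)
              - Hpow_scale (of_int (\<epsilon> k)) (keldysh_chain n (of_real d) (w k) (p k div 2))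
            \<in> Hpow.span {keldysh_chain n (of_real d) (w j) h | j h. j \<in> I \<and> int h \<le> (int (p j) - 1) div 2}"
        unfolding regular_system_def by (metis (no_types, lifting))
      let ?W = "\<lambda>k. pairing_poly (Suc (p k)) (of_real d) (w k) l f"
        and ?Z = "\<lambda>k. pairing_poly (Suc (p k)) (cnj (of_real d)) (z k) l f"
      have \<Lambda>: "\<Lambda> k = of_real d" "k < M" if "k \<in> I" for k using that by (auto simp: I_def)
      have finI: "finite I" by (simp add: I_def)
      have idx: "(k, h) \<in> half_index \<sigma> M \<Lambda> p \<epsilon>" if k: "k \<in> I" and h: "2 * h < p k" for k h
      proof -
        have "\<sigma> * \<epsilon> k \<ge> -1" and "odd (p k) \<Longrightarrow> \<sigma> * \<epsilon> k = 0"
          using eps[OF k] \<sigma> by (cases "even (p k)"; auto)+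
        then have "int h \<le> (int (p k) + \<sigma> * \<epsilon> k) div 2" using h by linarith
        then show ?thesis using \<Lambda>[OF k] by (simp add: half_index_def)
      qed
      have lower: "Hpow_inner l f (keldysh_chain l (of_real d) (w k) h) = 0"
        if "k \<in> I" "2 * h < p k" for k h
        using coeff0(1)[OF idx[OF that]] \<Lambda>[OF that(1)] by simp
      have lowerP: "coeff (?W k) h = 0"
        if "k \<in> I" "2 * h < p k" for k h
        using lower[OF that] that(2) by (subst coeff_pairing_poly) simp_all
      have lowerZ: "coeff (pairing_poly (Suc (p k)) (of_real d) (z k) l f) h = 0"
        if "k \<in> I" "2 * h < p k" for k h
        by (rule lower_half_orthogonal[OF fd A diss finI adj lowerP that])
      define a where "a k = coeff (?W k) (p k div 2)" for k
      have mid: "coeff (?Z k) (p k div 2) = of_int (\<epsilon> k) * a k"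
        if k: "k \<in> I" "even (p k)" for k
      proof -
        have "Hpow_inner l f (keldysh_chain l (cnj (of_real d)) (z k) (p k div 2))
            = of_int (\<epsilon> k) * Hpow_inner l f (keldysh_chain l (of_real d) (w k) (p k div 2))"
          by (rule regular_system_middle[OF f _ lower rel[OF k]]) (use n in auto)
        then show ?thesis unfolding a_def by (simp add: coeff_pairing_poly)
      qed
      define r where "r = (\<Sum>k\<in>{k \<in> I. even (p k)}. of_int (\<epsilon> k) * (cmod (a k))\<^sup>2)"
      have sum_r: "(\<Sum>k\<in>{k \<in> I. even (p k)}. a k
          * cnj (coeff (?Z k) (p k div 2))) = of_real r"
        unfolding r_def of_real_sum
      proof (intro sum.cong refl)
        fix k assume "k \<in> {k \<in> I. even (p k)}"
        then have k: "k \<in> I" "even (p k)" by auto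
        have "a k * cnj (coeff (?Z k) (p k div 2))
            = of_int (\<epsilon> k) * (a k * cnj (a k))"
          unfolding mid[OF k] by simp
        also have "\<dots> = of_real (of_int (\<epsilon> k) * (cmod (a k))\<^sup>2)"
          unfolding complex_norm_square[symmetric] by simp
        finally show "a k * cnj (coeff (?Z k) (p k div 2))
            = of_real (of_int (\<epsilon> k) * (cmod (a k))\<^sup>2)" .
      qed
      have "of_int \<sigma> * r \<le> 0"
        unfolding r_def sum_distrib_left
      proof (intro sum_nonpos)
        fix k assume k: "k \<in> {k \<in> I. even (p k)}"
        show "of_int \<sigma> * (of_int (\<epsilon> k) * (cmod (a k))\<^sup>2) \<le> 0"
        proof (cases "\<epsilon> k = \<sigma>")
          case True
          have "\<sigma> * \<epsilon> k = 1" using True \<sigma> by auto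
          then have "(k, p k div 2) \<in> half_index \<sigma> M \<Lambda> p \<epsilon>"
            using k \<Lambda>[of k] by (auto simp: half_index_def)
          then have "a k = 0" using coeff0(2)[of k "p k div 2"] k \<Lambda>[of k] by (simp add: a_def P_def)
          then show ?thesis by simp
        next
          case False
          then have "\<sigma> * \<epsilon> k = -1" using eps(1)[of k] k \<sigma> by auto
          then have "real_of_int \<sigma> * of_int (\<epsilon> k) = -1" by (metis of_int_mult of_int_minus of_int_1)
          then have "of_int \<sigma> * (of_int (\<epsilon> k) * (cmod (a k))\<^sup>2) = - (cmod (a k))\<^sup>2"
            by (simp flip: mult.assoc)
          then show ?thesis by simp
        qed
      qed
      moreover have "\<exists>B. \<forall>\<^sub>F \<mu> in at c. norm (?G (?s * \<mu>) - of_real (of_int \<sigma> * r) / (\<mu> - c)) \<le> B"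
      proof -
        have "\<exists>B. \<forall>\<^sub>F \<mu> in at (of_real d). norm (?G \<mu> - (\<Sum>k\<in>{k \<in> I. even (p k)}.
            coeff (?W k) (p k div 2)
            * cnj (coeff (?Z k) (p k div 2))) / (\<mu> - of_real d)) \<le> B"
        proof (rule resolvent_form_simple_pole[OF fd _ adj])
          show "clinear (A i)" if "i \<le> n" for i by (rule A[OF that])
          show "coeff (?W k) h = 0"
            if "k \<in> I" "2 * h < p k" for k h by (rule lowerP[OF that])
          show "coeff (?Z k) h = 0"
            if "k \<in> I" "2 * h < p k" for k h unfolding complex_cnj_complex_of_real by (rule lowerZ[OF that])
        qed
        then obtain B where B: "\<forall>\<^sub>F \<mu> in at (?s * c). norm (?G \<mu> - of_real r / (\<mu> - ?s * c)) \<le> B"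
          unfolding a_def[symmetric] sum_r d by blast
        have eq: "of_real r / (?s * \<mu> - ?s * c) = of_real (of_int \<sigma> * r) / (\<mu> - c)" for \<mu>
          using \<sigma> by (auto simp: minus_divide_left[symmetric] divide_minus_right[symmetric])
        have "\<forall>\<^sub>F \<mu> in at c. norm (?G (?s * \<mu>) - of_real r / (?s * \<mu> - ?s * c)) \<le> B"
          by (rule eventually_compose_filterlim[OF B flip])
        then show ?thesis unfolding eq by (rule exI)
      qed
      ultimately show ?thesis by blast
    qed
    then have "\<forall>c\<in>{c \<in> K. Im c = 0}. \<exists>r. r \<le> 0 \<and>
        (\<exists>B. \<forall>\<^sub>F \<mu> in at c. norm (?G (?s * \<mu>) - of_real r / (\<mu> - c)) \<le> B)" by simp
    from bchoice[OF this] obtain r where r: "\<forall>c\<in>{c \<in> K. Im c = 0}. r c \<le> 0 \<and>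
        (\<exists>B. \<forall>\<^sub>F \<mu> in at c. norm (?G (?s * \<mu>) - of_real (r c) / (\<mu> - c)) \<le> B)" by (rule exE)
    have G_zero: "?G (?s * of_real t) = 0" if t: "of_real t \<notin> K" for t :: real
    proof (rule real_line_vanishing[where G = "\<lambda>\<mu>. ?G (?s * \<mu>)" and K = K and r = r and t = t])
      show "finite K" by (rule finK)
      have "?G \<circ> (\<lambda>\<mu>. ?s * \<mu>) holomorphic_on - K"
      proof (rule holomorphic_on_compose_gen[where t = "{c. \<not> eigenvalue A n c}"])
        show "(\<lambda>\<mu>. ?s * \<mu>) holomorphic_on - K" by (intro holomorphic_intros)
        show "?G holomorphic_on {c. \<not> eigenvalue A n c}"
          by (rule resolvent_form_holomorphic[OF fd]) (rule A)
        show "(\<lambda>\<mu>. ?s * \<mu>) ` (- K) \<subseteq> {c. \<not> eigenvalue A n c}" by (auto simp: K_def)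
      qed
      then show "(\<lambda>\<mu>. ?G (?s * \<mu>)) holomorphic_on - K" by (simp add: o_def)
      show "\<exists>B. \<forall>\<^sub>F \<mu> in at c. norm (?G (?s * \<mu>)) \<le> B" if c: "c \<in> K" "Im c > 0" for c
      proof -
        have eig: "eigenvalue A n (?s * c)" using c(1) by (simp add: K_def)
        have "\<exists>B. \<forall>\<^sub>F \<mu> in at (?s * c). norm (?G \<mu>) \<le> B"
        proof (rule resolvent_form_bounded[OF fd _ numbering_canonical[OF num eig] ev_bij])
          show "clinear (A i)" if "i \<le> n" for i by (rule A[OF that])
          fix k h assume k: "k \<in> {k. k < M \<and> \<Lambda> k = ?s * c}" and h: "h \<le> p k"
          have "of_int \<sigma> * Im (?s * c) > 0" using c(2) \<sigma> by auto
          then have "(k, h) \<in> half_index \<sigma> M \<Lambda> p \<epsilon>" using k h by (auto simp: half_index_def)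
          then show "coeff (pairing_poly (Suc (p k)) (?s * c) (w k) l f) h = 0"
            using coeff0(2)[of k h] k h by (simp add: P_def)
        qed
        then obtain B where "\<forall>\<^sub>F \<mu> in at (?s * c). norm (?G \<mu>) \<le> B" by blast
        then have "\<forall>\<^sub>F \<mu> in at c. norm (?G (?s * \<mu>)) \<le> B"
          by (rule eventually_compose_filterlim[OF _ flip])
        then show ?thesis by (rule exI)
      qed
      show "r c \<le> 0" "\<exists>B. \<forall>\<^sub>F \<mu> in at c. norm (?G (?s * \<mu>) - of_real (r c) / (\<mu> - c)) \<le> B"
        if "c \<in> K" "Im c = 0" for c using r that by blast+
      show "norm (?G (?s * \<mu>)) \<le> C / (norm \<mu>)\<^sup>2" if "norm \<mu> \<ge> R" for \<mu>
        using decay[of "?s * \<mu>"] that ss(3) by (simp add: norm_mult)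
      show "Im (?G (?s * of_real t)) \<ge> 0" if "of_real t \<notin> K" for t :: real
      proof -
        have st: "?s * of_real t = of_real (of_int \<sigma> * t)" by simp
        have "?s * of_real t \<notin> Ev" using that by (simp add: K_def Ev_def)
        then have "bij (pencil A n (of_real (of_int \<sigma> * t)))" unfolding st by (rule bij)
        then show ?thesis unfolding st by (rule resolvent_form_Im_nonneg) (rule diss)
      qed
      show "of_real t \<notin> K" by (rule t)
    qed
    obtain \<tau> :: real where \<tau>: "0 \<notin> numerical_range (pencil A n (of_real \<tau>))" using def by blast
    show "f j = 0"
    proof (rule resolvent_form_zero_imp[OF fd _ \<tau> _ j])
      show "clinear (A i)" if "i \<le> n" for i by (rule A[OF that])
      fix t :: real assume t: "\<not> eigenvalue A n (of_real t)"
      have st: "?s * of_real (of_int \<sigma> * t) = of_real t" using ss'[of "of_real t"] by simp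
      have "of_real (of_int \<sigma> * t) \<notin> K" unfolding K_def mem_Collect_eq st by (rule t)
      from G_zero[OF this] show "?G (of_real t) = 0" unfolding st .
    qed
  qed
  then have "f j = 0" for j using f by (cases "j < l") (auto simp: Hpow_def)
  then show "f = 0" by (simp add: fun_eq_iff)
qed

theorem theorem7p3:
  fixes A :: "nat \<Rightarrow> 'a::complex_inner \<Rightarrow> 'a"
    and l n M :: nat
    and \<Lambda> :: "nat \<Rightarrow> complex"
    and p :: "nat \<Rightarrow> nat"
    and w :: "nat \<Rightarrow> nat \<Rightarrow> 'a"
    and \<epsilon> :: "nat \<Rightarrow> int"
  assumes finite_dim: "cfinite_dim TYPE('a)"
    and degree: "n = 2 * l"
    and linear: "\<And>i. i \<le> n \<Longrightarrow> clinear (A i)"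
    and dissipative: "\<And>x (t::real). Im (cinner (pencil A n (of_real t) x) x) \<le> 0"
    and leading: "{x. A n x = 0} = {0}"
    and definite_point: "\<exists>t::real. 0 \<notin> numerical_range (pencil A n (of_real t))"
    and numbering: "chain_numbering A n M \<Lambda> p w \<epsilon>"
  shows "complete_in_Hpow l (half_system 1 l M \<Lambda> p w \<epsilon>)
       \<and> complete_in_Hpow l (half_system (-1) l M \<Lambda> p w \<epsilon>)"
  by (intro conjI half_system_complete[OF finite_dim degree linear dissipative leading
        definite_point numbering]) simp_all

end
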